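(* Let $f(\cdot;\boldsymbol\lambda)$, $\boldsymbol\lambda\in\boldsymbol\Lambda$, and $\psi(\cdot;\theta)$, $\theta\in\Theta$, be families of probability densities on $\mathcal X\subset\mathbb R^s$, where $\Theta\subset\mathbb R$ is one-dimensional, and let $\boldsymbol\lambda_0$ be the true null parameter. Suppose that: (A1) $\Theta$ is compact and convex (a compact interval); (A2) $\mathbb C(\theta,\theta)<\infty$ for all $\theta\in\Theta$; (A3) for each $\theta\in\Theta$, $\mathrm{supp}[\psi(\cdot;\theta)]\subset\mathrm{supp}[f(\cdot;\boldsymbol\lambda_0)]$; (A4) for all $x\in\mathcal X$, $\psi(x;\theta)$ is twice differentiable in $\theta$, with $\int\frac{\psi'(x;\theta)^2}{f(x;\boldsymbol\lambda_0)}dx<\infty$ and $\int\frac{\psi''(x;\theta)^2}{f(x;\boldsymbol\lambda_0)}dx<\infty$; (A5) $\mathbb C(\theta,\theta)>0$ for all $\theta\in\Theta$; (A6) $\mathbb C^\star(\theta,\theta^\dagger)$ is continuous and $0<\mathbb C^\star(\theta,\theta)<\infty$ for all $\theta\in\Theta$. Let $Z^\star$ be the mean-zero Gaussian random field on $\Theta$ with continuous sample paths and covariance function $\rho^\star$. Then, as $c\to\infty$, $$\mathbb P\Big(\sup_{\theta\in\Theta}Z^\star(\theta)\ge c\Big)=\frac{\kappa_0}{2\pi}\,\mathbb P(\chi^2_2\ge c^2)+\frac{\ell_0}{4}\,\mathbb P(\chi^2_1\ge c^2)+o\big[c^{-1}\exp(-c^2/2)\big]$$ with $$\kappa_0=\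int_\Theta\left.\left[\frac{\partial^2}{\partial\theta\,\partial\theta^\dagger}\rho^\star(\theta,\theta^\dagger)\right]^{1/2}\right|_{\theta^\dagger=\theta}d\theta\qquad\text{and}\qquad\ell_0=2.$$
   Context: $\mathbb C(\theta,\theta^\dagger)=\int\frac{\psi(x;\theta)\psi(x;\theta^\dagger)}{f(x;\boldsymbol\lambda_0)}dx-1$. With $l(\boldsymbol\lambda|x)=\log f(x;\boldsymbol\lambda)$, $\nabla l$ its gradient in $\boldsymbol\lambda$, and $\mathbf I(\boldsymbol\lambda_0)$ the (invertible) Fisher information matrix, let $\mathbb C(\theta|\boldsymbol\lambda_0)=\int\psi(x;\theta)\nabla l(\boldsymbol\lambda_0|x)\,dx$ (a vector), $$\mathbb C^\star(\theta,\theta^\dagger)=\mathbb C(\theta,\theta^\dagger)-\mathbb C^T(\theta|\boldsymbol\lambda_0)[\mathbf I(\boldsymbol\lambda_0)]^{-1}\mathbb C(\theta^\dagger|\boldsymbol\lambda_0),\qquad \rho^\star(\theta,\theta^\dagger)=\frac{\mathbb C^\star(\theta,\theta^\dagger)}{\sqrt{\mathbb C^\star(\theta,\theta)\,\mathbb C^\star(\theta^\dagger,\theta^\dagger)}}.$$ $\chi^2_k$ denotes a chi-squared random variable with $k$ degrees of freedom. Standing geometric assumption: writing $\rho^\star(\theta,\theta^\dagger)=\langle\boldsymbol\xi(\theta),\boldsymbol\xi(\theta^\dagger)\rangle$ through the Karhunen–Loève expansion of $Z^\star$ ($Z^\star(\theta)=\sum_k z_k\xi_k(\theta)$, uniformly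 convergent, $z_k$ i.i.d. standard Gaussian, $\xi_k$ twice continuously differentiable), the curve $\{\boldsymbol\xi(\theta):\theta\in\Theta\}$ on the unit sphere is a one-dimensional manifold with boundary; $\kappa_0$ is its length and $\ell_0$ is its number of end-points.
   Formalization: The curve is taken to be a C² embedded manifold with boundary traversed once (ξ injective on Θ); for a closed curve (e.g. a full circle) ℓ₀ would be 0, and for a curve that retraces itself the integral for κ₀ would exceed its length. *)

theory Defs
  imports "HOL-Probability.Probability" "HOL-Library.Landau_Symbols"
begin

typedef l2 = "{x :: nat \<Rightarrow> real. summable (\<lambda>k. (x k)\<^sup>2)}"
  morphisms coord Abs_l2
  by (rule exI[of _ "\<lambda>_. 0"]) simp

setup_lifting type_definition_l2

lemma summable_coord_sq: "summable (\<lambda>k. (coord x k)\<^sup>2)"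
  using coord[of x] by simp

lemma summable_mult_of_sq:
  fixes x y :: "nat \<Rightarrow> real"
  assumes "summable (\<lambda>k. (x k)\<^sup>2)" "summable (\<lambda>k. (y k)\<^sup>2)"
  shows "summable (\<lambda>k. x k * y k)"
proof (rule summable_comparison_test)
  show "summable (\<lambda>k. (x k)\<^sup>2 + (y k)\<^sup>2)"
    using assms by (rule summable_add)
  have "\<bar>a * b\<bar> \<le> a\<^sup>2 + b\<^sup>2" for a b :: real
  proof -
    have "0 \<le> (\<bar>a\<bar> - \<bar>b\<bar>)\<^sup>2" by simp
    then have "2 * (\<bar>a\<bar> * \<bar>b\<bar>) \<le> a\<^sup>2 + b\<^sup>2" by (simp add: power2_diff)
    moreover have "0 \<le> \<bar>a\<bar> * \<bar>b\<bar>" by simp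
    ultimately show ?thesis unfolding abs_mult by linarith
  qed
  then show "\<exists>N. \<forall>n\<ge>N. norm (x n * y n) \<le> (x n)\<^sup>2 + (y n)\<^sup>2"
    by (metis real_norm_def)
qed

lemma summable_coord_mult: "summable (\<lambda>k. coord x k * coord y k)"
  by (intro summable_mult_of_sq summable_coord_sq)

lemma summable_add_sq:
  fixes x y :: "nat \<Rightarrow> real"
  assumes "summable (\<lambda>k. (x k)\<^sup>2)" "summable (\<lambda>k. (y k)\<^sup>2)"
  shows "summable (\<lambda>k. (x k + y k)\<^sup>2)"
proof -
  have "summable (\<lambda>k. ((x k)\<^sup>2 + (y k)\<^sup>2) + 2 * (x k * y k))"
    using assms by (intro summable_add summable_mult summable_mult_of_sq)
  then show ?thesis by (simp add: power2_sum mult.assoc)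
qed

instantiation l2 :: real_vector
begin

lift_definition zero_l2 :: l2 is "\<lambda>_. 0" by simp

lift_definition uminus_l2 :: "l2 \<Rightarrow> l2" is "\<lambda>x k. - x k" by simp

lift_definition plus_l2 :: "l2 \<Rightarrow> l2 \<Rightarrow> l2" is "\<lambda>x y k. x k + y k"
  by (rule summable_add_sq)

lift_definition minus_l2 :: "l2 \<Rightarrow> l2 \<Rightarrow> l2" is "\<lambda>x y k. x k - y k"
proof -
  fix x y :: "nat \<Rightarrow> real"
  assume "summable (\<lambda>k. (x k)\<^sup>2)" "summable (\<lambda>k. (y k)\<^sup>2)"
  then show "summable (\<lambda>k. (x k - y k)\<^sup>2)"
    using summable_add_sq[of x "\<lambda>k. - y k"] by simp
qed

lift_definition scaleR_l2 :: "real \<Rightarrow> l2 \<Rightarrow> l2" is "\<lambda>r x k. r * x k"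
  by (simp add: power_mult_distrib summable_mult)

instance
  by standard (transfer; simp add: algebra_simps fun_eq_iff)+

end

instantiation l2 :: real_inner
begin

definition inner_l2 :: "l2 \<Rightarrow> l2 \<Rightarrow> real"
  where "inner_l2 x y = (\<Sum>k. coord x k * coord y k)"

definition norm_l2 :: "l2 \<Rightarrow> real"
  where "norm_l2 x = sqrt (inner x x)"

definition sgn_l2 :: "l2 \<Rightarrow> l2"
  where "sgn_l2 x = x /\<^sub>R norm x"

definition dist_l2 :: "l2 \<Rightarrow> l2 \<Rightarrow> real"
  where "dist_l2 x y = norm (x - y)"

definition uniformity_l2 :: "(l2 \<times> l2) filter"
  where "uniformity_l2 = (INF e\<in>{0 <..}. principal {(x, y). dist x y < e})"

definition open_l2 :: "l2 set \<Rightarrow> bool"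
  where "open_l2 U \<longleftrightarrow> (\<forall>x\<in>U. \<forall>\<^sub>F (x', y) in uniformity. x' = x \<longrightarrow> y \<in> U)"

instance
proof
  fix x y z :: l2 and r s :: real and U :: "l2 set"
  show "inner x y = inner y x" by (simp add: inner_l2_def mult.commute)
  show "inner (x + y) z = inner x z + inner y z"
    by (simp add: inner_l2_def plus_l2.rep_eq distrib_right suminf_add summable_coord_mult)
  show "inner (r *\<^sub>R x) y = r * inner x y"
    by (simp add: inner_l2_def scaleR_l2.rep_eq mult.assoc suminf_mult summable_coord_mult)
  show "0 \<le> inner x x"
    by (auto simp: inner_l2_def intro!: suminf_nonneg summable_coord_mult)
  show "inner x x = 0 \<longleftrightarrow> x = 0"
  proof -
    have "inner x x = 0 \<longleftrightarrow> (\<forall>k. coord x k * coord x k = 0)"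
      unfolding inner_l2_def by (rule suminf_eq_zero_iff) (auto intro: summable_coord_mult)
    also have "\<dots> \<longleftrightarrow> coord x = coord 0" by (auto simp: zero_l2.rep_eq)
    finally show ?thesis by (simp add: coord_inject)
  qed
qed (rule norm_l2_def sgn_l2_def dist_l2_def uniformity_l2_def open_l2_def)+

end

definition C2_on :: "real set \<Rightarrow> (real \<Rightarrow> 'a::real_normed_vector) \<Rightarrow> bool" where
  "C2_on S g \<longleftrightarrow> (\<exists>g' g''.
     (\<forall>t\<in>S. (g has_vector_derivative g' t) (at t within S)) \<and>
     (\<forall>t\<in>S. (g' has_vector_derivative g'' t) (at t within S)) \<and>
     continuous_on S g'')"

text \<open>
  Charts are modelled on the half-line. A chart whose domain avoids 0 is a chart around interior
  points, so one notion covers interior and boundary points.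
\<close>

definition half_line_chart :: "'a::real_normed_vector set \<Rightarrow> real set \<Rightarrow> (real \<Rightarrow> 'a) \<Rightarrow> bool" where
  "half_line_chart M J \<phi> \<longleftrightarrow>
     openin (top_of_set {0..}) J \<and> openin (top_of_set M) (\<phi> ` J) \<and>
     (\<exists>\<phi>'. homeomorphism J (\<phi> ` J) \<phi> \<phi>') \<and>
     C2_on J \<phi> \<and> (\<forall>t\<in>J. vector_derivative \<phi> (at t within J) \<noteq> 0)"

definition one_manifold_with_boundary :: "'a::real_normed_vector set \<Rightarrow> bool" where
  "one_manifold_with_boundary M \<longleftrightarrow> (\<forall>p\<in>M. \<exists>J \<phi>. half_line_chart M J \<phi> \<and> p \<in> \<phi> ` J)"

definition end_points :: "'a::real_normed_vector set \<Rightarrow> 'a set" where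
  "end_points M = {\<phi> 0 | J \<phi>. half_line_chart M J \<phi> \<and> 0 \<in> J}"

definition curve_length :: "real set \<Rightarrow> (real \<Rightarrow> 'a::metric_space) \<Rightarrow> ennreal" where
  "curve_length S \<gamma> =
     (SUP ts \<in> {ts. sorted ts \<and> set ts \<subseteq> S}.
        \<Sum>i < length ts - 1. ennreal (dist (\<gamma> (ts ! i)) (\<gamma> (ts ! Suc i))))"

definition density_on :: "'a::euclidean_space set \<Rightarrow> ('a \<Rightarrow> real) \<Rightarrow> bool" where
  "density_on X g \<longleftrightarrow>
     set_integrable lborel X g \<and> (\<forall>x\<in>X. 0 \<le> g x) \<and> (LINT x:X|lborel. g x) = 1"

text \<open>
  Non-topological support: with closures, a density could be positive where the null density
  vanishes, and there the HOL quotient (with x / 0 = 0) would not detect that the ratio is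
  infinite.
\<close>

definition supp_on :: "'a set \<Rightarrow> ('a \<Rightarrow> real) \<Rightarrow> 'a set" where
  "supp_on X g = {x \<in> X. g x \<noteq> 0}"

definition gradient :: "('a::real_inner \<Rightarrow> real) \<Rightarrow> 'a \<Rightarrow> 'a" where
  "gradient g x = (THE D. GDERIV g x :> D)"

definition score ::
  "(real^'p \<Rightarrow> real^'s \<Rightarrow> real) \<Rightarrow> real^'p \<Rightarrow> real^'s \<Rightarrow> real^'p" where
  "score f lam x = gradient (\<lambda>l. ln (f l x)) lam"

definition fisher_info ::
  "(real^'s) set \<Rightarrow> (real^'p \<Rightarrow> real^'s \<Rightarrow> real) \<Rightarrow> real^'p \<Rightarrow> real^'p^'p" where
  "fisher_info X f lam =
     (\<chi> i j. LINT x:X|lborel. score f lam x $ i * score f lam x $ j * f lam x)"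

definition covC ::
  "(real^'s) set \<Rightarrow> (real^'p \<Rightarrow> real^'s \<Rightarrow> real) \<Rightarrow> real^'p \<Rightarrow> (real \<Rightarrow> real^'s \<Rightarrow> real)
     \<Rightarrow> real \<Rightarrow> real \<Rightarrow> real" where
  "covC X f lam0 \<psi> s t = (LINT x:X|lborel. \<psi> s x * \<psi> t x / f lam0 x) - 1"

definition covC_score ::
  "(real^'s) set \<Rightarrow> (real^'p \<Rightarrow> real^'s \<Rightarrow> real) \<Rightarrow> real^'p \<Rightarrow> (real \<Rightarrow> real^'s \<Rightarrow> real)
     \<Rightarrow> real \<Rightarrow> real^'p" where
  "covC_score X f lam0 \<psi> t = (LINT x:X|lborel. \<psi> t x *\<^sub>R score f lam0 x)"

definition covC_star ::
  "(real^'s) set \<Rightarrow> (real^'p \<Rightarrow> real^'s \<Rightarrow> real) \<Rightarrow> real^'p \<Rightarrow> (real \<Rightarrow> real^'s \<Rightarrow> real)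
     \<Rightarrow> real \<Rightarrow> real \<Rightarrow> real" where
  "covC_star X f lam0 \<psi> s t =
     covC X f lam0 \<psi> s t
     - covC_score X f lam0 \<psi> s \<bullet> (matrix_inv (fisher_info X f lam0) *v covC_score X f lam0 \<psi> t)"

definition rho_star ::
  "(real^'s) set \<Rightarrow> (real^'p \<Rightarrow> real^'s \<Rightarrow> real) \<Rightarrow> real^'p \<Rightarrow> (real \<Rightarrow> real^'s \<Rightarrow> real)
     \<Rightarrow> real \<Rightarrow> real \<Rightarrow> real" where
  "rho_star X f lam0 \<psi> s t =
     covC_star X f lam0 \<psi> s t / sqrt (covC_star X f lam0 \<psi> s s * covC_star X f lam0 \<psi> t t)"

text \<open>Derivatives in the parameter are relative to its range, hence one-sided at its two ends.\<close>

definition deriv_on :: "real set \<Rightarrow> (real \<Rightarrow> real) \<Rightarrow> real \<Rightarrow> real" where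
  "deriv_on S g t = vector_derivative g (at t within S)"

definition mixed_deriv_on :: "real set \<Rightarrow> (real \<Rightarrow> real \<Rightarrow> real) \<Rightarrow> real \<Rightarrow> real \<Rightarrow> real" where
  "mixed_deriv_on S r s t = deriv_on S (\<lambda>s'. deriv_on S (\<lambda>t'. r s' t') t) s"

text \<open>Point masses count as Gaussian.\<close>

definition gaussian_var :: "'w measure \<Rightarrow> ('w \<Rightarrow> real) \<Rightarrow> bool" where
  "gaussian_var P Y \<longleftrightarrow> (\<exists>\<mu>.
     (Y \<in> borel_measurable P \<and> (AE \<omega> in P. Y \<omega> = \<mu>)) \<or>
     (\<exists>\<sigma>>0. distributed P lborel Y (normal_density \<mu> \<sigma>)))"

definition gaussian_process :: "'w measure \<Rightarrow> 't set \<Rightarrow> ('t \<Rightarrow> 'w \<Rightarrow> real) \<Rightarrow> bool" where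
  "gaussian_process P T Z \<longleftrightarrow>
     (\<forall>I a. finite I \<and> I \<subseteq> T \<longrightarrow> gaussian_var P (\<lambda>\<omega>. \<Sum>t\<in>I. a t * Z t \<omega>))"

definition chi_squared :: "nat \<Rightarrow> real measure" where
  "chi_squared k =
     distr (\<Pi>\<^sub>M i\<in>{..<k}. std_normal_distribution) borel (\<lambda>x. \<Sum>i<k. (x i)\<^sup>2)"

text \<open>
  Expansion of Z over the coordinates of \<xi>. The index set K may be finite or infinite, so finite
  expansions need only finitely many Gaussian variables.
\<close>

definition karhunen_loeve ::
  "'w measure \<Rightarrow> real set \<Rightarrow> (real \<Rightarrow> 'w \<Rightarrow> real) \<Rightarrow> nat set \<Rightarrow> (nat \<Rightarrow> 'w \<Rightarrow> real)
     \<Rightarrow> (real \<Rightarrow> l2) \<Rightarrow> bool" where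
  "karhunen_loeve P T Z K z \<xi> \<longleftrightarrow>
     prob_space.indep_vars P (\<lambda>_. borel) z K \<and>
     (\<forall>k\<in>K. distributed P lborel (z k) std_normal_density) \<and>
     (\<forall>t\<in>T. \<forall>k. k \<notin> K \<longrightarrow> coord (\<xi> t) k = 0) \<and>
     (\<forall>k. C2_on T (\<lambda>t. coord (\<xi> t) k)) \<and>
     (AE \<omega> in P. uniform_limit T (\<lambda>n t. \<Sum>k<n. z k \<omega> * coord (\<xi> t) k) (\<lambda>t. Z t \<omega>) sequentially)"

end

theory Submission
  imports Defs "HOL-Real_Asymp.Real_Asymp"
begin

text \<open>
  Upper bound. On a grid, the maximum exceeds \<open>c\<close> only if the process starts above \<open>c\<close> or crosses
  \<open>c\<close> upwards between two neighbouring nodes. If \<open>d\<close> is the chord between the two points of the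
  curve, the upcrossing has probability at most \<open>d / (2 pi) exp (- c\<^sup>2 / 2)\<close> up to a factor that tends
  to 1 with the mesh, and the chords add up to at most the length of the curve.

  Lower bound. By Bonferroni's inequality the same sum, for a grid with about \<open>c\<^sup>2\<close> nodes, is a lower
  bound up to the probabilities of pairs of such events. Each pair forces the process to be above,
  below and above \<open>c\<close> at three successive points, which is exponentially less likely than a single
  exceedance: some combination \<open>x p + y r - z q\<close> of the three unit vectors with nonnegative weights
  and \<open>x + y - z = 1\<close> has norm bounded away from 1. For distant points the midpoint of the two outer
  ones will do; for close points one adds to the middle point a small multiple of the second divided
  difference, which points into the ball because the curve lies on the unit sphere. Polynomially many
  pairs therefore contribute a negligible amount.

  The expansion is only assumed coordinatewise smooth; the charts of the manifold make the curve
  twice differentiable in norm, which gives the length formula and the rate of the chord sums.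
\<close>

section \<open>Jointly Gaussian pairs\<close>

text \<open>Both chi-squared tails are explicit: two degrees of freedom give exp(-c^2/2), one gives
  twice the normal tail. With two end-points the second term of the expansion is therefore exactly
  the probability of starting above c, although the formula treats both ends alike. The upper bound
  then holds with no error term, and the whole error comes from the lower bound, where it must be
  o(1/c) relative to exp(-c^2/2). The chord sum of a grid with n cells misses the length by O(1/n),
  and each upcrossing estimate loses a factor 1 - O(c^2/n^2). With n near c^2 both losses are
  O(1/c^2), while the number of pairs, of order n^2, only multiplies exp(-c^2/(2w)) with w < 1. The
  obstacle in the geometry is that the derivative of the curve in its parameter is not assumed to be
  nonzero, so chords have no lower bound linear in the parameter distance. Close triples are
  therefore treated in chart coordinates, where the derivative does not vanish, and carried back by
  a monotone change of parameter.\<close>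

lemma weighted_std_normal:
  fixes U g :: "'w \<Rightarrow> real"
  assumes "prob_space M" and [measurable]: "U \<in> borel_measurable M" "g \<in> borel_measurable M"
    and g: "\<And>\<omega>. 0 \<le> g \<omega>" "\<And>\<omega>. g \<omega> \<le> B" and m: "m > 0"
    and chr: "\<And>a. (CLINT \<omega>|M. complex_of_real (g \<omega>) * iexp (a * U \<omega>)) = complex_of_real (m * exp (- a\<^sup>2 / 2))"
    and A[measurable]: "A \<in> sets borel"
  shows "(LINT \<omega>|M. g \<omega> * indicator A (U \<omega>)) = m * measure std_normal_distribution A"
proof -
  interpret prob_space M by fact
  have int_g: "integrable M g"
    by (rule integrable_const_bound[of _ B]) (use g in auto)
  have "complex_of_real (LINT \<omega>|M. g \<omega>) = complex_of_real m"
    using chr[of 0] by simp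
  then have g_m: "(LINT \<omega>|M. g \<omega>) = m" using of_real_eq_iff by blast
  \<comment> \<open>The hypothesis \<open>chr\<close> at frequency 0 says that \<open>m\<close> is
    the total mass of \<open>g\<close>. After normalisation \<open>U\<close> has the standard normal
    characteristic function under the reweighted measure.\<close>
  define D where "D = density M (\<lambda>\<omega>. ennreal (g \<omega> / m))"
  have [simp]: "space D = space M" "sets D = sets M" by (auto simp: D_def)
  have [measurable]: "U \<in> borel_measurable D" by (simp add: D_def)
  have "emeasure D (space D) = (\<integral>\<^sup>+\<omega>. ennreal (g \<omega> / m) \<partial>M)"
    unfolding D_def by (subst emeasure_density) (auto intro!: nn_integral_cong)
  also have "\<dots> = ennreal (LINT \<omega>|M. g \<omega> / m)"
    by (intro nn_integral_eq_integral) (use int_g g m in auto)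
  also have "\<dots> = 1" using g_m m by simp
  finally interpret D: prob_space D by (intro prob_spaceI) simp
  define N where "N = distr D borel U"
  have rd: "real_distribution N"
    unfolding N_def by (rule D.real_distribution_distr) simp
  have "char N = char std_normal_distribution"
  proof
    fix t
    have "char N t = (CLINT \<omega>|D. iexp (t * U \<omega>))"
      unfolding char_def N_def by (subst integral_distr) auto
    also have "\<dots> = (CLINT \<omega>|M. (g \<omega> / m) *\<^sub>R iexp (t * U \<omega>))"
      unfolding D_def by (subst integral_density) (use g m in auto)
    also have "\<dots> = (CLINT \<omega>|M. (complex_of_real (g \<omega>) * iexp (t * U \<omega>)) / m)"
      by (intro Bochner_Integration.integral_cong) (auto simp: scaleR_conv_of_real)
    also have "\<dots> = exp (- t\<^sup>2 / 2)"
      using m chr[of t] by simp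
    finally show "char N t = char std_normal_distribution t"
      by (simp add: char_std_normal_distribution)
  qed
  then have eq: "N = std_normal_distribution"
    by (intro Levy_uniqueness rd real_dist_normal_dist)
  have "measure std_normal_distribution A = (LINT x|N. indicator A x)"
    using eq rd by simp
  also have "\<dots> = (LINT \<omega>|D. indicator A (U \<omega>))"
    unfolding N_def by (subst integral_distr) auto
  also have "\<dots> = (LINT \<omega>|M. (g \<omega> / m) *\<^sub>R indicator A (U \<omega>))"
    unfolding D_def by (subst integral_density) (use g m in auto)
  also have "\<dots> = (LINT \<omega>|M. g \<omega> * indicator A (U \<omega>)) / m"
    by (simp add: mult_ac)
  finally show ?thesis using m by simp
qed

text \<open>
  A Cramer-Wold argument by two applications of one-dimensional Levy uniqueness: the weights
  \<open>1 + cos (b W)\<close> and \<open>1 + sin (b W)\<close> turn the joint characteristic function into that of a positive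
  measure in the first variable, and the indicator of \<open>U \<in> A\<close> then does the same in the second.
\<close>

lemma std_normal_pair_distr:
  fixes U W :: "'w \<Rightarrow> real"
  assumes "prob_space M" and [measurable]: "U \<in> borel_measurable M" "W \<in> borel_measurable M"
    and chr: "\<And>a b. (CLINT \<omega>|M. iexp (a * U \<omega> + b * W \<omega>)) = complex_of_real (exp (- (a\<^sup>2 + b\<^sup>2) / 2))"
  shows "distr M (borel \<Otimes>\<^sub>M borel) (\<lambda>\<omega>. (U \<omega>, W \<omega>)) = std_normal_distribution \<Otimes>\<^sub>M std_normal_distribution"
proof -
  interpret prob_space M by fact
  let ?N = "measure std_normal_distribution"
  interpret N: real_distribution std_normal_distribution by (rule real_dist_normal_dist)
  have int_iexp: "integrable M (\<lambda>\<omega>. iexp (a * U \<omega> + b * W \<omega>))" for a b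
    by (rule integrable_iexp) auto
  have int_iexp2: "integrable M (\<lambda>\<omega>. exp (\<i> * (a * complex_of_real (U \<omega>) + b * complex_of_real (W \<omega>))))" for a b :: real
    using int_iexp[of a b] by simp
  note chr2 = chr[simplified]
  have c1: "(LINT \<omega>|M. (1 + cos (b * W \<omega>)) * indicator A (U \<omega>)) = (1 + exp (- b\<^sup>2 / 2)) * ?N A"
    if [measurable]: "A \<in> sets borel" for A b
  proof (rule weighted_std_normal[OF assms(1), where B = 2])
    show "0 \<le> 1 + cos (b * W \<omega>)" for \<omega> using cos_ge_minus_one[of "b * W \<omega>"] by linarith
    show "0 < 1 + exp (- b\<^sup>2 / 2)" by (simp add: add_pos_pos)
    fix a :: real
    have "(CLINT \<omega>|M. complex_of_real (1 + cos (b * W \<omega>)) * iexp (a * U \<omega>))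
      = (CLINT \<omega>|M. iexp (a * U \<omega> + 0 * W \<omega>) + (iexp (a * U \<omega> + b * W \<omega>) + iexp (a * U \<omega> + (-b) * W \<omega>)) / 2)"
      by (intro Bochner_Integration.integral_cong)
        (auto simp: cos_of_real[symmetric] cos_exp_eq algebra_simps simp flip: exp_add)
    also have "\<dots> = (CLINT \<omega>|M. iexp (a * U \<omega> + 0 * W \<omega>)) +
       ((CLINT \<omega>|M. iexp (a * U \<omega> + b * W \<omega>)) + (CLINT \<omega>|M. iexp (a * U \<omega> + (-b) * W \<omega>))) / 2"
      using int_iexp[of a 0] int_iexp[of a b] int_iexp[of a "-b"]
      by (auto simp del: of_real_add of_real_mult exp_of_real)
    also have "\<dots> = exp (- a\<^sup>2 / 2) + (exp (- (a\<^sup>2 + b\<^sup>2) / 2) + exp (- (a\<^sup>2 + b\<^sup>2) / 2)) / 2"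
      unfolding chr by simp
    also have "\<dots> = (1 + exp (- b\<^sup>2 / 2)) * exp (- a\<^sup>2 / 2)"
      by (simp add: algebra_simps add_divide_distrib diff_divide_distrib flip: exp_add)
    finally show "(CLINT \<omega>|M. complex_of_real (1 + cos (b * W \<omega>)) * iexp (a * U \<omega>)) = \<dots>" .
  qed auto
  have s1: "(LINT \<omega>|M. (1 + sin (b * W \<omega>)) * indicator A (U \<omega>)) = 1 * ?N A"
    if [measurable]: "A \<in> sets borel" for A b
  proof (rule weighted_std_normal[OF assms(1), where B = 2])
    show "0 \<le> 1 + sin (b * W \<omega>)" for \<omega> using sin_ge_minus_one[of "b * W \<omega>"] by linarith
    fix a :: real
    have "(CLINT \<omega>|M. complex_of_real (1 + sin (b * W \<omega>)) * iexp (a * U \<omega>))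
      = (CLINT \<omega>|M. iexp (a * U \<omega> + 0 * W \<omega>) + (iexp (a * U \<omega> + b * W \<omega>) - iexp (a * U \<omega> + (-b) * W \<omega>)) / (2 * \<i>))"
      by (intro Bochner_Integration.integral_cong)
        (auto simp: sin_of_real[symmetric] sin_exp_eq algebra_simps diff_divide_distrib simp flip: exp_add)
    also have "\<dots> = (CLINT \<omega>|M. iexp (a * U \<omega> + 0 * W \<omega>)) +
       ((CLINT \<omega>|M. iexp (a * U \<omega> + b * W \<omega>)) - (CLINT \<omega>|M. iexp (a * U \<omega> + (-b) * W \<omega>))) / (2 * \<i>)"
      using int_iexp[of a 0] int_iexp[of a b] int_iexp[of a "-b"]
      by (auto simp del: of_real_add of_real_mult exp_of_real)
    also have "\<dots> = 1 * exp (- a\<^sup>2 / 2)"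
      unfolding chr by simp
    finally show "(CLINT \<omega>|M. complex_of_real (1 + sin (b * W \<omega>)) * iexp (a * U \<omega>)) = \<dots>"
      by simp
  qed auto
  have ind_U: "(LINT \<omega>|M. indicator A (U \<omega>)) = ?N A" if "A \<in> sets borel" for A
    using s1[OF that, of 0] by simp
  have int_ind: "integrable M (\<lambda>\<omega>. f (W \<omega>) * indicator A (U \<omega>) :: real)"
    if [measurable]: "A \<in> sets borel" "f \<in> borel_measurable borel" and "\<And>x. \<bar>f x\<bar> \<le> 1" for A f
    by (rule integrable_const_bound[of _ 1]) (use that(3) in \<open>auto simp: abs_mult indicator_def\<close>)
  have int_i: "integrable M (\<lambda>\<omega>. indicator A (U \<omega>) :: real)" if "A \<in> sets borel" for A
    using int_ind[OF that, of "\<lambda>_. 1"] by simp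
  \<comment> \<open>Removing the constant part of the weights isolates the Fourier coefficients of
    \<open>W\<close> on the event that \<open>U\<close> lies in \<open>A\<close>. They factor, and
    the sine part vanishes.\<close>
  have c2: "(LINT \<omega>|M. cos (b * W \<omega>) * indicator A (U \<omega>)) = exp (- b\<^sup>2 / 2) * ?N A"
    if A: "A \<in> sets borel" for A b
    using c1[OF A, of b] int_i[OF A] int_ind[OF A, of "\<lambda>x. cos (b * x)"] ind_U[OF A]
    by (simp add: distrib_right)
  have s2: "(LINT \<omega>|M. sin (b * W \<omega>) * indicator A (U \<omega>)) = 0"
    if A: "A \<in> sets borel" for A b
    using s1[OF A, of b] int_i[OF A] int_ind[OF A, of "\<lambda>x. sin (b * x)"] ind_U[OF A]
    by (simp add: distrib_right)
  have AB: "(LINT \<omega>|M. indicator A (U \<omega>) * indicator B (W \<omega>)) = ?N A * ?N B"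
    if A[measurable]: "A \<in> sets borel" and B[measurable]: "B \<in> sets borel" for A B
  proof (cases "?N A = 0")
    \<comment> \<open>A weight of total mass zero cannot be normalised, so this case is settled by
      domination.\<close>
    case True
    have "0 \<le> (LINT \<omega>|M. indicator A (U \<omega>) * indicator B (W \<omega>) :: real)"
      by (intro integral_nonneg_AE) auto
    moreover have "(LINT \<omega>|M. indicator A (U \<omega>) * indicator B (W \<omega>)) \<le> (LINT \<omega>|M. indicator A (U \<omega>) :: real)"
      using int_i[OF A] int_ind[OF A, of "indicator B"]
      by (intro integral_mono) (auto simp: indicator_def mult_ac)
    ultimately show ?thesis unfolding True ind_U[OF A] mult_zero_left by (rule antisym[rotated])
  next
    case False
    show ?thesis
    proof (rule weighted_std_normal[OF assms(1), where B = 1])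
      show "0 < ?N A" using False by (simp add: zero_less_measure_iff)
      fix a :: real
      have "(CLINT \<omega>|M. complex_of_real (indicator A (U \<omega>)) * iexp (a * W \<omega>))
        = (CLINT \<omega>|M. complex_of_real (cos (a * W \<omega>) * indicator A (U \<omega>)) + \<i> * complex_of_real (sin (a * W \<omega>) * indicator A (U \<omega>)))"
        by (intro Bochner_Integration.integral_cong)
            (auto simp: Euler cos_of_real sin_of_real distrib_left distrib_right mult_ac simp flip: of_real_mult)
      also have "\<dots> = (CLINT \<omega>|M. complex_of_real (cos (a * W \<omega>) * indicator A (U \<omega>))) + \<i> * (CLINT \<omega>|M. complex_of_real (sin (a * W \<omega>) * indicator A (U \<omega>)))"
        using int_ind[OF A, of "\<lambda>x. cos (a * x)"] int_ind[OF A, of "\<lambda>x. sin (a * x)"]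
        by (subst Bochner_Integration.integral_add) (auto simp del: of_real_mult)
      also have "\<dots> = complex_of_real (?N A * exp (- a\<^sup>2 / 2))"
        unfolding integral_complex_of_real c2[OF A] s2[OF A] by simp
      finally show "(CLINT \<omega>|M. complex_of_real (indicator A (U \<omega>)) * iexp (a * W \<omega>)) = \<dots>" .
    qed (auto simp: indicator_def)
  qed
  show ?thesis
  proof (rule pair_measure_eqI[symmetric])
    fix A B assume "A \<in> sets std_normal_distribution" "B \<in> sets std_normal_distribution"
    then have [measurable]: "A \<in> sets borel" "B \<in> sets borel" by auto
    have "measure M ((\<lambda>\<omega>. (U \<omega>, W \<omega>)) -` (A \<times> B) \<inter> space M) = (LINT \<omega>|M. indicator ((\<lambda>\<omega>. (U \<omega>, W \<omega>)) -` (A \<times> B) \<inter> space M) \<omega>)"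
      by simp
    also have "\<dots> = (LINT \<omega>|M. indicator A (U \<omega>) * indicator B (W \<omega>))"
      by (intro Bochner_Integration.integral_cong) (auto simp: indicator_def)
    also have "\<dots> = ?N A * ?N B" by (rule AB) auto
    finally show "emeasure std_normal_distribution A * emeasure std_normal_distribution B =
      emeasure (distr M (borel \<Otimes>\<^sub>M borel) (\<lambda>\<omega>. (U \<omega>, W \<omega>))) (A \<times> B)"
      by (subst emeasure_distr) (auto simp: emeasure_eq_measure N.emeasure_eq_measure ennreal_mult)
  qed (auto intro!: N.sigma_finite_measure_axioms cong: sets_pair_measure_cong)
qed

section \<open>Gaussian integrals over half-lines, windows and plane sectors\<close>

lemma nn_integral_even:
  fixes f :: "real \<Rightarrow> ennreal"
  assumes [measurable]: "f \<in> borel_measurable borel" and even: "\<And>x. f (- x) = f x"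
  shows "(\<integral>\<^sup>+x. f x \<partial>lborel) = 2 * (\<integral>\<^sup>+x. f x * indicator {0..} x \<partial>lborel)"
proof -
  have "(\<integral>\<^sup>+x. f x * indicator {..<0} x \<partial>lborel) = (\<integral>\<^sup>+x. f (- x) * indicator {..<0} (- x) \<partial>lborel)"
    by (subst nn_integral_real_affine[where t = 0 and c = "-1"]) auto
  also have "\<dots> = (\<integral>\<^sup>+x. f x * indicator {0..} x \<partial>lborel)"
    by (intro nn_integral_cong_AE AE_I[where N = "{0}"]) (auto simp: even split: split_indicator_asm split_indicator)
  finally have neg: "(\<integral>\<^sup>+x. f x * indicator {..<0} x \<partial>lborel) = \<dots>" .
  have "(\<integral>\<^sup>+x. f x \<partial>lborel) = (\<integral>\<^sup>+x. f x * indicator {..<0} x + f x * indicator {0..} x \<partial>lborel)"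
    by (intro nn_integral_cong) (auto split: split_indicator)
  also have "\<dots> = (\<integral>\<^sup>+x. f x * indicator {..<0} x \<partial>lborel) + (\<integral>\<^sup>+x. f x * indicator {0..} x \<partial>lborel)"
    by (subst nn_integral_add) auto
  also have "\<dots> = 2 * (\<integral>\<^sup>+x. f x * indicator {0..} x \<partial>lborel)"
    unfolding neg by (simp add: mult_2)
  finally show ?thesis .
qed

text \<open>The factor \<open>x\<close> makes the integrand an exact derivative. The rate
  \<open>k\<close> is 1 for the upper bounds, 1 + \<tau>^2 for the lower bound on a sector and 1 +
  s^2 for the chi-squared tail.\<close>

lemma nn_integral_gaussian_tail:
  fixes c k :: real
  assumes k: "k > 0" and c: "c \<ge> 0"
  shows "(\<integral>\<^sup>+x. ennreal (x * exp (- (k * x\<^sup>2) / 2)) * indicator {c..} x \<partial>lborel) = ennreal (exp (- (k * c\<^sup>2) / 2) / k)"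
proof -
  have "((\<lambda>x. - exp (- (k * x\<^sup>2) / 2) / k) \<longlongrightarrow> - 0 / k) at_top"
  proof (intro tendsto_intros filterlim_compose[OF exp_at_bot])
    have "LIM x at_top. (k / 2) * x\<^sup>2 :> at_top"
      using k by (intro filterlim_tendsto_pos_mult_at_top[OF tendsto_const] filterlim_pow_at_top filterlim_ident) auto
    then show "LIM x at_top. - (k * x\<^sup>2) / 2 :> at_bot"
      by (simp add: filterlim_uminus_at_top)
  qed (use k in auto)
  then have "(\<integral>\<^sup>+x. ennreal (x * exp (- (k * x\<^sup>2) / 2)) * indicator {c..} x \<partial>lborel) = ennreal (0 - (- exp (- (k * c\<^sup>2) / 2) / k))"
    using k c by (intro nn_integral_FTC_atLeast) (auto intro!: derivative_eq_intros simp: field_simps)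
  then show ?thesis by simp
qed

lemma std_normal_uminus: "distr std_normal_distribution borel uminus = std_normal_distribution"
proof (rule Levy_uniqueness)
  interpret real_distribution std_normal_distribution by (rule real_dist_normal_dist)
  show "real_distribution (distr std_normal_distribution borel uminus)"
    by (rule real_distribution_distr) simp
  have "char (distr std_normal_distribution borel uminus) t = char std_normal_distribution (- t)" for t
    unfolding char_def by (subst integral_distr) auto
  then show "char (distr std_normal_distribution borel uminus) = char std_normal_distribution"
    by (simp add: char_std_normal_distribution fun_eq_iff)
qed (rule real_dist_normal_dist)

abbreviation normal_tail :: "real \<Rightarrow> real" where
  "normal_tail c \<equiv> measure std_normal_distribution {c..}"

text \<open>For x >= 1 the density is at most x exp(-x^2/2), which integrates exactly. The crude
  constant is harmless: the bound serves only for events that are exponentially rarer than a single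
  exceedance.\<close>

lemma std_normal_tail_le:
  assumes "c \<ge> 1"
  shows "normal_tail c \<le> exp (- c\<^sup>2 / 2)"
proof -
  interpret N: real_distribution std_normal_distribution by (rule real_dist_normal_dist)
  have "emeasure std_normal_distribution {c..} = (\<integral>\<^sup>+x. ennreal (std_normal_density x) * indicator {c..} x \<partial>lborel)"
    by (rule emeasure_density) auto
  also have "\<dots> \<le> (\<integral>\<^sup>+x. ennreal (x * exp (- (1 * x\<^sup>2) / 2)) * indicator {c..} x \<partial>lborel)"
  proof (intro nn_integral_mono)
    fix x :: real
    have "std_normal_density x \<le> x * exp (- (1 * x\<^sup>2) / 2)" if "c \<le> x"
    proof -
      have "1 \<le> sqrt (2 * pi)" using pi_gt3 by (simp add: real_le_rsqrt)
      then have "1 / sqrt (2 * pi) \<le> x" using that assms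
        by (smt (verit) divide_le_eq_1)
      then show ?thesis unfolding std_normal_density_def
        by (intro mult_mono) (use that assms in auto)
    qed
    then show "ennreal (std_normal_density x) * indicator {c..} x \<le> ennreal (x * exp (- (1 * x\<^sup>2) / 2)) * indicator {c..} x"
      by (auto split: split_indicator intro!: ennreal_leI)
  qed
  also have "\<dots> = ennreal (exp (- c\<^sup>2 / 2))"
    using assms by (subst nn_integral_gaussian_tail) auto
  finally show ?thesis by (simp add: N.emeasure_eq_measure)
qed

lemma std_normal_window:
  fixes y :: real
  assumes "y \<ge> 0"
  shows "emeasure std_normal_distribution {- y..<y} \<le> ennreal (2 * y / sqrt (2 * pi))"
    and "ennreal (2 * y / sqrt (2 * pi) * exp (- y\<^sup>2 / 2)) \<le> emeasure std_normal_distribution {- y..<y}"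
proof -
  have e: "emeasure std_normal_distribution {-y..<y} = (\<integral>\<^sup>+x. ennreal (std_normal_density x) * indicator {-y..<y} x \<partial>lborel)"
    by (rule emeasure_density) auto
  have c: "(\<integral>\<^sup>+x. ennreal a * indicator {-y..<y} x \<partial>lborel) = ennreal (2 * y * a)" if "a \<ge> 0" for a
    using assms that by (subst nn_integral_cmult) (auto simp: ennreal_mult[symmetric] mult_ac)
  show "emeasure std_normal_distribution {- y..<y} \<le> ennreal (2 * y / sqrt (2 * pi))"
  proof -
    have "emeasure std_normal_distribution {-y..<y} \<le> (\<integral>\<^sup>+x. ennreal (1 / sqrt (2 * pi)) * indicator {-y..<y} x \<partial>lborel)"
      unfolding e by (intro nn_integral_mono) (auto intro!: ennreal_leI simp: std_normal_density_def divide_right_mono split: split_indicator)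
    also have "\<dots> = ennreal (2 * y / sqrt (2 * pi))" by (subst c) auto
    finally show ?thesis .
  qed
  have le: "std_normal_density x \<ge> 1 / sqrt (2 * pi) * exp (- y\<^sup>2 / 2)" if "x \<in> {-y..<y}" for x
  proof -
    have "x\<^sup>2 \<le> y\<^sup>2" using that assms by (auto simp: abs_le_square_iff[symmetric])
    then show ?thesis by (auto simp: std_normal_density_def divide_right_mono)
  qed
  have "ennreal (2 * y / sqrt (2 * pi) * exp (- y\<^sup>2 / 2)) =
    (\<integral>\<^sup>+x. ennreal (1 / sqrt (2 * pi) * exp (- y\<^sup>2 / 2)) * indicator {-y..<y} x \<partial>lborel)"
    by (subst c) auto
  also have "\<dots> \<le> emeasure std_normal_distribution {- y..<y}"
    unfolding e using le by (intro nn_integral_mono) (auto split: split_indicator intro!: ennreal_leI)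
  finally show "ennreal (2 * y / sqrt (2 * pi) * exp (- y\<^sup>2 / 2)) \<le> emeasure std_normal_distribution {- y..<y}" .
qed

text \<open>A plane sector of half-angle arctan \<tau> about the first axis, cut off at first
  coordinate \<open>c\<close>. One edge is closed and the other open because the set arises as a
  difference of two sets with strict upper edges.\<close>

definition wedge :: "real \<Rightarrow> real \<Rightarrow> (real \<times> real) set" where
  "wedge \<tau> c = {(x, y). c \<le> x \<and> - (\<tau> * x) \<le> y \<and> y < \<tau> * x}"

lemma wedge_sets [measurable]: "wedge \<tau> c \<in> sets (borel \<Otimes>\<^sub>M borel)"
proof -
  have "{p \<in> space (borel \<Otimes>\<^sub>M borel). c \<le> fst p \<and> - (\<tau> * fst p) \<le> snd p \<and> snd p < \<tau> * fst p} \<in> sets (borel \<Otimes>\<^sub>M borel)"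
    by measurable
  also have "{p \<in> space (borel \<Otimes>\<^sub>M borel). c \<le> fst p \<and> - (\<tau> * fst p) \<le> snd p \<and> snd p < \<tau> * fst p} = wedge \<tau> c"
    by (auto simp: wedge_def space_pair_measure)
  finally show ?thesis .
qed

text \<open>The fibre over x is a window of half-width \<tau> x, whose normal mass is 2 \<tau> x /
  sqrt (2 pi) up to a factor between exp(-(\<tau> x)^2/2) and 1. The factor x from the window makes
  the outer integral elementary; in the lower bound the extra exponential changes the rate from 1 to
  1 + \<tau>^2.\<close>

lemma std_normal_wedge:
  fixes \<tau> c :: real
  assumes "\<tau> \<ge> 0" "c \<ge> 0"
  shows "measure (std_normal_distribution \<Otimes>\<^sub>M std_normal_distribution) (wedge \<tau> c) \<le> \<tau> / pi * exp (- c\<^sup>2 / 2)"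
    and "\<tau> / pi * exp (- ((1 + \<tau>\<^sup>2) * c\<^sup>2) / 2) / (1 + \<tau>\<^sup>2)
      \<le> measure (std_normal_distribution \<Otimes>\<^sub>M std_normal_distribution) (wedge \<tau> c)"
proof -
  interpret N: real_distribution std_normal_distribution by (rule real_dist_normal_dist)
  interpret NN: pair_prob_space std_normal_distribution std_normal_distribution ..
  let ?N = std_normal_distribution
  have sq: "sqrt (2 * pi) * sqrt (2 * pi) = 2 * pi" by simp
  have sets_NN: "sets (?N \<Otimes>\<^sub>M ?N) = sets (borel \<Otimes>\<^sub>M borel)" by (intro sets_pair_measure_cong) auto
  have "emeasure (?N \<Otimes>\<^sub>M ?N) (wedge \<tau> c) = (\<integral>\<^sup>+x. emeasure ?N (Pair x -` wedge \<tau> c) \<partial>?N)"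
    by (subst N.emeasure_pair_measure_alt) (auto simp: sets_NN)
  also have "\<dots> = (\<integral>\<^sup>+x. indicator {c..} x * emeasure ?N {-(\<tau> * x)..<\<tau> * x} \<partial>?N)"
    by (intro nn_integral_cong) (auto simp: wedge_def vimage_def atLeastLessThan_def atLeast_def lessThan_def Int_def split: split_indicator)
  also have "\<dots> = (\<integral>\<^sup>+x. ennreal (std_normal_density x) * (indicator {c..} x * emeasure ?N {-(\<tau> * x)..<\<tau> * x}) \<partial>lborel)"
  proof (rule nn_integral_density)
    have "(\<lambda>x. emeasure ?N {y \<in> space ?N. -(\<tau> * x) \<le> y \<and> y < \<tau> * x}) \<in> borel_measurable borel"
      by measurable
    also have "(\<lambda>x. emeasure ?N {y \<in> space ?N. -(\<tau> * x) \<le> y \<and> y < \<tau> * x}) = (\<lambda>x. emeasure ?N {-(\<tau> * x)..<\<tau> * x})"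
      by (intro ext arg_cong2[where f = emeasure]) auto
    finally show "(\<lambda>x. indicator {c..} x * emeasure ?N {-(\<tau> * x)..<\<tau> * x}) \<in> borel_measurable lborel"
      by (intro borel_measurable_times_ennreal borel_measurable_indicator) auto
  qed auto
  finally have e: "emeasure (?N \<Otimes>\<^sub>M ?N) (wedge \<tau> c) = \<dots>" .
  have win: "\<tau> * x \<ge> 0" if "c \<le> x" for x using that assms by auto
  have "emeasure (?N \<Otimes>\<^sub>M ?N) (wedge \<tau> c) \<le> (\<integral>\<^sup>+x. ennreal (\<tau> / pi) * (ennreal (x * exp (- (1 * x\<^sup>2) / 2)) * indicator {c..} x) \<partial>lborel)"
    unfolding e
  proof (intro nn_integral_mono)
    fix x :: real
    have "ennreal (std_normal_density x) * emeasure ?N {-(\<tau> * x)..<\<tau> * x} \<le> ennreal (\<tau> / pi) * ennreal (x * exp (- (1 * x\<^sup>2) / 2))" if "c \<le> x"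
    proof -
      have "ennreal (std_normal_density x) * emeasure ?N {-(\<tau> * x)..<\<tau> * x} \<le> ennreal (std_normal_density x) * ennreal (2 * (\<tau> * x) / sqrt (2 * pi))"
        using std_normal_window(1)[OF win[OF that]] by (rule mult_left_mono) simp
      also have "\<dots> = ennreal (\<tau> / pi) * ennreal (x * exp (- (1 * x\<^sup>2) / 2))"
        using assms win[OF that] that sq by (auto simp: ennreal_mult[symmetric] std_normal_density_def)
      finally show ?thesis .
    qed
    then show "ennreal (std_normal_density x) * (indicator {c..} x * emeasure ?N {-(\<tau> * x)..<\<tau> * x}) \<le> ennreal (\<tau> / pi) * (ennreal (x * exp (- (1 * x\<^sup>2) / 2)) * indicator {c..} x)"
      by (auto split: split_indicator)
  qed
  also have "\<dots> = ennreal (\<tau> / pi * exp (- c\<^sup>2 / 2))"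
    using assms by (subst nn_integral_cmult, simp, subst nn_integral_gaussian_tail) (auto simp: ennreal_mult[symmetric])
  finally show "measure (?N \<Otimes>\<^sub>M ?N) (wedge \<tau> c) \<le> \<tau> / pi * exp (- c\<^sup>2 / 2)"
    using assms by (simp add: NN.emeasure_eq_measure)
  have k: "0 < 1 + \<tau>\<^sup>2" by (simp add: add_pos_nonneg)
  have "ennreal (\<tau> / pi * exp (- ((1 + \<tau>\<^sup>2) * c\<^sup>2) / 2) / (1 + \<tau>\<^sup>2)) =
     (\<integral>\<^sup>+x. ennreal (\<tau> / pi) * (ennreal (x * exp (- ((1 + \<tau>\<^sup>2) * x\<^sup>2) / 2)) * indicator {c..} x) \<partial>lborel)"
    using assms k by (subst nn_integral_cmult, simp, subst nn_integral_gaussian_tail) (auto simp: ennreal_mult[symmetric])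
  also have "\<dots> \<le> emeasure (?N \<Otimes>\<^sub>M ?N) (wedge \<tau> c)"
    unfolding e
  proof (intro nn_integral_mono)
    fix x :: real
    have "ennreal (\<tau> / pi) * ennreal (x * exp (- ((1 + \<tau>\<^sup>2) * x\<^sup>2) / 2)) \<le> ennreal (std_normal_density x) * emeasure ?N {-(\<tau> * x)..<\<tau> * x}" if "c \<le> x"
    proof -
      have "\<tau> / pi * (x * exp (- ((1 + \<tau>\<^sup>2) * x\<^sup>2) / 2)) = \<tau> / pi * (x * (exp (- x\<^sup>2 / 2) * exp (- (\<tau> * x)\<^sup>2 / 2)))"
        by (simp add: algebra_simps power_mult_distrib add_divide_distrib diff_divide_distrib flip: exp_add)
      also have "\<dots> = std_normal_density x * (2 * (\<tau> * x) / sqrt (2 * pi) * exp (- (\<tau> * x)\<^sup>2 / 2))"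
        using sq by (simp add: std_normal_density_def)
      finally have "ennreal (\<tau> / pi) * ennreal (x * exp (- ((1 + \<tau>\<^sup>2) * x\<^sup>2) / 2)) = ennreal (std_normal_density x) * ennreal (2 * (\<tau> * x) / sqrt (2 * pi) * exp (- (\<tau> * x)\<^sup>2 / 2))"
        using assms that win[OF that] by (simp only: ennreal_mult[symmetric] divide_nonneg_pos mult_nonneg_nonneg exp_ge_zero normal_density_nonneg pi_gt_zero) (auto simp: ennreal_mult[symmetric])
      also have "\<dots> \<le> ennreal (std_normal_density x) * emeasure ?N {-(\<tau> * x)..<\<tau> * x}"
        using std_normal_window(2)[OF win[OF that]] by (rule mult_left_mono) simp
      finally show ?thesis .
    qed
    then show "ennreal (\<tau> / pi) * (ennreal (x * exp (- ((1 + \<tau>\<^sup>2) * x\<^sup>2) / 2)) * indicator {c..} x) \<le> ennreal (std_normal_density x) * (indicator {c..} x * emeasure ?N {-(\<tau> * x)..<\<tau> * x})"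
      by (auto split: split_indicator)
  qed
  finally show "\<tau> / pi * exp (- ((1 + \<tau>\<^sup>2) * c\<^sup>2) / 2) / (1 + \<tau>\<^sup>2) \<le> measure (?N \<Otimes>\<^sub>M ?N) (wedge \<tau> c)"
    by (simp add: NN.emeasure_eq_measure)
qed

text \<open>
  The upcrossing event is \<open>{c \<le> V, U < V} - {c \<le> U, U < V}\<close>. In orthonormal coordinates with first
  axis \<open>V\<close>, respectively \<open>U\<close>, both sets have the form \<open>{c \<le> x, y < t x}\<close>, with opposite slopes \<open>t\<close>;
  so no polar coordinates are needed.
\<close>

lemma upcrossing_prob:
  fixes U V :: "'w \<Rightarrow> real"
  assumes "prob_space M" and [measurable]: "U \<in> borel_measurable M" "V \<in> borel_measurable M"
    and r: "- 1 < r" "r < 1" and c: "c \<ge> 0"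
    and chr: "\<And>a b. (CLINT \<omega>|M. iexp (a * U \<omega> + b * V \<omega>)) = complex_of_real (exp (- (a\<^sup>2 + b\<^sup>2 + 2 * a * b * r) / 2))"
  shows "measure M {\<omega> \<in> space M. U \<omega> < c \<and> c \<le> V \<omega>} =
    measure (std_normal_distribution \<Otimes>\<^sub>M std_normal_distribution) (wedge (sqrt ((1 - r) / (1 + r))) c)"
proof -
  interpret prob_space M by fact
  interpret N: real_distribution std_normal_distribution by (rule real_dist_normal_dist)
  let ?N = "std_normal_distribution"
  let ?NN = "?N \<Otimes>\<^sub>M ?N"
  interpret NN: pair_prob_space ?N ?N ..
  define s where "s = sqrt (1 - r\<^sup>2)"
  \<comment> \<open>If r is the cosine of an angle, s is its sine and \<tau> the tangent of its
    half. The identity \<open>\<tau> * s = 1 - r\<close> is what turns U < V into a condition on the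
    slope in both coordinate systems.\<close>
  define \<tau> where "\<tau> = sqrt ((1 - r) / (1 + r))"
  have r2: "r\<^sup>2 < 1" using r by (simp add: abs_square_less_1)
  then have s: "s > 0" and s2: "s\<^sup>2 = 1 - r\<^sup>2" by (auto simp: s_def)
  have "\<tau> \<ge> 0" using r by (simp add: \<tau>_def)
  have s\<tau>: "\<tau> * s = 1 - r"
  proof -
    have "\<tau> * s = sqrt ((1 - r) / (1 + r) * (1 - r\<^sup>2))" unfolding \<tau>_def s_def real_sqrt_mult ..
    also have "(1 - r) / (1 + r) * (1 - r\<^sup>2) = (1 - r)\<^sup>2"
      using r by (simp add: field_simps power2_eq_square)
    finally show ?thesis using r by simp
  qed
  have sets_NN: "sets ?NN = sets (borel \<Otimes>\<^sub>M borel)" by (intro sets_pair_measure_cong) auto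
  \<comment> \<open>The second axis is reversed here, with r U - V instead of V - r U, so that U < V
    becomes an upper bound on the second coordinate in both systems and the two sets differ only in
    the sign of the slope.\<close>
  have distr1: "distr M (borel \<Otimes>\<^sub>M borel) (\<lambda>\<omega>. (U \<omega>, (r * U \<omega> - V \<omega>) / s)) = ?NN"
  proof (rule std_normal_pair_distr[OF assms(1)])
    fix a b :: real
    have "(CLINT \<omega>|M. iexp (a * U \<omega> + b * ((r * U \<omega> - V \<omega>) / s))) = (CLINT \<omega>|M. iexp ((a + b * r / s) * U \<omega> + (- b / s) * V \<omega>))"
      using s by (intro Bochner_Integration.integral_cong refl arg_cong[where f = iexp]) (simp add: field_simps)
    also have "\<dots> = exp (- ((a + b * r / s)\<^sup>2 + (- b / s)\<^sup>2 + 2 * (a + b * r / s) * (- b / s) * r) / 2)"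
      by (rule chr)
    also have "(a + b * r / s)\<^sup>2 + (- b / s)\<^sup>2 + 2 * (a + b * r / s) * (- b / s) * r = a\<^sup>2 + b\<^sup>2 * ((1 - r\<^sup>2) / s\<^sup>2)"
      using s by (simp add: field_simps power2_eq_square)
    also have "\<dots> = a\<^sup>2 + b\<^sup>2" using r2 by (simp add: s2)
    finally show "(CLINT \<omega>|M. iexp (a * U \<omega> + b * ((r * U \<omega> - V \<omega>) / s))) = exp (- (a\<^sup>2 + b\<^sup>2) / 2)" .
  qed auto
  have distr2: "distr M (borel \<Otimes>\<^sub>M borel) (\<lambda>\<omega>. (V \<omega>, (U \<omega> - r * V \<omega>) / s)) = ?NN"
  proof (rule std_normal_pair_distr[OF assms(1)])
    fix a b :: real
    have "(CLINT \<omega>|M. iexp (a * V \<omega> + b * ((U \<omega> - r * V \<omega>) / s))) = (CLINT \<omega>|M. iexp ((b / s) * U \<omega> + (a - b * r / s) * V \<omega>))"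
      using s by (intro Bochner_Integration.integral_cong refl arg_cong[where f = iexp]) (simp add: field_simps)
    also have "\<dots> = exp (- ((b / s)\<^sup>2 + (a - b * r / s)\<^sup>2 + 2 * (b / s) * (a - b * r / s) * r) / 2)"
      by (rule chr)
    also have "(b / s)\<^sup>2 + (a - b * r / s)\<^sup>2 + 2 * (b / s) * (a - b * r / s) * r = a\<^sup>2 + b\<^sup>2 * ((1 - r\<^sup>2) / s\<^sup>2)"
      using s by (simp add: field_simps power2_eq_square)
    also have "\<dots> = a\<^sup>2 + b\<^sup>2" using r2 by (simp add: s2)
    finally show "(CLINT \<omega>|M. iexp (a * V \<omega> + b * ((U \<omega> - r * V \<omega>) / s))) = exp (- (a\<^sup>2 + b\<^sup>2) / 2)" .
  qed auto
  define H where "H t = {p \<in> space (borel \<Otimes>\<^sub>M borel). c \<le> fst p \<and> snd p < t * fst p}" for t :: real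
  have H[measurable]: "H t \<in> sets (borel \<Otimes>\<^sub>M borel)" for t unfolding H_def by measurable
  have [measurable]: "H t \<in> sets ?NN" for t using sets_NN by simp
  have cmp1: "U \<omega> < V \<omega> \<longleftrightarrow> (r * U \<omega> - V \<omega>) / s < - \<tau> * U \<omega>" for \<omega>
  proof -
    have "(r * U \<omega> - V \<omega>) / s < - \<tau> * U \<omega> \<longleftrightarrow> r * U \<omega> - V \<omega> < - (\<tau> * s) * U \<omega>"
      using s by (simp add: pos_divide_less_eq algebra_simps)
    then show ?thesis unfolding s\<tau> by (simp add: algebra_simps)
  qed
  have cmp2: "U \<omega> < V \<omega> \<longleftrightarrow> (U \<omega> - r * V \<omega>) / s < \<tau> * V \<omega>" for \<omega>
  proof -
    have "(U \<omega> - r * V \<omega>) / s < \<tau> * V \<omega> \<longleftrightarrow> U \<omega> - r * V \<omega> < (\<tau> * s) * V \<omega>"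
      using s by (simp add: pos_divide_less_eq algebra_simps)
    then show ?thesis unfolding s\<tau> by (simp add: algebra_simps)
  qed
  have 1: "measure M {\<omega> \<in> space M. c \<le> U \<omega> \<and> U \<omega> < V \<omega>} = measure ?NN (H (- \<tau>))"
  proof -
    have "measure ?NN (H (- \<tau>)) = measure M ((\<lambda>\<omega>. (U \<omega>, (r * U \<omega> - V \<omega>) / s)) -` H (- \<tau>) \<inter> space M)"
      unfolding distr1[symmetric] by (rule measure_distr[OF _ H]) measurable
    also have "(\<lambda>\<omega>. (U \<omega>, (r * U \<omega> - V \<omega>) / s)) -` H (- \<tau>) \<inter> space M = {\<omega> \<in> space M. c \<le> U \<omega> \<and> U \<omega> < V \<omega>}"
      unfolding cmp1 by (auto simp: H_def space_pair_measure)
    finally show ?thesis by simp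
  qed
  have 2: "measure M {\<omega> \<in> space M. c \<le> V \<omega> \<and> U \<omega> < V \<omega>} = measure ?NN (H \<tau>)"
  proof -
    have "measure ?NN (H (\<tau>)) = measure M ((\<lambda>\<omega>. (V \<omega>, (U \<omega> - r * V \<omega>) / s)) -` H (\<tau>) \<inter> space M)"
      unfolding distr2[symmetric] by (rule measure_distr[OF _ H]) measurable
    also have "(\<lambda>\<omega>. (V \<omega>, (U \<omega> - r * V \<omega>) / s)) -` H (\<tau>) \<inter> space M = {\<omega> \<in> space M. c \<le> V \<omega> \<and> U \<omega> < V \<omega>}"
      unfolding cmp2 by (auto simp: H_def space_pair_measure)
    finally show ?thesis by simp
  qed
  have "{\<omega> \<in> space M. U \<omega> < c \<and> c \<le> V \<omega>} = {\<omega> \<in> space M. c \<le> V \<omega> \<and> U \<omega> < V \<omega>} - {\<omega> \<in> space M. c \<le> U \<omega> \<and> U \<omega> < V \<omega>}"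
    by auto
  then have "measure M {\<omega> \<in> space M. U \<omega> < c \<and> c \<le> V \<omega>} =
      measure M ({\<omega> \<in> space M. c \<le> V \<omega> \<and> U \<omega> < V \<omega>} - {\<omega> \<in> space M. c \<le> U \<omega> \<and> U \<omega> < V \<omega>})"
    by (rule arg_cong)
  also have "\<dots> = measure ?NN (H \<tau>) - measure ?NN (H (- \<tau>))"
    unfolding 1[symmetric] 2[symmetric]
  proof (rule finite_measure_Diff)
    show "{\<omega> \<in> space M. c \<le> U \<omega> \<and> U \<omega> < V \<omega>} \<subseteq> {\<omega> \<in> space M. c \<le> V \<omega> \<and> U \<omega> < V \<omega>}"
      by auto
  qed measurable
  also have "\<dots> = measure ?NN (H \<tau> - H (- \<tau>))"
  proof (rule NN.finite_measure_Diff[symmetric])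
    show "H (- \<tau>) \<subseteq> H \<tau>"
    proof
      fix p assume "p \<in> H (- \<tau>)"
      moreover from this have "0 \<le> \<tau> * fst p" using c \<open>\<tau> \<ge> 0\<close> by (auto simp: H_def)
      ultimately show "p \<in> H \<tau>" by (auto simp: H_def)
    qed
  qed auto
  also have "H \<tau> - H (- \<tau>) = wedge \<tau> c" by (auto simp: H_def wedge_def space_pair_measure)
  finally show ?thesis unfolding \<tau>_def .
qed

text \<open>Point masses count as Gaussian, and a combination of process values may be degenerate,
  for instance with all coefficients zero. The mean pins the mass to 0; otherwise scaling by the
  standard deviation gives the standard law.\<close>

lemma centred_gaussian_cases:
  assumes "prob_space P" "gaussian_var P X"
    and mean: "prob_space.expectation P X = 0" and var: "prob_space.expectation P (\<lambda>\<omega>. (X \<omega>)\<^sup>2) = v"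
  obtains "X \<in> borel_measurable P" "v = 0" "AE \<omega> in P. X \<omega> = 0"
  | "X \<in> borel_measurable P" "v > 0" "distr P borel (\<lambda>\<omega>. X \<omega> / sqrt v) = std_normal_distribution"
proof -
  interpret prob_space P by fact
  from assms(2) obtain \<mu> where "(X \<in> borel_measurable P \<and> (AE \<omega> in P. X \<omega> = \<mu>)) \<or>
     (\<exists>\<sigma>>0. distributed P lborel X (normal_density \<mu> \<sigma>))"
    unfolding gaussian_var_def by auto
  then consider "X \<in> borel_measurable P" "AE \<omega> in P. X \<omega> = \<mu>"
    | \<sigma> where "\<sigma> > 0" "distributed P lborel X (normal_density \<mu> \<sigma>)" by auto
  then show thesis
  proof cases
    case 1
    have "expectation X = expectation (\<lambda>_. \<mu>)" using 1 by (intro integral_cong_AE) auto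
    then have "\<mu> = 0" using mean by (simp add: prob_space)
    moreover have "expectation (\<lambda>\<omega>. (X \<omega>)\<^sup>2) = expectation (\<lambda>_. \<mu>\<^sup>2)" using 1 by (intro integral_cong_AE) auto
    ultimately show ?thesis using 1 var that(1) by simp
  next
    case 2
    then have "X \<in> measurable P lborel" by (auto simp: distributed_def)
    then have [measurable]: "X \<in> borel_measurable P" by simp
    have "\<mu> = 0" using normal_distributed_expectation[OF 2] mean by simp
    then have v: "v = \<sigma>\<^sup>2" using normal_distributed_variance[OF 2] mean var by simp
    then have "sqrt v = \<sigma>" using 2 by simp
    have "distributed P lborel (\<lambda>\<omega>. (X \<omega> - \<mu>) / \<sigma>) std_normal_density"
      using normal_standard_normal_convert[OF 2(1), of X \<mu>] 2 by simp
    then have "distr P lborel (\<lambda>\<omega>. X \<omega> / \<sigma>) = std_normal_distribution"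
      using \<open>\<mu> = 0\<close> by (simp add: distributed_def)
    moreover have "distr P lborel (\<lambda>\<omega>. X \<omega> / \<sigma>) = distr P borel (\<lambda>\<omega>. X \<omega> / \<sigma>)"
      by (rule distr_cong) auto
    ultimately show ?thesis using that(2) v \<open>sqrt v = \<sigma>\<close> 2(1) by simp
  qed
qed

text \<open>Applied to every combination of two process values, this gives the joint characteristic
  function required by \<open>upcrossing_prob\<close>.\<close>

lemma centred_gaussian_iexp:
  assumes "prob_space P" "gaussian_var P X"
    and "prob_space.expectation P X = 0" "prob_space.expectation P (\<lambda>\<omega>. (X \<omega>)\<^sup>2) = v"
  shows "(CLINT \<omega>|P. iexp (X \<omega>)) = complex_of_real (exp (- v / 2))"
proof (rule centred_gaussian_cases[OF assms])
  interpret prob_space P by fact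
  assume [measurable]: "X \<in> borel_measurable P" and v: "v = 0" and X: "AE \<omega> in P. X \<omega> = 0"
  have "(CLINT \<omega>|P. iexp (X \<omega>)) = (CLINT \<omega>|P. 1)"
    using X by (intro integral_cong_AE) auto
  then show ?thesis using v prob_space by simp
next
  assume [measurable]: "X \<in> borel_measurable P" and v: "v > 0"
    and d: "distr P borel (\<lambda>\<omega>. X \<omega> / sqrt v) = std_normal_distribution"
  have "char std_normal_distribution (sqrt v) = (CLINT \<omega>|P. iexp (sqrt v * (X \<omega> / sqrt v)))"
    unfolding char_def d[symmetric] by (subst integral_distr) auto
  then show ?thesis using v by (simp add: char_std_normal_distribution)
qed

text \<open>Only an upper bound \<open>w\<close> for the variance is available for the combinations
  of interest. Since w <= 1 <= c, the standardised level is at least 1, where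
  \<open>std_normal_tail_le\<close> applies.\<close>

lemma centred_gaussian_tail:
  assumes "prob_space P" "gaussian_var P X"
    and "prob_space.expectation P X = 0" "prob_space.expectation P (\<lambda>\<omega>. (X \<omega>)\<^sup>2) = v"
    and w: "v \<le> w" "0 < w" "w \<le> 1" and c: "c \<ge> 1"
  shows "measure P {\<omega> \<in> space P. c \<le> X \<omega>} \<le> exp (- c\<^sup>2 / (2 * w))"
proof (rule centred_gaussian_cases[OF assms(1-4)])
  interpret prob_space P by fact
  assume [measurable]: "X \<in> borel_measurable P" and X: "AE \<omega> in P. X \<omega> = 0"
  have "AE \<omega> in P. \<not> c \<le> X \<omega>" using X by eventually_elim (use c in auto)
  then have "measure P {\<omega> \<in> space P. c \<le> X \<omega>} = 0"
    by (subst prob_eq_0) auto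
  then show ?thesis by simp
next
  assume [measurable]: "X \<in> borel_measurable P" and v: "v > 0"
    and d: "distr P borel (\<lambda>\<omega>. X \<omega> / sqrt v) = std_normal_distribution"
  have "measure P {\<omega> \<in> space P. c \<le> X \<omega>} = measure std_normal_distribution {c / sqrt v..}"
    unfolding d[symmetric] using v
    by (subst measure_distr) (auto intro!: arg_cong[where f = "measure P"] simp: divide_right_mono field_simps)
  also have "\<dots> \<le> exp (- (c / sqrt v)\<^sup>2 / 2)"
  proof (rule std_normal_tail_le)
    have "sqrt v \<le> 1" using v w by simp
    then have "sqrt v \<le> c" using c by linarith
    then show "1 \<le> c / sqrt v" using v by (simp add: pos_le_divide_eq)
  qed
  also have "\<dots> \<le> exp (- c\<^sup>2 / (2 * w))"
    using v w by (simp add: power_divide frac_le)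
  finally show ?thesis .
qed

lemma std_normal_atLeast:
  assumes "prob_space P" "gaussian_var P X"
    and "prob_space.expectation P X = 0" "prob_space.expectation P (\<lambda>\<omega>. (X \<omega>)\<^sup>2) = 1"
  shows "measure P {\<omega> \<in> space P. c \<le> X \<omega>} = normal_tail c"
proof (rule centred_gaussian_cases[OF assms])
  assume [measurable]: "X \<in> borel_measurable P"
    and d: "distr P borel (\<lambda>\<omega>. X \<omega> / sqrt 1) = std_normal_distribution"
  show ?thesis
    unfolding d[symmetric]
    by (subst measure_distr) (auto intro!: arg_cong[where f = "measure P"])
qed simp

section \<open>Chi-squared tails\<close>

lemma chi_squared_1_atLeast:
  assumes "c > 0"
  shows "measure (chi_squared 1) {c\<^sup>2..} = 2 * normal_tail c"
proof -
  interpret N: real_distribution std_normal_distribution by (rule real_dist_normal_dist)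
  let ?N = std_normal_distribution
  have "measure (chi_squared 1) {c\<^sup>2..} = measure (distr (\<Pi>\<^sub>M i\<in>{..<1::nat}. ?N) ?N (\<lambda>x. x 0)) {x. c\<^sup>2 \<le> x\<^sup>2}"
    unfolding chi_squared_def
    by (subst (1 2) measure_distr) (auto intro!: arg_cong[where f = "measure _"] simp: space_PiM)
  also have "\<dots> = measure ?N {x. c\<^sup>2 \<le> x\<^sup>2}"
    by (subst distr_PiM_component) (auto intro: N.prob_space_axioms)
  also have "{x. c\<^sup>2 \<le> x\<^sup>2} = {c..} \<union> {..-c}"
    using assms by (auto simp: abs_le_square_iff[symmetric])
  also have "measure ?N \<dots> = measure ?N {c..} + measure ?N {..-c}"
    using assms by (intro N.finite_measure_Union) auto
  also have "measure ?N {..-c} = measure (distr ?N borel uminus) {..-c}" by (simp add: std_normal_uminus)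
  also have "\<dots> = measure ?N {c..}"
    by (subst measure_distr) (auto intro!: arg_cong[where f = "measure ?N"])
  finally show ?thesis by simp
qed

text \<open>The substitution y = x s, with s the slope, replaces polar coordinates. After exchanging
  the integrals the one over x is elementary for each slope and leaves exp(-c^2/2) / pi times the
  integral of 1/(1 + s^2), which is pi.\<close>

lemma chi_squared_2_atLeast:
  assumes "c \<ge> 0"
  shows "measure (chi_squared 2) {c\<^sup>2..} = exp (- c\<^sup>2 / 2)"
proof -
  interpret N: real_distribution std_normal_distribution by (rule real_dist_normal_dist)
  let ?N = std_normal_distribution
  interpret product_prob_space "\<lambda>_. ?N" "UNIV :: nat set" ..
  let ?f = "\<lambda>x :: nat \<Rightarrow> real. indicator {c\<^sup>2..} ((x 1)\<^sup>2 + (x 0)\<^sup>2) :: ennreal"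
  have i: "{..<2} = insert (1::nat) {0}" by auto
  have [measurable]: "?f \<in> borel_measurable (\<Pi>\<^sub>M i\<in>insert 1 {0}. ?N)" by measurable
  have "emeasure (chi_squared 2) {c\<^sup>2..} = (\<integral>\<^sup>+x. indicator {c\<^sup>2..} x \<partial>chi_squared 2)"
    by (subst nn_integral_indicator) (auto simp: chi_squared_def)
  also have "\<dots> = (\<integral>\<^sup>+x. ?f x \<partial>(\<Pi>\<^sub>M i\<in>insert 1 {0}. ?N))"
    unfolding chi_squared_def i by (subst nn_integral_distr) (auto simp: add.commute)
  also have "\<dots> = (\<integral>\<^sup>+x. (\<integral>\<^sup>+y. ?f (x(1 := y)) \<partial>?N) \<partial>(\<Pi>\<^sub>M i\<in>{0}. ?N))"
    by (rule product_nn_integral_insert) auto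
  also have "\<dots> = (\<integral>\<^sup>+x. (\<lambda>u. \<integral>\<^sup>+y. indicator {c\<^sup>2..} (y\<^sup>2 + u\<^sup>2) \<partial>?N) (x 0) \<partial>(\<Pi>\<^sub>M i\<in>{0::nat}. ?N))"
    by simp
  also have "\<dots> = (\<integral>\<^sup>+u. \<integral>\<^sup>+y. indicator {c\<^sup>2..} (y\<^sup>2 + u\<^sup>2) \<partial>?N \<partial>?N)"
    by (rule product_nn_integral_singleton) measurable
  also have "\<dots> = (\<integral>\<^sup>+x. ennreal (std_normal_density x) * (\<integral>\<^sup>+y. ennreal (std_normal_density y) * indicator {c\<^sup>2..} (y\<^sup>2 + x\<^sup>2) \<partial>lborel) \<partial>lborel)"
    by (simp add: nn_integral_density)
  also have "\<dots> = (\<integral>\<^sup>+x. (\<integral>\<^sup>+y. ennreal (exp (- (x\<^sup>2 + y\<^sup>2) / 2) / (2 * pi)) * indicator {c\<^sup>2..} (y\<^sup>2 + x\<^sup>2) \<partial>lborel) \<partial>lborel)"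
  proof (rule nn_integral_cong)
    fix x :: real
    have "ennreal (std_normal_density x) * (\<integral>\<^sup>+y. ennreal (std_normal_density y) * indicator {c\<^sup>2..} (y\<^sup>2 + x\<^sup>2) \<partial>lborel)
      = (\<integral>\<^sup>+y. ennreal (std_normal_density x) * (ennreal (std_normal_density y) * indicator {c\<^sup>2..} (y\<^sup>2 + x\<^sup>2)) \<partial>lborel)"
      by (rule nn_integral_cmult[symmetric]) measurable
    also have "\<dots> = (\<integral>\<^sup>+y. ennreal (exp (- (x\<^sup>2 + y\<^sup>2) / 2) / (2 * pi)) * indicator {c\<^sup>2..} (y\<^sup>2 + x\<^sup>2) \<partial>lborel)"
    proof (rule nn_integral_cong)
      fix y :: real
      have "std_normal_density x * std_normal_density y = exp (- (x\<^sup>2 + y\<^sup>2) / 2) / (2 * pi)"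
        by (simp add: std_normal_density_def add_divide_distrib diff_divide_distrib flip: exp_add)
      then have "ennreal (std_normal_density x) * ennreal (std_normal_density y) = ennreal (exp (- (x\<^sup>2 + y\<^sup>2) / 2) / (2 * pi))"
        by (simp add: ennreal_mult[symmetric])
      then show "ennreal (std_normal_density x) * (ennreal (std_normal_density y) * indicator {c\<^sup>2..} (y\<^sup>2 + x\<^sup>2)) =
        ennreal (exp (- (x\<^sup>2 + y\<^sup>2) / 2) / (2 * pi)) * indicator {c\<^sup>2..} (y\<^sup>2 + x\<^sup>2)"
        by (simp add: mult.assoc[symmetric])
    qed
    finally show "ennreal (std_normal_density x) * (\<integral>\<^sup>+y. ennreal (std_normal_density y) * indicator {c\<^sup>2..} (y\<^sup>2 + x\<^sup>2) \<partial>lborel) = \<dots>" .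
  qed
  also have "\<dots> = (\<integral>\<^sup>+x. (\<integral>\<^sup>+s. ennreal (\<bar>x\<bar> * exp (- ((1 + s\<^sup>2) * x\<^sup>2) / 2) / (2 * pi)) * indicator {c\<^sup>2..} ((1 + s\<^sup>2) * x\<^sup>2) \<partial>lborel) \<partial>lborel)"
  \<comment> \<open>The substitution y = x s degenerates only at x = 0, a null set.\<close>
  proof (intro nn_integral_cong_AE AE_I[where N = "{0}"] subsetI)
    fix x :: real
    assume x: "x \<in> {x \<in> space lborel. \<not> (\<integral>\<^sup>+y. ennreal (exp (- (x\<^sup>2 + y\<^sup>2) / 2) / (2 * pi)) * indicator {c\<^sup>2..} (y\<^sup>2 + x\<^sup>2) \<partial>lborel) =
      (\<integral>\<^sup>+s. ennreal (\<bar>x\<bar> * exp (- ((1 + s\<^sup>2) * x\<^sup>2) / 2) / (2 * pi)) * indicator {c\<^sup>2..} ((1 + s\<^sup>2) * x\<^sup>2) \<partial>lborel)}"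
    have "(\<integral>\<^sup>+y. ennreal (exp (- (x\<^sup>2 + y\<^sup>2) / 2) / (2 * pi)) * indicator {c\<^sup>2..} (y\<^sup>2 + x\<^sup>2) \<partial>lborel) =
      (\<integral>\<^sup>+s. ennreal (\<bar>x\<bar> * exp (- ((1 + s\<^sup>2) * x\<^sup>2) / 2) / (2 * pi)) * indicator {c\<^sup>2..} ((1 + s\<^sup>2) * x\<^sup>2) \<partial>lborel)"
      if "x \<noteq> 0"
    proof -
      have "(\<integral>\<^sup>+y. ennreal (exp (- (x\<^sup>2 + y\<^sup>2) / 2) / (2 * pi)) * indicator {c\<^sup>2..} (y\<^sup>2 + x\<^sup>2) \<partial>lborel) =
        ennreal \<bar>x\<bar> * (\<integral>\<^sup>+s. ennreal (exp (- (x\<^sup>2 + (0 + x * s)\<^sup>2) / 2) / (2 * pi)) * indicator {c\<^sup>2..} ((0 + x * s)\<^sup>2 + x\<^sup>2) \<partial>lborel)"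
        by (rule nn_integral_real_affine) (use that in auto)
      also have "\<dots> = (\<integral>\<^sup>+s. ennreal \<bar>x\<bar> * (ennreal (exp (- (x\<^sup>2 + (0 + x * s)\<^sup>2) / 2) / (2 * pi)) * indicator {c\<^sup>2..} ((0 + x * s)\<^sup>2 + x\<^sup>2)) \<partial>lborel)"
        by (rule nn_integral_cmult[symmetric]) measurable
      also have "\<dots> = (\<integral>\<^sup>+s. ennreal (\<bar>x\<bar> * exp (- ((1 + s\<^sup>2) * x\<^sup>2) / 2) / (2 * pi)) * indicator {c\<^sup>2..} ((1 + s\<^sup>2) * x\<^sup>2) \<partial>lborel)"
      proof (rule nn_integral_cong)
        fix s :: real
        have "(0 + x * s)\<^sup>2 + x\<^sup>2 = (1 + s\<^sup>2) * x\<^sup>2" "x\<^sup>2 + (0 + x * s)\<^sup>2 = (1 + s\<^sup>2) * x\<^sup>2"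
          by (simp_all add: power_mult_distrib algebra_simps)
        then show "ennreal \<bar>x\<bar> * (ennreal (exp (- (x\<^sup>2 + (0 + x * s)\<^sup>2) / 2) / (2 * pi)) * indicator {c\<^sup>2..} ((0 + x * s)\<^sup>2 + x\<^sup>2)) =
          ennreal (\<bar>x\<bar> * exp (- ((1 + s\<^sup>2) * x\<^sup>2) / 2) / (2 * pi)) * indicator {c\<^sup>2..} ((1 + s\<^sup>2) * x\<^sup>2)"
          by (simp only: mult.assoc[symmetric]) (simp add: ennreal_mult'[symmetric])
      qed
      finally show ?thesis .
    qed
    with x show "x \<in> {0}" by auto
  qed auto
  also have "\<dots> = (\<integral>\<^sup>+s. (\<integral>\<^sup>+x. ennreal (\<bar>x\<bar> * exp (- ((1 + s\<^sup>2) * x\<^sup>2) / 2) / (2 * pi)) * indicator {c\<^sup>2..} ((1 + s\<^sup>2) * x\<^sup>2) \<partial>lborel) \<partial>lborel)"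
    by (rule lborel_pair.Fubini'[symmetric]) measurable
  also have "\<dots> = (\<integral>\<^sup>+s. ennreal (exp (- c\<^sup>2 / 2) / pi) * ennreal (1 / (1 + s\<^sup>2)) \<partial>lborel)"
  proof (rule nn_integral_cong)
    fix s :: real
    have k: "1 + s\<^sup>2 > 0" by (simp add: add_pos_nonneg)
    \<comment> \<open>The distance along the first axis at which the line of slope s leaves the disc
      of radius c.\<close>
    define c' where "c' = c / sqrt (1 + s\<^sup>2)"
    have c': "c' \<ge> 0" using assms by (simp add: c'_def)
    have c'2: "(1 + s\<^sup>2) * c'\<^sup>2 = c\<^sup>2" using k by (simp add: c'_def power_divide)
    have ind: "c\<^sup>2 \<le> (1 + s\<^sup>2) * x\<^sup>2 \<longleftrightarrow> c' \<le> x" if "x \<ge> 0" for x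
    proof -
      have "c\<^sup>2 \<le> (1 + s\<^sup>2) * x\<^sup>2 \<longleftrightarrow> c'\<^sup>2 \<le> x\<^sup>2" unfolding c'2[symmetric] using k by simp
      then show ?thesis using that c' by (simp add: abs_le_square_iff[symmetric])
    qed
    have "(\<integral>\<^sup>+x. ennreal (\<bar>x\<bar> * exp (- ((1 + s\<^sup>2) * x\<^sup>2) / 2) / (2 * pi)) * indicator {c\<^sup>2..} ((1 + s\<^sup>2) * x\<^sup>2) \<partial>lborel)
      = 2 * (\<integral>\<^sup>+x. ennreal (\<bar>x\<bar> * exp (- ((1 + s\<^sup>2) * x\<^sup>2) / 2) / (2 * pi)) * indicator {c\<^sup>2..} ((1 + s\<^sup>2) * x\<^sup>2) * indicator {0..} x \<partial>lborel)"
      by (rule nn_integral_even) auto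
    also have "\<dots> = 2 * (\<integral>\<^sup>+x. ennreal (1 / (2 * pi)) * (ennreal (x * exp (- ((1 + s\<^sup>2) * x\<^sup>2) / 2)) * indicator {c'..} x) \<partial>lborel)"
    proof (rule arg_cong[where f = "\<lambda>u. 2 * u"], rule nn_integral_cong)
      fix x :: real
      show "ennreal (\<bar>x\<bar> * exp (- ((1 + s\<^sup>2) * x\<^sup>2) / 2) / (2 * pi)) * indicator {c\<^sup>2..} ((1 + s\<^sup>2) * x\<^sup>2) * indicator {0..} x =
        ennreal (1 / (2 * pi)) * (ennreal (x * exp (- ((1 + s\<^sup>2) * x\<^sup>2) / 2)) * indicator {c'..} x)"
      proof (cases "c' \<le> x")
        case True
        then have "x \<ge> 0" using c' by simp
        then show ?thesis using ind[of x] True by (simp add: ennreal_mult[symmetric])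
      next
        case False
        then show ?thesis using ind[of x] by (cases "x \<ge> 0") auto
      qed
    qed
    also have "\<dots> = 2 * (ennreal (1 / (2 * pi)) * ennreal (exp (- ((1 + s\<^sup>2) * c'\<^sup>2) / 2) / (1 + s\<^sup>2)))"
      using c' k by (subst nn_integral_cmult, simp, subst nn_integral_gaussian_tail) auto
    also have "\<dots> = ennreal (exp (- c\<^sup>2 / 2) / pi) * ennreal (1 / (1 + s\<^sup>2))"
      unfolding c'2 using k by (simp add: ennreal_mult[symmetric] ennreal_numeral[symmetric] del: ennreal_numeral)
    finally show "(\<integral>\<^sup>+x. ennreal (\<bar>x\<bar> * exp (- ((1 + s\<^sup>2) * x\<^sup>2) / 2) / (2 * pi)) * indicator {c\<^sup>2..} ((1 + s\<^sup>2) * x\<^sup>2) \<partial>lborel) = \<dots>" .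
  qed
  also have "\<dots> = ennreal (exp (- c\<^sup>2 / 2) / pi) * (\<integral>\<^sup>+s. ennreal (1 / (1 + s\<^sup>2)) \<partial>lborel)"
    by (rule nn_integral_cmult) auto
  also have "(\<integral>\<^sup>+s. ennreal (1 / (1 + s\<^sup>2)) \<partial>lborel) = 2 * (\<integral>\<^sup>+s. ennreal (1 / (1 + s\<^sup>2)) * indicator {0..} s \<partial>lborel)"
    by (rule nn_integral_even) auto
  also have "(\<integral>\<^sup>+s. ennreal (1 / (1 + s\<^sup>2)) * indicator {0..} s \<partial>lborel) = ennreal (pi / 2 - arctan 0)"
    by (rule nn_integral_FTC_atLeast)
      (auto intro!: derivative_eq_intros tendsto_arctan_at_top simp: field_simps)
  also have "ennreal (exp (- c\<^sup>2 / 2) / pi) * (2 * ennreal (pi / 2 - arctan 0)) = ennreal (exp (- c\<^sup>2 / 2))"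
    by (simp add: ennreal_mult[symmetric] ennreal_numeral[symmetric] del: ennreal_numeral)
  finally show ?thesis
    by (simp add: measure_def)
qed

section \<open>Geometry of the curve\<close>

text \<open>A Lebesgue number argument. The radii of the finite subcover are halved, so that every
  small ball lies inside one full ball of the local statement; monotonicity in the constant allows
  passing to the largest one.\<close>

lemma compact_uniform_neighbourhoods:
  fixes S :: "'a::metric_space set" and R :: "real \<Rightarrow> 'a set \<Rightarrow> bool"
  assumes S: "compact S"
    and local: "\<And>x. x \<in> S \<Longrightarrow> \<exists>e>0. \<exists>B. R B (S \<inter> ball x e)"
    and mono: "\<And>B B' T T'. R B T \<Longrightarrow> B \<le> B' \<Longrightarrow> T' \<subseteq> T \<Longrightarrow> R B' T'"
  shows "\<exists>\<delta>>0. \<exists>B. \<forall>x\<in>S. R B (S \<inter> ball x \<delta>)"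
proof -
  obtain e B where eB: "\<And>x. x \<in> S \<Longrightarrow> e x > 0 \<and> R (B x) (S \<inter> ball x (e x))"
    using local by metis
  have cover: "S \<subseteq> (\<Union>x\<in>S. ball x (e x / 2))" using eB by force
  obtain F where F: "F \<subseteq> S" "finite F" "S \<subseteq> (\<Union>x\<in>F. ball x (e x / 2))"
    by (rule compactE_image[OF S _ cover]) auto
  \<comment> \<open>The inserted 1, and the 0 in the next line, keep minimum and maximum meaningful
    when the subcover is empty.\<close>
  define \<delta> where "\<delta> = Min (insert 1 ((\<lambda>x. e x / 2) ` F))"
  define C where "C = Max (insert 0 (B ` F))"
  have "\<delta> > 0" unfolding \<delta>_def using F eB by (subst Min_gr_iff) auto
  moreover have "R C (S \<inter> ball x \<delta>)" if xS: "x \<in> S" for x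
  proof -
    obtain y where y: "y \<in> F" "x \<in> ball y (e y / 2)" using F(3) xS by blast
    have "\<delta> \<le> e y / 2" unfolding \<delta>_def using F(2) y(1) by (intro Min_le) auto
    have "B y \<le> C" unfolding C_def using F(2) y(1) by (intro Max_ge) auto
    have "S \<inter> ball x \<delta> \<subseteq> S \<inter> ball y (e y)"
    proof
      fix z assume "z \<in> S \<inter> ball x \<delta>"
      then have "z \<in> S" "dist x z < e y / 2" using \<open>\<delta> \<le> e y / 2\<close> by auto
      moreover have "dist y x < e y / 2" using y by simp
      ultimately show "z \<in> S \<inter> ball y (e y)" using dist_triangle[of y z x] by auto
    qed
    then show ?thesis using mono eB y F \<open>B y \<le> C\<close> by blast
  qed
  ultimately show ?thesis by blast
qed

lemma C1_lipschitz_on_compact: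
  fixes f :: "real \<Rightarrow> 'a::real_normed_vector"
  assumes "compact S" "convex S"
    and f: "\<And>x. x \<in> S \<Longrightarrow> (f has_vector_derivative f' x) (at x within S)"
    and "continuous_on S f'"
  obtains B where "B > 0" "\<And>s t. s \<in> S \<Longrightarrow> t \<in> S \<Longrightarrow> norm (f s - f t) \<le> B * \<bar>s - t\<bar>"
proof -
  have "bounded (f' ` S)" using assms by (intro compact_imp_bounded compact_continuous_image)
  then obtain C where C: "C > 0" "\<And>x. x \<in> S \<Longrightarrow> norm (f' x) \<le> C"
    by (auto simp: bounded_pos)
  \<comment> \<open>One \<open>C\<close> comes from the linear term and two from the variation of
    the derivative along the segment.\<close>
  have "norm (f s - f t) \<le> 3 * C * \<bar>s - t\<bar>" if st: "s \<in> S" "t \<in> S" for s t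
  proof -
    have "norm (f s - f t - (s - t) *\<^sub>R f' t) \<le> norm (s - t) * (2 * C)"
    proof (rule vector_differentiable_bound_linearization[OF f])
      show "closed_segment t s \<subseteq> S" using st assms by (simp add: closed_segment_subset)
      show "norm (f' x - f' t) \<le> 2 * C" if "x \<in> S" for x
        using C(2)[OF that] C(2)[OF st(2)] norm_triangle_ineq4[of "f' x" "f' t"] by linarith
    qed (use st in auto)
    moreover have "norm ((s - t) *\<^sub>R f' t) \<le> \<bar>s - t\<bar> * C"
      using C(2)[OF st(2)] by (simp add: mult_left_mono)
    moreover have "norm (f s - f t) \<le> norm (f s - f t - (s - t) *\<^sub>R f' t) + norm ((s - t) *\<^sub>R f' t)"
      using norm_triangle_ineq[of "f s - f t - (s - t) *\<^sub>R f' t" "(s - t) *\<^sub>R f' t"] by simp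
    ultimately show ?thesis by (simp add: algebra_simps)
  qed
  with C(1) show thesis by (intro that[of "3 * C"]) auto
qed

text \<open>On the segment the derivative differs from its value at s by at most K times the length,
  and the mean value inequality multiplies this by the length again. The factor 1/2 of Taylor's
  formula is given away.\<close>

lemma lipschitz_derivative_linearization:
  fixes f :: "real \<Rightarrow> 'a::real_normed_vector"
  assumes f: "\<And>x. x \<in> S \<Longrightarrow> (f has_vector_derivative f' x) (at x within S)"
    and lip: "\<And>x y. x \<in> S \<Longrightarrow> y \<in> S \<Longrightarrow> norm (f' x - f' y) \<le> K * \<bar>x - y\<bar>"
    and st: "closed_segment s t \<subseteq> S" and "K \<ge> 0"
  shows "norm (f t - f s - (t - s) *\<^sub>R f' s) \<le> K * (t - s)\<^sup>2"
proof -
  have "norm (f t - f s - (t - s) *\<^sub>R f' s) \<le> norm (t - s) * (K * \<bar>t - s\<bar>)"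
  proof (rule vector_differentiable_bound_linearization[where S = "closed_segment s t"])
    show "(f has_vector_derivative f' x) (at x within closed_segment s t)" if "x \<in> closed_segment s t" for x
      using f st that has_vector_derivative_within_subset by blast
    fix x assume x: "x \<in> closed_segment s t"
    then have "norm (f' x - f' s) \<le> K * \<bar>x - s\<bar>" using st by (intro lip) auto
    also have "\<dots> \<le> K * \<bar>t - s\<bar>"
      using x \<open>K \<ge> 0\<close> by (intro mult_left_mono) (auto simp: closed_segment_eq_real_ivl split: if_splits)
    finally show "norm (f' x - f' s) \<le> K * \<bar>t - s\<bar>" .
  qed auto
  then show ?thesis by (simp add: power2_eq_square[of "t - s"] abs_mult_self mult_ac flip: abs_mult)
qed

text \<open>
  With \<open>DD\<close> the second divided difference, the vector is \<open>\<phi> t + m DD\<close>. Its norm drops because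
  \<open>\<phi> t \<bullet> DD \<le> - \<nu>\<^sup>2 / 2\<close> on the unit sphere, and the middle coefficient is nonpositive because \<open>m\<close>
  is large compared with the squared spacing.
\<close>

lemma close_triple_contraction:
  fixes \<phi> :: "real \<Rightarrow> 'a::real_inner"
  assumes \<phi>: "\<And>x. x \<in> {\<alpha>..\<beta>} \<Longrightarrow> (\<phi> has_vector_derivative \<phi>' x) (at x within {\<alpha>..\<beta>})"
    and lip: "\<And>x y. x \<in> {\<alpha>..\<beta>} \<Longrightarrow> y \<in> {\<alpha>..\<beta>} \<Longrightarrow> norm (\<phi>' x - \<phi>' y) \<le> K * \<bar>x - y\<bar>"
    and chord: "\<And>x y. x \<in> {\<alpha>..\<beta>} \<Longrightarrow> y \<in> {\<alpha>..\<beta>} \<Longrightarrow> \<nu> * \<bar>x - y\<bar> \<le> norm (\<phi> x - \<phi> y)"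
    and unit: "\<And>x. x \<in> {\<alpha>..\<beta>} \<Longrightarrow> norm (\<phi> x) = 1"
    and pos: "K > 0" "\<nu> > 0"
    and m_def: "m = \<nu>\<^sup>2 / (2 * K\<^sup>2)"
    and stu: "\<alpha> \<le> s" "s < t" "t < u" "u \<le> \<beta>" and small: "(u - s)\<^sup>2 \<le> m"
  shows "\<exists>x y z. 0 \<le> x \<and> 0 \<le> y \<and> 0 \<le> z \<and> x + y - z = 1 \<and>
     (norm (x *\<^sub>R \<phi> s + y *\<^sub>R \<phi> u - z *\<^sub>R \<phi> t))\<^sup>2 \<le> 1 - m * \<nu>\<^sup>2 / 2"
proof -
  have m: "m > 0" using pos by (simp add: m_def)
  define p where "p = t - s"
  define q where "q = u - t"
  have pq: "p > 0" "q > 0" "u - s = p + q" using stu by (auto simp: p_def q_def)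
  \<comment> \<open>\<open>x\<close> and \<open>y\<close> are the coefficients of the outer points
    in \<open>m DD\<close>. The middle point receives -(x + y) from \<open>m DD\<close> and 1 from
    \<open>\<phi> t\<close>, which together make \<open>- z\<close>.\<close>
  define x where "x = m / (p * (p + q))"
  define y where "y = m / (q * (p + q))"
  define z where "z = m / (p * q) - 1"
  have xy: "x + y = m / (p * q)"
    using pq by (simp add: x_def y_def field_simps add_nonneg_eq_0_iff)
  have "p * q \<le> (p + q)\<^sup>2" using pq by (simp add: power2_eq_square algebra_simps)
  then have "p * q \<le> m" using small pq by simp
  then have z: "z \<ge> 0" using pq by (simp add: z_def)
  define A where "A = \<phi> u - \<phi> t"
  define B where "B = \<phi> s - \<phi> t"
  define DD where "DD = (1 / (p * (p + q))) *\<^sub>R B + (1 / (q * (p + q))) *\<^sub>R A"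
  have I: "s \<in> {\<alpha>..\<beta>}" "t \<in> {\<alpha>..\<beta>}" "u \<in> {\<alpha>..\<beta>}" using stu by auto
  have lin: "norm (\<phi> v - \<phi> t - (v - t) *\<^sub>R \<phi>' t) \<le> K * (v - t)\<^sup>2" if "v \<in> {\<alpha>..\<beta>}" for v
    by (rule lipschitz_derivative_linearization[OF \<phi> lip]) (use that I pos in \<open>auto simp: closed_segment_eq_real_ivl\<close>)
  \<comment> \<open>A second difference annihilates affine functions, so the tangent line at t may
    be subtracted. Only second-order remainders are left, and \<open>DD\<close> stays bounded
    however close the points are.\<close>
  have DD_eq: "DD = (1 / (p * (p + q))) *\<^sub>R (B - (s - t) *\<^sub>R \<phi>' t) + (1 / (q * (p + q))) *\<^sub>R (A - (u - t) *\<^sub>R \<phi>' t)"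
  proof -
    have "1 / (p * (p + q)) * (s - t) + 1 / (q * (p + q)) * (u - t) = 0"
    proof -
      have st: "s - t = - p" and ut: "u - t = q" by (auto simp: p_def q_def)
      show ?thesis unfolding st ut using pq by simp
    qed
    then have "(1 / (p * (p + q))) *\<^sub>R ((s - t) *\<^sub>R \<phi>' t) + (1 / (q * (p + q))) *\<^sub>R ((u - t) *\<^sub>R \<phi>' t) = 0"
      by (simp only: scaleR_scaleR scaleR_add_left[symmetric]) simp
    then show ?thesis unfolding DD_def by (simp add: scaleR_diff_right algebra_simps)
  qed
  have "norm DD \<le> (1 / (p * (p + q))) * (K * p\<^sup>2) + (1 / (q * (p + q))) * (K * q\<^sup>2)"
    unfolding DD_eq
  proof (rule norm_triangle_le, rule add_mono)
    show "norm ((1 / (p * (p + q))) *\<^sub>R (B - (s - t) *\<^sub>R \<phi>' t)) \<le> (1 / (p * (p + q))) * (K * p\<^sup>2)"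
      using lin[OF I(1)] pq unfolding norm_scaleR B_def
      by (intro mult_mono) (auto simp: p_def power2_commute)
    show "norm ((1 / (q * (p + q))) *\<^sub>R (A - (u - t) *\<^sub>R \<phi>' t)) \<le> (1 / (q * (p + q))) * (K * q\<^sup>2)"
      using lin[OF I(3)] pq unfolding norm_scaleR A_def
      by (intro mult_mono) (auto simp: q_def)
  qed
  also have "\<dots> = K"
  proof -
    have "(1 / (p * (p + q))) * (K * p\<^sup>2) = K * (p / (p + q))" "(1 / (q * (p + q))) * (K * q\<^sup>2) = K * (q / (p + q))"
      using pq by (auto simp: power2_eq_square)
    moreover have "p / (p + q) + q / (p + q) = 1" using pq by (simp add: add_divide_distrib[symmetric])
    ultimately show ?thesis by (metis distrib_left mult.right_neutral)
  qed
  finally have DD: "norm DD \<le> K" .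
  \<comment> \<open>Between points of the unit sphere a chord leans inwards by half its squared
    length.\<close>
  have chord_inner: "\<phi> t \<bullet> (\<phi> v - \<phi> t) = - (norm (\<phi> v - \<phi> t))\<^sup>2 / 2" if "v \<in> {\<alpha>..\<beta>}" for v
  proof -
    have "\<phi> v \<bullet> \<phi> v = 1" "\<phi> t \<bullet> \<phi> t = 1" using unit[OF that] unit[OF I(2)] by (auto simp: dot_square_norm)
    then show ?thesis by (simp add: power2_norm_eq_inner inner_diff_left inner_diff_right inner_commute)
  qed
  have sq: "\<nu>\<^sup>2 * (v - t)\<^sup>2 \<le> (norm (\<phi> v - \<phi> t))\<^sup>2" if "v \<in> {\<alpha>..\<beta>}" for v
  proof -
    have "(\<nu> * \<bar>v - t\<bar>)\<^sup>2 \<le> (norm (\<phi> v - \<phi> t))\<^sup>2"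
      using chord[OF that I(2)] pos by (intro power_mono) auto
    then show ?thesis by (simp add: power_mult_distrib)
  qed
  have "\<phi> t \<bullet> DD = (1 / (p * (p + q))) * (\<phi> t \<bullet> B) + (1 / (q * (p + q))) * (\<phi> t \<bullet> A)"
    by (simp add: DD_def inner_add_right)
  also have "\<dots> \<le> (1 / (p * (p + q))) * (- (\<nu>\<^sup>2 * p\<^sup>2) / 2) + (1 / (q * (p + q))) * (- (\<nu>\<^sup>2 * q\<^sup>2) / 2)"
    using sq[OF I(1)] sq[OF I(3)] pq chord_inner[OF I(1)] chord_inner[OF I(3)]
    by (intro add_mono mult_left_mono) (auto simp: A_def B_def p_def q_def power2_commute[of s t])
  also have "\<dots> = - (\<nu>\<^sup>2 / 2)"
  proof -
    have "(1 / (p * (p + q))) * (- (\<nu>\<^sup>2 * p\<^sup>2) / 2) = - (\<nu>\<^sup>2 / 2) * (p / (p + q))"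
      "(1 / (q * (p + q))) * (- (\<nu>\<^sup>2 * q\<^sup>2) / 2) = - (\<nu>\<^sup>2 / 2) * (q / (p + q))"
      using pq by (auto simp: power2_eq_square field_simps add_nonneg_eq_0_iff)
    moreover have "p / (p + q) + q / (p + q) = 1" using pq by (simp add: add_divide_distrib[symmetric])
    ultimately show ?thesis by (metis distrib_left mult.right_neutral)
  qed
  finally have inner_DD: "\<phi> t \<bullet> DD \<le> - (\<nu>\<^sup>2 / 2)" .
  have v: "x *\<^sub>R \<phi> s + y *\<^sub>R \<phi> u - z *\<^sub>R \<phi> t = \<phi> t + m *\<^sub>R DD"
  proof -
    have "\<phi> t + m *\<^sub>R DD = \<phi> t + x *\<^sub>R B + y *\<^sub>R A"
      by (simp add: DD_def x_def y_def scaleR_add_right)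
    also have "\<dots> = x *\<^sub>R \<phi> s + y *\<^sub>R \<phi> u + (1 - (x + y)) *\<^sub>R \<phi> t"
      by (simp add: A_def B_def algebra_simps)
    also have "1 - (x + y) = - z" by (simp add: xy z_def)
    finally show ?thesis by simp
  qed
  have "(norm (\<phi> t + m *\<^sub>R DD))\<^sup>2 = 1 + 2 * m * (\<phi> t \<bullet> DD) + m\<^sup>2 * (norm DD)\<^sup>2"
  proof -
    have "\<phi> t \<bullet> \<phi> t = 1" using unit[OF I(2)] by (simp add: dot_square_norm)
    then show ?thesis unfolding power2_norm_eq_inner
      by (simp add: inner_add_left inner_add_right inner_commute power2_eq_square algebra_simps)
  qed
  also have "\<dots> \<le> 1 + 2 * m * (- (\<nu>\<^sup>2 / 2)) + m\<^sup>2 * K\<^sup>2"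
    using inner_DD DD m by (intro add_mono mult_left_mono power_mono) auto
  \<comment> \<open>The value of \<open>m\<close> minimises the quadratic 1 - m \<nu>^2 + m^2 K^2;
    at the minimum the quadratic term eats up half of the gain.\<close>
  also have "m\<^sup>2 * K\<^sup>2 = m * (\<nu>\<^sup>2 / 2)"
    using pos by (simp add: m_def power2_eq_square)
  also have "1 + 2 * m * (- (\<nu>\<^sup>2 / 2)) + m * (\<nu>\<^sup>2 / 2) = 1 - m * \<nu>\<^sup>2 / 2"
    by (simp add: algebra_simps)
  finally show ?thesis
    unfolding v[symmetric]
    by (intro exI[of _ x] exI[of _ y] exI[of _ z]) (use z xy m pq in \<open>auto simp: x_def y_def z_def\<close>)
qed

section \<open>From charts to the given parametrisation\<close>

lemma has_field_derivative_within_inverse: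
  fixes p q h :: "real \<Rightarrow> real"
  assumes pq: "\<And>t. t \<in> N \<Longrightarrow> p (h t) = q t" and h: "h ` N \<subseteq> I" "continuous (at t within N) h"
    and p: "(p has_field_derivative P) (at (h t) within I)" "P \<noteq> 0"
    and q: "(q has_field_derivative Q) (at t within N)" and t: "t \<in> N"
  shows "(h has_field_derivative Q / P) (at t within N)"
proof -
  \<comment> \<open>Caratheodory's slope function gives q s - q t = g (h s) (h s - h t). Continuity
    of h keeps the factor g (h s) near P, hence nonzero, so dividing by it yields the difference
    quotient of h without assuming that h is differentiable.\<close>
  obtain g where g: "\<And>z. p z - p (h t) = g z * (z - h t)" "continuous (at (h t) within I) g" "g (h t) = P"
    using p(1) unfolding DERIV_caratheodory_within by blast
  have "continuous (at t within N) (\<lambda>s. g (h s))"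
    by (rule continuous_within_compose2[OF h(2)]) (use g(2) h(1) in \<open>auto intro: continuous_within_subset\<close>)
  then have lim: "((\<lambda>s. g (h s)) \<longlongrightarrow> P) (at t within N)"
    using g(3) by (simp add: continuous_within)
  have lim_q: "((\<lambda>s. ((q s - q t) / (s - t)) / g (h s)) \<longlongrightarrow> Q / P) (at t within N)"
    using q p(2) lim by (intro tendsto_divide) (auto simp: has_field_derivative_iff)
  have ne: "eventually (\<lambda>s. g (h s) \<noteq> 0) (at t within N)"
    using lim p(2) by (rule tendsto_imp_eventually_ne)
  have "eventually (\<lambda>s. s \<in> N \<and> s \<noteq> t) (at t within N)"
    by (auto simp: eventually_at_filter)
  with ne have "eventually (\<lambda>s. ((q s - q t) / (s - t)) / g (h s) = (h s - h t) / (s - t)) (at t within N)"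
  proof eventually_elim
    case (elim s)
    have "q s - q t = g (h s) * (h s - h t)" using g(1)[of "h s"] pq elim t by auto
    then show ?case using elim by simp
  qed
  with lim_q show ?thesis
    unfolding has_field_derivative_iff by (rule Lim_transform_eventually)
qed

text \<open>Near any parameter the curve is a chart composed with a continuous coordinate change
  \<open>h\<close>. Smoothness of the curve is known only when tested against \<open>W\<close>, so
  the separating property is used to pick a test vector that sees the nonzero derivative of the
  chart; shrinking the chart domain to a compact interval keeps that pairing away from 0 and of
  constant sign.\<close>

lemma manifold_local_form:
  fixes \<xi> :: "real \<Rightarrow> 'a::real_inner"
  assumes ab: "a < b" and cont: "continuous_on {a..b} \<xi>"
    and mfd: "one_manifold_with_boundary (\<xi> ` {a..b})"
    and sep: "\<And>v. v \<noteq> 0 \<Longrightarrow> \<exists>w\<in>W. v \<bullet> w \<noteq> 0" and \<theta>0: "\<theta>0 \<in> {a..b}"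
  obtains e \<alpha> \<beta> \<phi> \<phi>' \<phi>'' h w \<nu> where "e > 0" "\<nu> > 0" "w \<in> W" "\<alpha> < \<beta>"
    "\<And>\<theta>. \<theta> \<in> {a..b} \<inter> ball \<theta>0 e \<Longrightarrow> h \<theta> \<in> {\<alpha>..\<beta>}"
    "\<And>\<theta>. \<theta> \<in> {a..b} \<inter> ball \<theta>0 e \<Longrightarrow> \<xi> \<theta> = \<phi> (h \<theta>)"
    "continuous_on ({a..b} \<inter> ball \<theta>0 e) h"
    "\<phi> ` {\<alpha>..\<beta>} \<subseteq> \<xi> ` {a..b}"
    "\<And>t. t \<in> {\<alpha>..\<beta>} \<Longrightarrow> (\<phi> has_vector_derivative \<phi>' t) (at t within {\<alpha>..\<beta>})"
    "\<And>t. t \<in> {\<alpha>..\<beta>} \<Longrightarrow> (\<phi>' has_vector_derivative \<phi>'' t) (at t within {\<alpha>..\<beta>})"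
    "continuous_on {\<alpha>..\<beta>} \<phi>''"
    "(\<forall>t\<in>{\<alpha>..\<beta>}. \<nu> \<le> \<phi>' t \<bullet> w) \<or> (\<forall>t\<in>{\<alpha>..\<beta>}. \<nu> \<le> \<phi>' t \<bullet> (- w))"
proof -
  let ?M = "\<xi> ` {a..b}"
  obtain J \<phi> where chart: "half_line_chart ?M J \<phi>" "\<xi> \<theta>0 \<in> \<phi> ` J"
    using mfd \<theta>0 unfolding one_manifold_with_boundary_def by blast
  then obtain t0 where t0: "t0 \<in> J" "\<phi> t0 = \<xi> \<theta>0" by auto
  from chart(1) obtain g where J: "openin (top_of_set {0..}) J" and M: "openin (top_of_set ?M) (\<phi> ` J)"
    and g: "homeomorphism J (\<phi> ` J) \<phi> g" and C2: "C2_on J \<phi>"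
    and ne: "\<forall>t\<in>J. vector_derivative \<phi> (at t within J) \<noteq> 0"
    unfolding half_line_chart_def by blast
  from C2 obtain \<phi>' \<phi>'' where d1: "\<And>t. t \<in> J \<Longrightarrow> (\<phi> has_vector_derivative \<phi>' t) (at t within J)"
    and d2: "\<And>t. t \<in> J \<Longrightarrow> (\<phi>' has_vector_derivative \<phi>'' t) (at t within J)" and d3: "continuous_on J \<phi>''"
    unfolding C2_on_def by blast
  obtain e0 where e0: "e0 > 0" "cball t0 e0 \<inter> {0..} \<subseteq> J" and t0_nonneg: "t0 \<ge> 0"
    using J t0(1) unfolding openin_contains_cball by fastforce
  \<comment> \<open>The point may be the boundary point 0 of the half-line, so it is approached from
    the right.\<close>
  have "at t0 within J \<noteq> bot"
  proof -
    have "t0 islimpt {t0..t0 + e0}" using e0(1) by (simp add: islimpt_Icc)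
    moreover have "{t0..t0 + e0} \<subseteq> J" using e0 t0_nonneg by (auto simp: dist_real_def subset_iff)
    ultimately show ?thesis using islimpt_subset trivial_limit_within by blast
  qed
  then have "\<phi>' t0 \<noteq> 0" using ne t0(1) vector_derivative_within[OF _ d1[OF t0(1)]] by auto
  then obtain w where w: "w \<in> W" "\<phi>' t0 \<bullet> w \<noteq> 0" using sep by blast
  define \<nu> where "\<nu> = \<bar>\<phi>' t0 \<bullet> w\<bar> / 2"
  have \<nu>: "\<nu> > 0" using w by (simp add: \<nu>_def)
  have "continuous_on J \<phi>'"
    using d2 by (meson continuous_on_eq_continuous_within has_vector_derivative_continuous)
  then have "continuous_on J (\<lambda>t. \<phi>' t \<bullet> w)" by (intro continuous_intros)
  then obtain e1 where e1: "e1 > 0" "\<And>t. t \<in> J \<Longrightarrow> dist t t0 < e1 \<Longrightarrow> dist (\<phi>' t \<bullet> w) (\<phi>' t0 \<bullet> w) < \<nu>"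
    using t0(1) \<nu> unfolding continuous_on_iff by meson
  define r where "r = min e0 (e1 / 2)"
  have r: "r > 0" "r \<le> e0" "r < e1" using e0 e1 by (auto simp: r_def)
  define \<alpha> where "\<alpha> = max 0 (t0 - r)"
  define \<beta> where "\<beta> = t0 + r"
  have I: "{\<alpha>..\<beta>} \<subseteq> J" using e0 r by (auto simp: \<alpha>_def \<beta>_def dist_real_def subset_iff)
  have I_near: "dist t t0 < e1" if "t \<in> {\<alpha>..\<beta>}" for t using that r by (auto simp: \<alpha>_def \<beta>_def dist_real_def)
  have I_iff: "t \<in> {\<alpha>..\<beta>}" if "t \<in> J" "dist t t0 < r" for t
    using that J openin_imp_subset[OF J] by (auto simp: \<alpha>_def \<beta>_def dist_real_def)
  have sgn: "(\<forall>t\<in>{\<alpha>..\<beta>}. \<nu> \<le> \<phi>' t \<bullet> w) \<or> (\<forall>t\<in>{\<alpha>..\<beta>}. \<nu> \<le> \<phi>' t \<bullet> (- w))"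
  proof (cases "\<phi>' t0 \<bullet> w > 0")
    case True
    have "\<nu> \<le> \<phi>' t \<bullet> w" if "t \<in> {\<alpha>..\<beta>}" for t
      using e1(2)[of t] I I_near[OF that] that True by (auto simp: \<nu>_def dist_real_def subset_iff abs_if split: if_splits)
    then show ?thesis by blast
  next
    case False
    have "\<nu> \<le> \<phi>' t \<bullet> (- w)" if "t \<in> {\<alpha>..\<beta>}" for t
      using e1(2)[of t] I I_near[OF that] that False by (auto simp: \<nu>_def dist_real_def subset_iff abs_if split: if_splits)
    then show ?thesis by blast
  qed
  define h where "h = (\<lambda>\<theta>. g (\<xi> \<theta>))"
  \<comment> \<open>Parameters whose points lie in the chart. This set is open because the image of
    the chart is open in the curve, which is how the inverse chart becomes applicable near
    \<open>\<theta>0\<close>.\<close>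
  define V where "V = {a..b} \<inter> \<xi> -` (\<phi> ` J)"
  have V: "openin (top_of_set {a..b}) V"
    unfolding V_def by (rule continuous_openin_preimage[OF cont _ M]) auto
  have \<theta>V: "\<theta>0 \<in> V" using \<theta>0 chart(2) by (auto simp: V_def)
  obtain e2 where e2: "e2 > 0" "ball \<theta>0 e2 \<inter> {a..b} \<subseteq> V"
    using V \<theta>V unfolding openin_contains_ball by blast
  have gc: "continuous_on (\<phi> ` J) g" using g by (simp add: homeomorphism_def)
  have hV: "continuous_on V h" unfolding h_def
    by (rule continuous_on_compose2[OF gc]) (use cont in \<open>auto simp: V_def intro: continuous_on_subset\<close>)
  have h0: "h \<theta>0 = t0" using g t0 by (metis h_def homeomorphism_apply1)
  obtain e3 where e3: "e3 > 0" "\<And>\<theta>. \<theta> \<in> V \<Longrightarrow> dist \<theta> \<theta>0 < e3 \<Longrightarrow> dist (h \<theta>) t0 < r"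
    using hV \<theta>V r(1) h0 unfolding continuous_on_iff by metis
  define e where "e = min e2 e3"
  have "e > 0" using e2 e3 by (simp add: e_def)
  have eV: "\<theta> \<in> V" "dist \<theta> \<theta>0 < e3" if "\<theta> \<in> {a..b} \<inter> ball \<theta>0 e" for \<theta>
    using that e2 by (auto simp: e_def dist_commute)
  show thesis
  proof (rule that[OF \<open>e > 0\<close> \<nu> w(1)])
    show "\<alpha> < \<beta>" using r t0_nonneg by (auto simp: \<alpha>_def \<beta>_def)
    fix \<theta> assume \<theta>: "\<theta> \<in> {a..b} \<inter> ball \<theta>0 e"
    have "\<xi> \<theta> \<in> \<phi> ` J" using eV[OF \<theta>] by (auto simp: V_def)
    then have hJ: "h \<theta> \<in> J" "\<phi> (h \<theta>) = \<xi> \<theta>"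
      using g by (auto simp: h_def homeomorphism_def)
    show "h \<theta> \<in> {\<alpha>..\<beta>}" using e3(2) eV[OF \<theta>] hJ I_iff by blast
    show "\<xi> \<theta> = \<phi> (h \<theta>)" using hJ by simp
  next
    show "continuous_on ({a..b} \<inter> ball \<theta>0 e) h" using hV eV by (meson continuous_on_subset subsetI)
    show "\<phi> ` {\<alpha>..\<beta>} \<subseteq> ?M" using I openin_imp_subset[OF M] by blast
    show "(\<phi> has_vector_derivative \<phi>' t) (at t within {\<alpha>..\<beta>})" if "t \<in> {\<alpha>..\<beta>}" for t
      using d1 I that has_vector_derivative_within_subset by blast
    show "(\<phi>' has_vector_derivative \<phi>'' t) (at t within {\<alpha>..\<beta>})" if "t \<in> {\<alpha>..\<beta>}" for t
      using d2 I that has_vector_derivative_within_subset by blast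
    show "continuous_on {\<alpha>..\<beta>} \<phi>''" using d3 I continuous_on_subset by blast
  qed (rule sgn)
qed

text \<open>Pairing with a fixed vector makes the mean value theorem available, which has no
  equality form for vector-valued curves; Cauchy-Schwarz then returns to the chord.\<close>

lemma chord_lower_bound:
  fixes \<phi> :: "real \<Rightarrow> 'a::real_inner"
  assumes d1: "\<And>t. t \<in> {\<alpha>..\<beta>} \<Longrightarrow> (\<phi> has_vector_derivative \<phi>' t) (at t within {\<alpha>..\<beta>})"
    and \<nu>: "\<nu> > 0" "\<And>t. t \<in> {\<alpha>..\<beta>} \<Longrightarrow> \<nu> \<le> \<phi>' t \<bullet> w"
    and st: "s \<in> {\<alpha>..\<beta>}" "t \<in> {\<alpha>..\<beta>}"
  shows "\<nu> * \<bar>s - t\<bar> \<le> norm w * norm (\<phi> s - \<phi> t)"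
proof -
  have *: "\<nu> * (t - s) \<le> norm w * norm (\<phi> s - \<phi> t)" if "s \<in> {\<alpha>..\<beta>}" "t \<in> {\<alpha>..\<beta>}" "s < t" for s t
  proof -
    have "\<exists>x\<in>{s<..<t}. \<phi> t \<bullet> w - \<phi> s \<bullet> w = (t - s) * (\<phi>' x \<bullet> w)"
    proof (rule mvt_simple[OF \<open>s < t\<close>])
      fix x assume x: "s \<le> x" "x \<le> t"
      then have "(\<phi> has_vector_derivative \<phi>' x) (at x within {s..t})"
        using that by (intro has_vector_derivative_within_subset[OF d1]) auto
      then have "(\<phi> has_derivative (\<lambda>h. h *\<^sub>R \<phi>' x)) (at x within {s..t})"
        by (simp add: has_vector_derivative_def)
      then show "((\<lambda>x. \<phi> x \<bullet> w) has_derivative (\<lambda>h. h * (\<phi>' x \<bullet> w))) (at x within {s..t})"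
        by (auto intro!: derivative_eq_intros)
    qed
    then obtain x where x: "x \<in> {s<..<t}" "\<phi> t \<bullet> w - \<phi> s \<bullet> w = (t - s) * (\<phi>' x \<bullet> w)" by blast
    have "\<nu> * (t - s) \<le> (t - s) * (\<phi>' x \<bullet> w)"
      using \<nu>(2)[of x] x(1) that by (subst mult.commute) (intro mult_left_mono, auto)
    also have "\<dots> = (\<phi> t - \<phi> s) \<bullet> w" using x by (simp add: inner_diff_left)
    also have "\<dots> \<le> norm (\<phi> t - \<phi> s) * norm w" by (rule norm_cauchy_schwarz)
    finally show ?thesis by (simp add: norm_minus_commute mult.commute)
  qed
  show ?thesis
    using *[of s t] *[of t s] st by (cases s t rule: linorder_cases) (auto simp: norm_minus_commute)
qed

text \<open>Encodes when "above, below, above" is rare for a Gaussian process indexed by the points: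
  the sign pattern and \<open>x + y - z = 1\<close> make the combination exceed the level too, while
  its variance is at most \<open>k\<close>. For k < 1 this costs an exponential factor.\<close>

definition contracting_triple :: "real \<Rightarrow> 'a::real_inner \<Rightarrow> 'a \<Rightarrow> 'a \<Rightarrow> bool" where
  "contracting_triple k p q r \<longleftrightarrow> (\<exists>x y z. 0 \<le> x \<and> 0 \<le> y \<and> 0 \<le> z \<and> x + y - z = 1 \<and>
     (norm (x *\<^sub>R p + y *\<^sub>R r - z *\<^sub>R q))\<^sup>2 \<le> k)"

lemma contracting_triple_mono: "contracting_triple k p q r \<Longrightarrow> k \<le> l \<Longrightarrow> contracting_triple l p q r"
  unfolding contracting_triple_def by (meson order_trans)

lemma contracting_triple_commute: "contracting_triple k p q r \<Longrightarrow> contracting_triple k r q p"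
  unfolding contracting_triple_def by (metis add.commute)

text \<open>Collects all local estimates with a single constant \<open>B\<close>, so that the
  predicate weakens when \<open>B\<close> grows or \<open>T\<close> shrinks, as
  \<open>compact_uniform_neighbourhoods\<close> requires. This explains the form 1 - 1/B of the
  contraction constant.\<close>

definition regular_on :: "(real \<Rightarrow> 'a::real_inner) \<Rightarrow> (real \<Rightarrow> 'a) \<Rightarrow> real set \<Rightarrow> real \<Rightarrow> real set \<Rightarrow> bool" where
  "regular_on \<xi> D S B T \<longleftrightarrow> B > 0 \<and>
     (\<forall>t\<in>T. (\<xi> has_vector_derivative D t) (at t within S)) \<and>
     (\<forall>s\<in>T. \<forall>t\<in>T. norm (D s - D t) \<le> B * \<bar>s - t\<bar>) \<and>
     (\<forall>s\<in>T. \<forall>t\<in>T. \<forall>u\<in>T. s < t \<longrightarrow> t < u \<longrightarrow> contracting_triple (1 - 1 / B) (\<xi> s) (\<xi> t) (\<xi> u))"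

lemma regular_on_mono:
  assumes "regular_on \<xi> D S B T" "B \<le> B'" "T' \<subseteq> T"
  shows "regular_on \<xi> D S B' T'"
proof -
  have B: "B > 0" "1 / B' \<le> 1 / B" using assms by (auto simp: regular_on_def frac_le)
  have "norm (D s - D t) \<le> B' * \<bar>s - t\<bar>" if "s \<in> T'" "t \<in> T'" for s t
  proof -
    have "norm (D s - D t) \<le> B * \<bar>s - t\<bar>" using assms that unfolding regular_on_def by blast
    also have "\<dots> \<le> B' * \<bar>s - t\<bar>" using assms by (simp add: mult_right_mono)
    finally show ?thesis .
  qed
  moreover have "contracting_triple (1 - 1 / B') (\<xi> s) (\<xi> t) (\<xi> u)"
    if "s \<in> T'" "t \<in> T'" "u \<in> T'" "s < t" "t < u" for s t u
    by (rule contracting_triple_mono[of "1 - 1 / B"]) (use assms that B in \<open>auto simp: regular_on_def subset_iff\<close>)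
  ultimately show ?thesis
    using assms unfolding regular_on_def by auto
qed

lemma C2_on_minus:
  fixes g :: "real \<Rightarrow> 'a::real_normed_vector"
  assumes "C2_on S g"
  shows "C2_on S (\<lambda>t. - g t)"
proof -
  obtain g' g'' where "\<forall>t\<in>S. (g has_vector_derivative g' t) (at t within S)"
     "\<forall>t\<in>S. (g' has_vector_derivative g'' t) (at t within S)" "continuous_on S g''"
    using assms unfolding C2_on_def by blast
  then show ?thesis unfolding C2_on_def
    by (intro exI[of _ "\<lambda>t. - g' t"] exI[of _ "\<lambda>t. - g'' t"])
      (auto intro!: has_vector_derivative_minus continuous_on_minus)
qed

text \<open>
  The coordinate change \<open>h\<close> is only known to be continuous; it is smooth because \<open>q = (\<phi> \<circ> h) \<bullet> w\<close> is
  smooth and \<open>\<phi> \<bullet> w\<close> has nonvanishing derivative.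
\<close>

lemma chart_C1:
  fixes \<phi> :: "real \<Rightarrow> 'a::real_inner" and h q q' q'' :: "real \<Rightarrow> real"
  assumes hI: "h ` N \<subseteq> I" and hc: "continuous_on N h"
    and d1: "\<And>t. t \<in> I \<Longrightarrow> (\<phi> has_vector_derivative \<phi>' t) (at t within I)"
    and d2: "\<And>t. t \<in> I \<Longrightarrow> (\<phi>' has_vector_derivative \<phi>'' t) (at t within I)"
    and d3: "continuous_on I \<phi>''"
    and ne: "\<And>t. t \<in> I \<Longrightarrow> \<phi>' t \<bullet> w \<noteq> 0"
    and q0: "\<And>t. t \<in> N \<Longrightarrow> \<phi> (h t) \<bullet> w = q t"
    and q1: "\<And>t. t \<in> N \<Longrightarrow> (q has_vector_derivative q' t) (at t within N)"
    and q2: "\<And>t. t \<in> N \<Longrightarrow> (q' has_vector_derivative q'' t) (at t within N)"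
    and q3: "continuous_on N q''"
  obtains D D' where "\<And>t. t \<in> N \<Longrightarrow> ((\<lambda>t. \<phi> (h t)) has_vector_derivative D t) (at t within N)"
    "\<And>t. t \<in> N \<Longrightarrow> (D has_vector_derivative D' t) (at t within N)" "continuous_on N D'"
proof -
  define P where "P t = \<phi>' (h t) \<bullet> w" for t
  define h' where "h' t = q' t / P t" for t
  have P0: "P t \<noteq> 0" if "t \<in> N" for t using ne hI that by (auto simp: P_def)
  have hd: "(h has_vector_derivative h' t) (at t within N)" if t: "t \<in> N" for t
    unfolding has_real_derivative_iff_has_vector_derivative[symmetric] h'_def
  proof (rule has_field_derivative_within_inverse[where p = "\<lambda>t. \<phi> t \<bullet> w" and q = q and I = I])
    show "continuous (at t within N) h" using hc t by (simp add: continuous_on_eq_continuous_within)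
    have "(\<phi> has_derivative (\<lambda>x. x *\<^sub>R \<phi>' (h t))) (at (h t) within I)"
      using d1 hI t by (auto simp: has_vector_derivative_def)
    then have "((\<lambda>t. \<phi> t \<bullet> w) has_derivative (\<lambda>x. x * P t)) (at (h t) within I)"
      unfolding P_def by (auto intro!: derivative_eq_intros)
    then show "((\<lambda>t. \<phi> t \<bullet> w) has_field_derivative P t) (at (h t) within I)"
      by (simp add: has_field_derivative_def mult_commute_abs)
    show "(q has_field_derivative q' t) (at t within N)"
      using q1[OF t] by (simp add: has_real_derivative_iff_has_vector_derivative)
  qed (use q0 hI P0 t in auto)
  have sub: "(f has_vector_derivative d) (at (h t) within h ` N)" if "(f has_vector_derivative d) (at (h t) within I)"
    for f :: "real \<Rightarrow> 'a" and d t
    using that hI by (rule has_vector_derivative_within_subset)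
  have chain1: "((\<lambda>t. \<phi> (h t)) has_vector_derivative (h' t *\<^sub>R \<phi>' (h t))) (at t within N)" if t: "t \<in> N" for t
    using vector_diff_chain_within[OF hd[OF t] sub[OF d1]] hI t by (auto simp: o_def)
  have chain2: "((\<lambda>t. \<phi>' (h t)) has_vector_derivative (h' t *\<^sub>R \<phi>'' (h t))) (at t within N)" if t: "t \<in> N" for t
    using vector_diff_chain_within[OF hd[OF t] sub[OF d2]] hI t by (auto simp: o_def)
  define P' where "P' t = h' t * (\<phi>'' (h t) \<bullet> w)" for t
  have Pd: "(P has_field_derivative P' t) (at t within N)" if t: "t \<in> N" for t
  proof -
    have "((\<lambda>t. \<phi>' (h t)) has_derivative (\<lambda>x. x *\<^sub>R h' t *\<^sub>R \<phi>'' (h t))) (at t within N)"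
      using chain2[OF t] by (simp add: has_vector_derivative_def)
    then have "(P has_derivative (\<lambda>x. x * P' t)) (at t within N)"
      unfolding P_def P'_def by (auto intro!: derivative_eq_intros)
    then show ?thesis by (simp add: has_field_derivative_def mult_commute_abs)
  qed
  define h'' where "h'' t = (q'' t * P t - q' t * P' t) / (P t * P t)" for t
  have h'd: "(h' has_field_derivative h'' t) (at t within N)" if t: "t \<in> N" for t
    unfolding h'_def h''_def
    using q2[OF t] Pd[OF t] P0[OF t]
    by (intro DERIV_divide) (auto simp: has_real_derivative_iff_has_vector_derivative)
  have cont_vd: "continuous_on S f" if "\<And>t. t \<in> S \<Longrightarrow> (f has_vector_derivative f' t) (at t within S)"
    for S and f f' :: "real \<Rightarrow> 'b::real_normed_vector"
    using that by (meson continuous_on_eq_continuous_within has_vector_derivative_continuous)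
  have c: "continuous_on N (\<lambda>t. \<phi>' (h t))" "continuous_on N (\<lambda>t. \<phi>'' (h t))"
    using hc hI d3 cont_vd[OF d2] by (auto intro: continuous_on_compose2)
  have cP: "continuous_on N P" unfolding P_def by (intro continuous_intros c)
  have "continuous_on N h'" unfolding h'_def
    using P0 by (intro continuous_intros cP cont_vd[OF q2]) auto
  moreover from this have "continuous_on N P'" unfolding P'_def by (intro continuous_intros c)
  moreover from this have "continuous_on N h''" unfolding h''_def
    using P0 by (intro continuous_intros cP cont_vd[OF q2] q3) auto
  ultimately have C1: "continuous_on N (\<lambda>t. h' t *\<^sub>R (h' t *\<^sub>R \<phi>'' (h t)) + h'' t *\<^sub>R \<phi>' (h t))"
    by (intro continuous_intros c)
  have "((\<lambda>t. h' t *\<^sub>R \<phi>' (h t)) has_vector_derivative (h' t *\<^sub>R (h' t *\<^sub>R \<phi>'' (h t)) + h'' t *\<^sub>R \<phi>' (h t))) (at t within N)"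
    if t: "t \<in> N" for t
    by (rule has_vector_derivative_scaleR[OF h'd[OF t] chain2[OF t]])
  from that[OF chain1 this C1] show thesis .
qed

text \<open>The derivative in the parameter is Lipschitz because the chart and the coordinate change
  are both twice differentiable. The contraction is proved in the chart coordinate instead, since
  only there do chords have a lower bound proportional to the coordinate difference.\<close>

lemma manifold_locally_regular:
  fixes \<xi> :: "real \<Rightarrow> 'a::real_inner"
  assumes ab: "a < b" and cont: "continuous_on {a..b} \<xi>" and inj: "inj_on \<xi> {a..b}"
    and mfd: "one_manifold_with_boundary (\<xi> ` {a..b})"
    and sep: "\<And>v. v \<noteq> 0 \<Longrightarrow> \<exists>w\<in>W. v \<bullet> w \<noteq> 0"
    and C2: "\<And>w. w \<in> W \<Longrightarrow> C2_on {a..b} (\<lambda>t. \<xi> t \<bullet> w)"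
    and unit: "\<And>t. t \<in> {a..b} \<Longrightarrow> norm (\<xi> t) = 1" and \<theta>0: "\<theta>0 \<in> {a..b}"
  shows "\<exists>e>0. \<exists>B. regular_on \<xi> (\<lambda>t. vector_derivative \<xi> (at t within {a..b})) {a..b} B ({a..b} \<inter> ball \<theta>0 e)"
proof -
  define D where "D t = vector_derivative \<xi> (at t within {a..b})" for t
  obtain e \<alpha> \<beta> \<phi> \<phi>' \<phi>'' h w0 \<nu>0 where e: "e > 0" and \<nu>0: "\<nu>0 > 0" and w0: "w0 \<in> W" and \<alpha>\<beta>: "\<alpha> < \<beta>"
    and hI: "\<And>\<theta>. \<theta> \<in> {a..b} \<inter> ball \<theta>0 e \<Longrightarrow> h \<theta> \<in> {\<alpha>..\<beta>}"
    and \<xi>h: "\<And>\<theta>. \<theta> \<in> {a..b} \<inter> ball \<theta>0 e \<Longrightarrow> \<xi> \<theta> = \<phi> (h \<theta>)"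
    and hc: "continuous_on ({a..b} \<inter> ball \<theta>0 e) h"
    and \<phi>M: "\<phi> ` {\<alpha>..\<beta>} \<subseteq> \<xi> ` {a..b}"
    and d1: "\<And>t. t \<in> {\<alpha>..\<beta>} \<Longrightarrow> (\<phi> has_vector_derivative \<phi>' t) (at t within {\<alpha>..\<beta>})"
    and d2: "\<And>t. t \<in> {\<alpha>..\<beta>} \<Longrightarrow> (\<phi>' has_vector_derivative \<phi>'' t) (at t within {\<alpha>..\<beta>})"
    and d3: "continuous_on {\<alpha>..\<beta>} \<phi>''"
    and sgn: "(\<forall>t\<in>{\<alpha>..\<beta>}. \<nu>0 \<le> \<phi>' t \<bullet> w0) \<or> (\<forall>t\<in>{\<alpha>..\<beta>}. \<nu>0 \<le> \<phi>' t \<bullet> (- w0))"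
    by (rule manifold_local_form[OF ab cont mfd sep \<theta>0]) (assumption | rule that)+
  \<comment> \<open>A change of sign makes the derivative positive along the test vector. The
    negative of \<open>w0\<close> may lie outside \<open>W\<close>, but smoothness passes to
    it.\<close>
  obtain w where w: "\<And>t. t \<in> {\<alpha>..\<beta>} \<Longrightarrow> \<nu>0 \<le> \<phi>' t \<bullet> w" and C2w: "C2_on {a..b} (\<lambda>t. \<xi> t \<bullet> w)"
  proof (cases "\<forall>t\<in>{\<alpha>..\<beta>}. \<nu>0 \<le> \<phi>' t \<bullet> w0")
    case True
    then show ?thesis using C2[OF w0] by (intro that[of w0]) auto
  next
    case False
    then have "\<forall>t\<in>{\<alpha>..\<beta>}. \<nu>0 \<le> \<phi>' t \<bullet> (- w0)" using sgn by blast
    moreover have "C2_on {a..b} (\<lambda>t. \<xi> t \<bullet> (- w0))"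
      using C2_on_minus[OF C2[OF w0]] by simp
    ultimately show ?thesis by (intro that[of "- w0"]) auto
  qed
  obtain q' q'' where q1: "\<And>t. t \<in> {a..b} \<Longrightarrow> ((\<lambda>t. \<xi> t \<bullet> w) has_vector_derivative q' t) (at t within {a..b})"
    and q2: "\<And>t. t \<in> {a..b} \<Longrightarrow> (q' has_vector_derivative q'' t) (at t within {a..b})" and q3: "continuous_on {a..b} q''"
    using C2w unfolding C2_on_def by blast
  let ?N = "{a..b} \<inter> ball \<theta>0 e"
  obtain E E' where E: "\<And>t. t \<in> ?N \<Longrightarrow> ((\<lambda>t. \<phi> (h t)) has_vector_derivative E t) (at t within ?N)"
    and E': "\<And>t. t \<in> ?N \<Longrightarrow> (E has_vector_derivative E' t) (at t within ?N)" "continuous_on ?N E'"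
  proof (rule chart_C1[of h ?N "{\<alpha>..\<beta>}" \<phi> \<phi>' \<phi>'' w "\<lambda>t. \<xi> t \<bullet> w" q' q''])
    show "\<phi>' t \<bullet> w \<noteq> 0" if "t \<in> {\<alpha>..\<beta>}" for t using w[OF that] \<nu>0 by simp
    show "((\<lambda>t. \<xi> t \<bullet> w) has_vector_derivative q' t) (at t within ?N)" if "t \<in> ?N" for t
      by (rule has_vector_derivative_within_subset[OF q1]) (use that in auto)
    show "(q' has_vector_derivative q'' t) (at t within ?N)" if "t \<in> ?N" for t
      by (rule has_vector_derivative_within_subset[OF q2]) (use that in auto)
    show "continuous_on ?N q''" using q3 by (rule continuous_on_subset) auto
  qed (use hI hc d1 d2 d3 \<xi>h in auto)
  have within_eq: "at t within ?N = at t within {a..b}" if "t \<in> ?N" for t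
    by (rule at_within_nhd[where S = "ball \<theta>0 e"]) (use that in auto)
  have \<xi>E: "(\<xi> has_vector_derivative E t) (at t within {a..b})" if "t \<in> ?N" for t
  proof -
    have "(\<xi> has_vector_derivative E t) (at t within ?N)"
      by (rule has_vector_derivative_transform[OF that _ E[OF that]]) (use \<xi>h in auto)
    then show ?thesis using within_eq[OF that] by simp
  qed
  have DE: "D t = E t" if "t \<in> ?N" for t
    unfolding D_def using ab that
    by (intro vector_derivative_within \<xi>E) (auto simp: trivial_limit_within islimpt_Icc)
  \<comment> \<open>The closed ball of half the radius supplies the compactness needed for a
    Lipschitz constant.\<close>
  let ?S = "{a..b} \<inter> cball \<theta>0 (e / 2)"
  have SN: "?S \<subseteq> ?N" using e by auto
  obtain B1 where B1: "B1 > 0" "\<And>s t. s \<in> ?S \<Longrightarrow> t \<in> ?S \<Longrightarrow> norm (E s - E t) \<le> B1 * \<bar>s - t\<bar>"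
  proof (rule C1_lipschitz_on_compact[of ?S E E'])
    show "(E has_vector_derivative E' t) (at t within ?S)" if "t \<in> ?S" for t
      using E'(1) that SN has_vector_derivative_within_subset by blast
    show "continuous_on ?S E'" using E'(2) SN by (rule continuous_on_subset)
  qed (auto intro!: convex_Int compact_Int_closed)
  obtain K where K: "K > 0" "\<And>s t. s \<in> {\<alpha>..\<beta>} \<Longrightarrow> t \<in> {\<alpha>..\<beta>} \<Longrightarrow> norm (\<phi>' s - \<phi>' t) \<le> K * \<bar>s - t\<bar>"
    by (rule C1_lipschitz_on_compact[OF _ _ d2 d3]) auto
  have "w \<noteq> 0" using w[of \<alpha>] \<nu>0 \<alpha>\<beta> by auto
  define \<nu> where "\<nu> = \<nu>0 / norm w"
  have \<nu>: "\<nu> > 0" using \<nu>0 \<open>w \<noteq> 0\<close> by (simp add: \<nu>_def)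
  have chord: "\<nu> * \<bar>s - t\<bar> \<le> norm (\<phi> s - \<phi> t)" if "s \<in> {\<alpha>..\<beta>}" "t \<in> {\<alpha>..\<beta>}" for s t
    using chord_lower_bound[OF d1 \<nu>0 w that] \<open>w \<noteq> 0\<close> by (simp add: \<nu>_def field_simps)
  have \<phi>_unit: "norm (\<phi> t) = 1" if "t \<in> {\<alpha>..\<beta>}" for t using \<phi>M unit that by force
  define m where "m = \<nu>\<^sup>2 / (2 * K\<^sup>2)"
  have m: "m > 0" using K \<nu> by (simp add: m_def)
  have "\<theta>0 \<in> ?N" using \<theta>0 e by simp
  then obtain e1 where e1: "e1 > 0" "\<And>\<theta>. \<theta> \<in> ?N \<Longrightarrow> dist \<theta> \<theta>0 < e1 \<Longrightarrow> dist (h \<theta>) (h \<theta>0) < sqrt m / 2"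
    using hc[unfolded continuous_on_iff, rule_format, of \<theta>0 "sqrt m / 2"] m by auto
  define e2 where "e2 = min e1 (e / 2)"
  have e2: "e2 > 0" using e1 e by (simp add: e2_def)
  let ?T = "{a..b} \<inter> ball \<theta>0 e2"
  have TS: "?T \<subseteq> ?S" by (auto simp: e2_def)
  have triple: "contracting_triple (1 - m * \<nu>\<^sup>2 / 2) (\<xi> s) (\<xi> t) (\<xi> u)"
    if stu: "s \<in> ?T" "t \<in> ?T" "u \<in> ?T" "s < t" "t < u" for s t u
  proof -
    have "{s..u} \<subseteq> ?N"
    proof
      fix v assume v: "v \<in> {s..u}"
      have "s \<in> ball \<theta>0 e" "u \<in> ball \<theta>0 e" using stu TS SN by blast+
      then have "v \<in> ball \<theta>0 e" using v by (auto simp: dist_real_def abs_less_iff)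
      then show "v \<in> ?N" using v stu by auto
    qed
    \<comment> \<open>A continuous injection of an interval is strictly monotone, so
      \<open>h\<close> preserves or reverses the order of the three points. Reversal is harmless
      because contraction is symmetric in the outer points.\<close>
    moreover have "inj_on h ?N"
      by (rule inj_onI) (metis IntD1 \<xi>h inj inj_onD)
    ultimately have mono: "h s < h t \<and> h t < h u \<or> h u < h t \<and> h t < h s"
      using stu hc by (intro continuous_inj_imp_mono) (auto intro: continuous_on_subset inj_on_subset)
    have N: "s \<in> ?N" "t \<in> ?N" "u \<in> ?N" using stu TS SN by blast+
    have "dist s \<theta>0 < e1" "dist u \<theta>0 < e1" using stu by (auto simp: e2_def dist_commute)
    then have "dist (h s) (h \<theta>0) < sqrt m / 2" "dist (h u) (h \<theta>0) < sqrt m / 2"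
      using e1(2) N by blast+
    then have "\<bar>h u - h s\<bar> \<le> sqrt m" unfolding dist_real_def by arith
    then have "(h u - h s)\<^sup>2 \<le> m" using m sqrt_ge_absD[of "h u - h s" m] by (simp add: real_le_rsqrt)
    then have sm: "(h u - h s)\<^sup>2 \<le> m" "(h s - h u)\<^sup>2 \<le> m" by (auto simp: power2_commute)
    note close = close_triple_contraction[OF d1 K(2) chord \<phi>_unit K(1) \<nu> m_def, folded contracting_triple_def]
    have I: "h s \<in> {\<alpha>..\<beta>}" "h t \<in> {\<alpha>..\<beta>}" "h u \<in> {\<alpha>..\<beta>}" using hI N by blast+
    from mono show ?thesis
    proof
      assume "h s < h t \<and> h t < h u"
      then show ?thesis using close[of "h s" "h t" "h u"] I sm N \<xi>h by simp
    next
      assume "h u < h t \<and> h t < h s"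
      then have "contracting_triple (1 - m * \<nu>\<^sup>2 / 2) (\<xi> u) (\<xi> t) (\<xi> s)"
        using close[of "h u" "h t" "h s"] I sm N \<xi>h by simp
      then show ?thesis by (rule contracting_triple_commute)
    qed
  qed
  \<comment> \<open>Large enough for the Lipschitz bound and for 1/B to be at most the contraction
    gain of the close triples.\<close>
  define B where "B = max B1 (2 / (m * \<nu>\<^sup>2))"
  have "1 / B \<le> m * \<nu>\<^sup>2 / 2"
  proof -
    have "1 / B \<le> 1 / (2 / (m * \<nu>\<^sup>2))" using m \<nu> B1 by (intro divide_left_mono) (auto simp: B_def)
    then show ?thesis by simp
  qed
  then have triple': "contracting_triple (1 - 1 / B) (\<xi> s) (\<xi> t) (\<xi> u)"
    if "s \<in> ?T" "t \<in> ?T" "u \<in> ?T" "s < t" "t < u" for s t u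
    by (intro contracting_triple_mono[OF triple[OF that]]) simp
  have lip: "norm (D s - D t) \<le> B * \<bar>s - t\<bar>" if "s \<in> ?T" "t \<in> ?T" for s t
  proof -
    have "norm (D s - D t) \<le> B1 * \<bar>s - t\<bar>"
      using B1(2)[of s t] DE[of s] DE[of t] subsetD[OF TS that(1)] subsetD[OF TS that(2)] SN by (simp add: subset_iff)
    also have "\<dots> \<le> B * \<bar>s - t\<bar>" by (intro mult_right_mono) (auto simp: B_def)
    finally show ?thesis .
  qed
  have der: "(\<xi> has_vector_derivative D t) (at t within {a..b})" if "t \<in> ?T" for t
    using \<xi>E[of t] DE[of t] subsetD[OF SN subsetD[OF TS that]] by simp
  have "B > 0" using B1 by (simp add: B_def)
  then have "regular_on \<xi> D {a..b} B ?T"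
    unfolding regular_on_def using der lip triple' by blast
  then show ?thesis using e2 unfolding D_def by blast
qed

text \<open>Injectivity and compactness keep the inner product of points with parameters at least
  \<delta> apart below some r < 1, and then the midpoint has squared norm at most (1 + r)/2. The
  middle point gets weight zero, so its position is irrelevant.\<close>

lemma far_triple_contraction:
  fixes \<xi> :: "real \<Rightarrow> 'a::real_inner"
  assumes cont: "continuous_on {a..b} \<xi>" and inj: "inj_on \<xi> {a..b}"
    and unit: "\<And>t. t \<in> {a..b} \<Longrightarrow> norm (\<xi> t) = 1" and \<delta>: "\<delta> > 0"
  shows "\<exists>\<eta>>0. \<forall>s\<in>{a..b}. \<forall>u\<in>{a..b}. \<delta> \<le> u - s \<longrightarrow> (\<forall>t. contracting_triple (1 - \<eta>) (\<xi> s) (\<xi> t) (\<xi> u))"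
proof -
  let ?C = "({a..b} \<times> {a..b}) \<inter> {p. \<delta> \<le> snd p - fst p}"
  have "compact ?C"
    by (intro compact_Int_closed compact_Times closed_Collect_le continuous_intros) auto
  have cont2: "continuous_on ?C (\<lambda>p. \<xi> (fst p) \<bullet> \<xi> (snd p))"
    by (intro continuous_intros continuous_on_compose2[OF cont]) auto
  have inner: "\<xi> s \<bullet> \<xi> u < 1" if "(s, u) \<in> ?C" for s u
  proof -
    have "s \<in> {a..b}" "u \<in> {a..b}" "s \<noteq> u" using that \<delta> by auto
    then have "\<xi> s \<noteq> \<xi> u" "\<xi> s \<bullet> \<xi> s = 1" "\<xi> u \<bullet> \<xi> u = 1"
      using inj unit by (auto simp: inj_on_def dot_square_norm)
    moreover from this have "0 < (\<xi> s - \<xi> u) \<bullet> (\<xi> s - \<xi> u)" by simp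
    ultimately show ?thesis by (simp add: inner_diff_left inner_diff_right inner_commute)
  qed
  obtain r where r: "r < 1" "\<And>s u. (s, u) \<in> ?C \<Longrightarrow> \<xi> s \<bullet> \<xi> u \<le> r"
  proof (cases "?C = {}")
    \<comment> \<open>No two parameters are that far apart, and any bound below 1 will do.\<close>
    case True
    then show ?thesis by (intro that[of 0]) auto
  next
    case False
    then obtain p where pC: "p \<in> ?C" and pm: "\<forall>q\<in>?C. \<xi> (fst q) \<bullet> \<xi> (snd q) \<le> \<xi> (fst p) \<bullet> \<xi> (snd p)"
      using continuous_attains_sup[OF \<open>compact ?C\<close> _ cont2] by blast
    have p1: "(fst p, snd p) \<in> ?C" using pC by simp
    have p2: "\<xi> s \<bullet> \<xi> u \<le> \<xi> (fst p) \<bullet> \<xi> (snd p)" if "(s, u) \<in> ?C" for s u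
      using bspec[OF pm that] by simp
    show ?thesis by (rule that[OF inner[OF p1] p2])
  qed
  have "contracting_triple (1 - (1 - r) / 2) (\<xi> s) (\<xi> t) (\<xi> u)"
    if "s \<in> {a..b}" "u \<in> {a..b}" "\<delta> \<le> u - s" for s t u
  proof -
    have "\<xi> s \<bullet> \<xi> s = 1" "\<xi> u \<bullet> \<xi> u = 1"
      using unit that by (auto simp: dot_square_norm)
    moreover have "\<xi> s \<bullet> \<xi> u \<le> r" using r(2)[of s u] that by auto
    ultimately have "(norm ((1/2) *\<^sub>R \<xi> s + (1/2) *\<^sub>R \<xi> u - 0 *\<^sub>R \<xi> t))\<^sup>2 \<le> 1 - (1 - r) / 2"
      by (simp add: power2_norm_eq_inner inner_add_left inner_add_right inner_commute diff_divide_distrib)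
    then show ?thesis unfolding contracting_triple_def
      by (intro exI[of _ "1/2"] exI[of _ "1/2"] exI[of _ 0]) auto
  qed
  then show ?thesis using r(1) by (intro exI[of _ "(1 - r) / 2"]) auto
qed

text \<open>A triple either fits into one ball of the uniform radius, where the local estimate
  applies, or its outer parameters are at least \<delta> apart. The smaller of the two gains serves
  for all triples.\<close>

lemma manifold_regular:
  fixes \<xi> :: "real \<Rightarrow> 'a::real_inner"
  assumes ab: "a < b" and cont: "continuous_on {a..b} \<xi>" and inj: "inj_on \<xi> {a..b}"
    and mfd: "one_manifold_with_boundary (\<xi> ` {a..b})"
    and sep: "\<And>v. v \<noteq> 0 \<Longrightarrow> \<exists>w\<in>W. v \<bullet> w \<noteq> 0"
    and C2: "\<And>w. w \<in> W \<Longrightarrow> C2_on {a..b} (\<lambda>t. \<xi> t \<bullet> w)"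
    and unit: "\<And>t. t \<in> {a..b} \<Longrightarrow> norm (\<xi> t) = 1"
  obtains D \<delta> B \<eta> where "\<And>t. t \<in> {a..b} \<Longrightarrow> (\<xi> has_vector_derivative D t) (at t within {a..b})"
    "\<delta> > 0" "B > 0" "\<And>s t. s \<in> {a..b} \<Longrightarrow> t \<in> {a..b} \<Longrightarrow> \<bar>s - t\<bar> < \<delta> \<Longrightarrow> norm (D s - D t) \<le> B * \<bar>s - t\<bar>"
    "\<eta> > 0" "\<And>s t u. a \<le> s \<Longrightarrow> s < t \<Longrightarrow> t < u \<Longrightarrow> u \<le> b \<Longrightarrow> contracting_triple (1 - \<eta>) (\<xi> s) (\<xi> t) (\<xi> u)"
proof -
  define D where "D t = vector_derivative \<xi> (at t within {a..b})" for t
  obtain \<delta> B where \<delta>: "\<delta> > 0" and reg: "\<And>t. t \<in> {a..b} \<Longrightarrow> regular_on \<xi> D {a..b} B ({a..b} \<inter> ball t \<delta>)"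
  proof -
    have "\<exists>\<delta>>0. \<exists>B. \<forall>x\<in>{a..b}. regular_on \<xi> D {a..b} B ({a..b} \<inter> ball x \<delta>)"
    proof (rule compact_uniform_neighbourhoods)
      show "\<exists>e>0. \<exists>B. regular_on \<xi> D {a..b} B ({a..b} \<inter> ball t e)" if "t \<in> {a..b}" for t
        using manifold_locally_regular[OF ab cont inj mfd sep C2 unit that] by (simp add: D_def[abs_def])
    qed (auto intro: regular_on_mono)
    then show ?thesis using that by blast
  qed
  have B: "B > 0" using reg[of a] ab by (auto simp: regular_on_def)
  obtain \<eta>0 where \<eta>0: "\<eta>0 > 0"
    "\<And>s u t. s \<in> {a..b} \<Longrightarrow> u \<in> {a..b} \<Longrightarrow> \<delta> \<le> u - s \<Longrightarrow> contracting_triple (1 - \<eta>0) (\<xi> s) (\<xi> t) (\<xi> u)"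
    using far_triple_contraction[OF cont inj unit \<delta>] by metis
  show thesis
  proof (rule that[OF _ \<delta> B])
    show "(\<xi> has_vector_derivative D t) (at t within {a..b})" if "t \<in> {a..b}" for t
      using reg[OF that] \<delta> that by (auto simp: regular_on_def)
    show "norm (D s - D t) \<le> B * \<bar>s - t\<bar>" if "s \<in> {a..b}" "t \<in> {a..b}" "\<bar>s - t\<bar> < \<delta>" for s t
    proof -
      have "s \<in> {a..b} \<inter> ball s \<delta>" "t \<in> {a..b} \<inter> ball s \<delta>" using that \<delta> by (auto simp: dist_real_def)
      then show ?thesis using reg[OF that(1)] unfolding regular_on_def by blast
    qed
    show "min \<eta>0 (1 / B) > 0" using \<eta>0 B by simp
    show "contracting_triple (1 - min \<eta>0 (1 / B)) (\<xi> s) (\<xi> t) (\<xi> u)" if "a \<le> s" "s < t" "t < u" "u \<le> b" for s t u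
    proof (cases "u - s < \<delta>")
      case True
      have "s \<in> {a..b}" using that by simp
      moreover have "s \<in> {a..b} \<inter> ball s \<delta>" "t \<in> {a..b} \<inter> ball s \<delta>" "u \<in> {a..b} \<inter> ball s \<delta>"
        using that True \<delta> by (auto simp: dist_real_def)
      ultimately have "contracting_triple (1 - 1 / B) (\<xi> s) (\<xi> t) (\<xi> u)"
        using reg[of s] that unfolding regular_on_def by blast
      then show ?thesis by (rule contracting_triple_mono) simp
    next
      case False
      then have "contracting_triple (1 - \<eta>0) (\<xi> s) (\<xi> t) (\<xi> u)" using that by (intro \<eta>0) auto
      then show ?thesis by (rule contracting_triple_mono) simp
    qed
  qed
qed

section \<open>Arc length, chord sums and the length formula\<close>

locale lipschitz_C1_curve =
  fixes \<xi> D :: "real \<Rightarrow> 'a::real_inner" and a b \<delta> B :: real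
  assumes ab: "a < b" and \<delta>: "\<delta> > 0" and B: "B > 0"
    and deriv: "\<And>t. t \<in> {a..b} \<Longrightarrow> (\<xi> has_vector_derivative D t) (at t within {a..b})"
    and lip: "\<And>s t. s \<in> {a..b} \<Longrightarrow> t \<in> {a..b} \<Longrightarrow> \<bar>s - t\<bar> < \<delta> \<Longrightarrow> norm (D s - D t) \<le> B * \<bar>s - t\<bar>"
begin

lemma continuous_D: "continuous_on {a..b} D"
  unfolding continuous_on_iff
proof (intro ballI allI impI)
  fix s e :: real assume s: "s \<in> {a..b}" and e: "e > 0"
  have "dist (D t) (D s) < e" if t: "t \<in> {a..b}" "dist t s < min \<delta> (e / B)" for t
  proof -
    have "dist (D t) (D s) \<le> B * \<bar>t - s\<bar>" using lip[OF t(1) s] t(2) by (simp add: dist_norm dist_real_def)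
    also have "\<dots> < e" using t(2) B by (simp add: dist_real_def field_simps)
    finally show ?thesis .
  qed
  moreover have "min \<delta> (e / B) > 0" using \<delta> e B by simp
  ultimately show "\<exists>d>0. \<forall>t\<in>{a..b}. dist t s < d \<longrightarrow> dist (D t) (D s) < e" by blast
qed

definition arc_length :: "real \<Rightarrow> real" where
  "arc_length t = integral {a..t} (\<lambda>s. norm (D s))"

lemma arc_length_diff:
  assumes "a \<le> s" "s \<le> t" "t \<le> b"
  shows "arc_length t - arc_length s = integral {s..t} (\<lambda>s. norm (D s))"
    and "(\<lambda>s. norm (D s)) integrable_on {s..t}"
proof -
  have "(\<lambda>s. norm (D s)) integrable_on {a..t}"
    using assms by (intro integrable_continuous_real continuous_intros continuous_on_subset[OF continuous_D]) auto
  then show "arc_length t - arc_length s = integral {s..t} (\<lambda>s. norm (D s))"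
    using Henstock_Kurzweil_Integration.integral_combine[OF assms(1,2)] by (fastforce simp: arc_length_def)
  show "(\<lambda>s. norm (D s)) integrable_on {s..t}"
    using assms by (intro integrable_continuous_real continuous_intros continuous_on_subset[OF continuous_D]) auto
qed

lemma arc_length_mono:
  assumes "a \<le> s" "s \<le> t" "t \<le> b"
  shows "arc_length s \<le> arc_length t"
  using arc_length_diff[OF assms] integral_nonneg[OF arc_length_diff(2)[OF assms]] by simp

text \<open>Pairing the derivative with the chord vector itself reduces the claim to the scalar
  fundamental theorem of calculus, so no integral with values in the inner product space, which is
  not assumed complete, is needed.\<close>

lemma dist_le_arc_length:
  assumes "a \<le> s" "s \<le> t" "t \<le> b"
  shows "dist (\<xi> s) (\<xi> t) \<le> arc_length t - arc_length s"
proof (cases "\<xi> t = \<xi> s")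
  case True
  then show ?thesis using arc_length_mono[OF assms] by simp
next
  case False
  define v where "v = \<xi> t - \<xi> s"
  have "((\<lambda>x. v \<bullet> D x) has_integral (v \<bullet> \<xi> t - v \<bullet> \<xi> s)) {s..t}"
  proof (rule fundamental_theorem_of_calculus[OF assms(2)])
    fix x assume x: "x \<in> {s..t}"
    have "(\<xi> has_vector_derivative D x) (at x within {s..t})"
      by (rule has_vector_derivative_within_subset[OF deriv]) (use x assms in auto)
    then show "((\<lambda>x. v \<bullet> \<xi> x) has_vector_derivative (v \<bullet> D x)) (at x within {s..t})"
      by (rule bounded_linear.has_vector_derivative[OF bounded_linear_inner_right])
  qed
  then have "v \<bullet> \<xi> t - v \<bullet> \<xi> s \<le> integral {s..t} (\<lambda>x. norm v * norm (D x))"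
    using integrable_cmul[OF arc_length_diff(2)[OF assms], of "norm v"] norm_cauchy_schwarz[of v]
    by (intro has_integral_le[OF _ integrable_integral]) auto
  also have "\<dots> = norm v * (arc_length t - arc_length s)" using arc_length_diff[OF assms] by simp
  also have "v \<bullet> \<xi> t - v \<bullet> \<xi> s = norm v * norm v"
    by (simp add: v_def inner_diff_right[symmetric] dot_square_norm power2_eq_square)
  finally have "norm v \<le> arc_length t - arc_length s" using False by (simp add: v_def)
  then show ?thesis by (simp add: v_def dist_norm norm_minus_commute)
qed

text \<open>The error is quadratic, one B (t - s)^2 for replacing the chord by the tangent at s and
  another for replacing the speed by its value at s. Summed over n cells it becomes O(1/n), the rate
  on which the choice of the grid relies.\<close>

lemma arc_length_le_dist:
  assumes "a \<le> s" "s \<le> t" "t \<le> b" "t - s < \<delta>"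
  shows "arc_length t - arc_length s \<le> dist (\<xi> s) (\<xi> t) + 2 * B * (t - s)\<^sup>2"
proof -
  have "norm (\<xi> t - \<xi> s - (t - s) *\<^sub>R D s) \<le> B * (t - s)\<^sup>2"
  proof (rule lipschitz_derivative_linearization[where S = "{s..t}"])
    show "(\<xi> has_vector_derivative D x) (at x within {s..t})" if "x \<in> {s..t}" for x
      by (rule has_vector_derivative_within_subset[OF deriv]) (use that assms in auto)
  qed (use lip B assms in \<open>auto simp: closed_segment_eq_real_ivl\<close>)
  moreover have "norm ((t - s) *\<^sub>R D s) \<le> norm (\<xi> t - \<xi> s) + norm (\<xi> t - \<xi> s - (t - s) *\<^sub>R D s)"
    using norm_triangle_ineq4[of "\<xi> t - \<xi> s" "\<xi> t - \<xi> s - (t - s) *\<^sub>R D s"] by simp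
  moreover have "norm ((t - s) *\<^sub>R D s) = (t - s) * norm (D s)" using assms by simp
  moreover have "norm (\<xi> t - \<xi> s) = dist (\<xi> s) (\<xi> t)" by (simp add: dist_norm norm_minus_commute)
  ultimately have 1: "(t - s) * norm (D s) \<le> dist (\<xi> s) (\<xi> t) + B * (t - s)\<^sup>2" by linarith
  have "arc_length t - arc_length s \<le> integral {s..t} (\<lambda>_. norm (D s) + B * (t - s))"
    unfolding arc_length_diff(1)[OF assms(1-3)]
  proof (rule integral_le[OF arc_length_diff(2)[OF assms(1-3)]])
    fix x assume x: "x \<in> {s..t}"
    then have "norm (D x - D s) \<le> B * \<bar>x - s\<bar>" using assms by (intro lip) auto
    also have "\<dots> \<le> B * (t - s)" using x B by simp
    finally show "norm (D x) \<le> norm (D s) + B * (t - s)" using norm_triangle_sub[of "D x" "D s"] by linarith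
  qed auto
  also have "\<dots> = (t - s) * norm (D s) + B * (t - s)\<^sup>2"
    using assms by (simp add: power2_eq_square algebra_simps)
  finally show ?thesis using 1 by linarith
qed

definition node :: "nat \<Rightarrow> nat \<Rightarrow> real" where
  "node n i = a + (b - a) * real i / real n"

lemma node_0 [simp]: "node n 0 = a" and node_n: "n > 0 \<Longrightarrow> node n n = b"
  by (auto simp: node_def)

lemma node_mono: "i \<le> j \<Longrightarrow> node n i \<le> node n j"
  using ab by (auto simp: node_def intro!: divide_right_mono mult_left_mono)

lemma node_strict_mono: "n > 0 \<Longrightarrow> i < j \<Longrightarrow> node n i < node n j"
  using ab by (auto simp: node_def intro!: divide_strict_right_mono mult_strict_left_mono)

lemma node_in: "n > 0 \<Longrightarrow> i \<le> n \<Longrightarrow> node n i \<in> {a..b}"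
  using node_mono[of 0 i n] node_mono[of i n n] by (simp add: node_n)

lemma node_Suc: "node n (Suc i) - node n i = (b - a) / n"
  by (simp add: node_def add_divide_distrib[symmetric] diff_divide_distrib[symmetric] algebra_simps)

definition chord :: "nat \<Rightarrow> nat \<Rightarrow> real" where
  "chord n i = dist (\<xi> (node n i)) (\<xi> (node n (Suc i)))"

lemma arc_length_start [simp]: "arc_length a = 0" by (simp add: arc_length_def)

lemma sum_chord_le: "n > 0 \<Longrightarrow> (\<Sum>i<n. chord n i) \<le> arc_length b"
proof -
  assume n: "n > 0"
  have "(\<Sum>i<n. chord n i) \<le> (\<Sum>i<n. arc_length (node n (Suc i)) - arc_length (node n i))"
    using node_in[OF n] unfolding chord_def by (intro sum_mono dist_le_arc_length node_mono) auto
  also have "\<dots> = arc_length b" using n by (subst sum_lessThan_telescope) (simp add: node_n)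
  finally show ?thesis .
qed

lemma sum_chord_ge:
  assumes n: "n > 0" "(b - a) / n < \<delta>"
  shows "arc_length b - 2 * B * (b - a)\<^sup>2 / n \<le> (\<Sum>i<n. chord n i)"
proof -
  have "arc_length b = (\<Sum>i<n. arc_length (node n (Suc i)) - arc_length (node n i))"
    using n by (subst sum_lessThan_telescope) (simp add: node_n)
  also have "\<dots> \<le> (\<Sum>i<n. chord n i + 2 * B * ((b - a) / n)\<^sup>2)"
  proof (rule sum_mono)
    fix i assume "i \<in> {..<n}"
    then show "arc_length (node n (Suc i)) - arc_length (node n i) \<le> chord n i + 2 * B * ((b - a) / n)\<^sup>2"
      using node_in[OF n(1), of i] node_in[OF n(1), of "Suc i"] n(2) node_mono[of i "Suc i" n]
        arc_length_le_dist[of "node n i" "node n (Suc i)"] by (simp add: node_Suc chord_def)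
  qed
  also have "\<dots> = (\<Sum>i<n. chord n i) + 2 * B * (b - a)\<^sup>2 / n"
    using n by (simp add: sum.distrib power2_eq_square)
  finally show ?thesis by simp
qed

text \<open>For an arbitrary partition the arc lengths telescope and dominate the chords. In the
  other direction the uniform grids suffice, since their chord sums approach the arc length.\<close>

lemma curve_length_eq: "curve_length {a..b} \<xi> = ennreal (arc_length b)"
proof (rule antisym)
  show "curve_length {a..b} \<xi> \<le> ennreal (arc_length b)"
    unfolding curve_length_def
  proof (rule SUP_least)
    fix ts assume "ts \<in> {ts. sorted ts \<and> set ts \<subseteq> {a..b}}"
    then have ts: "sorted ts" "\<And>i. i < length ts \<Longrightarrow> ts ! i \<in> {a..b}"
      by (auto simp del: atLeastAtMost_iff dest: nth_mem)
    define n where "n = length ts - 1"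
    have "(\<Sum>i<n. dist (\<xi> (ts ! i)) (\<xi> (ts ! Suc i))) \<le> arc_length b"
    proof (cases "n = 0")
      case True
      then show ?thesis using arc_length_mono[of a b] ab by simp
    next
      case False
      have "(\<Sum>i<n. dist (\<xi> (ts ! i)) (\<xi> (ts ! Suc i))) \<le> (\<Sum>i<n. arc_length (ts ! Suc i) - arc_length (ts ! i))"
      proof (intro sum_mono dist_le_arc_length)
        fix i assume "i \<in> {..<n}"
        then have i: "Suc i < length ts" by (auto simp: n_def)
        show "a \<le> ts ! i" "ts ! Suc i \<le> b" using ts(2)[of i] ts(2)[of "Suc i"] i by auto
        show "ts ! i \<le> ts ! Suc i" using ts(1) i by (simp add: sorted_iff_nth_mono)
      qed
      also have "\<dots> = arc_length (ts ! n) - arc_length (ts ! 0)" by (rule sum_lessThan_telescope)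
      also have "\<dots> \<le> arc_length b - 0"
      proof (rule diff_mono)
        have "n < length ts" "0 < length ts" using False by (auto simp: n_def)
        then have "ts ! n \<in> {a..b}" "ts ! 0 \<in> {a..b}" using ts(2) by blast+
        then show "arc_length (ts ! n) \<le> arc_length b" "0 \<le> arc_length (ts ! 0)"
          using arc_length_mono[of "ts ! n" b] arc_length_mono[of a "ts ! 0"] by auto
      qed
      finally show ?thesis by simp
    qed
    then show "(\<Sum>i<length ts - 1. ennreal (dist (\<xi> (ts ! i)) (\<xi> (ts ! Suc i)))) \<le> ennreal (arc_length b)"
      by (simp add: n_def ennreal_leI)
  qed
  have lim: "((\<lambda>n. ennreal (arc_length b - 2 * B * (b - a)\<^sup>2 / real n)) \<longlongrightarrow> ennreal (arc_length b - 0)) sequentially"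
    by (intro tendsto_ennrealI tendsto_diff tendsto_const lim_const_over_n)
  have "eventually (\<lambda>n. (b - a) / real n < \<delta>) sequentially"
    using order_tendstoD(2)[OF lim_const_over_n[of "b - a"] \<delta>] .
  then have "eventually (\<lambda>n. ennreal (arc_length b - 2 * B * (b - a)\<^sup>2 / real n) \<le> curve_length {a..b} \<xi>) sequentially"
    using eventually_gt_at_top[of 0]
  proof eventually_elim
    case (elim n)
    let ?ts = "map (node n) [0..<Suc n]"
    have nth: "?ts ! i = node n i" if "i \<le> n" for i using that by (simp del: upt_Suc)
    have "sorted ?ts" using node_mono by (auto simp: sorted_iff_nth_mono simp del: upt_Suc)
    moreover have "set ?ts \<subseteq> {a..b}" using node_in[OF elim(2)] by (auto simp del: upt_Suc)
    ultimately have "(\<Sum>i<length ?ts - 1. ennreal (dist (\<xi> (?ts ! i)) (\<xi> (?ts ! Suc i)))) \<le> curve_length {a..b} \<xi>"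
      unfolding curve_length_def by (intro SUP_upper) blast
    also have "(\<Sum>i<length ?ts - 1. ennreal (dist (\<xi> (?ts ! i)) (\<xi> (?ts ! Suc i)))) = ennreal (\<Sum>i<n. chord n i)"
      by (subst sum_ennreal[symmetric]) (auto simp: chord_def nth simp del: upt_Suc intro!: sum.cong)
    finally show ?case using sum_chord_ge[OF elim(2,1)] by (meson ennreal_leI order_trans)
  qed
  then show "ennreal (arc_length b) \<le> curve_length {a..b} \<xi>"
    using tendsto_upperbound[OF lim] by simp
qed

lemma arc_length_eq_lborel: "arc_length b = (LINT t:{a..b}|lborel. norm (D t))"
  unfolding arc_length_def
  by (intro set_borel_integral_eq_integral(2)[symmetric] borel_integrable_atLeastAtMost')
    (intro continuous_intros continuous_D)

text \<open>The inner product is bilinear and bounded in each argument, so differentiability in norm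
  lets each derivative pass onto its own factor. Hence the square root in the length formula is the
  speed of the curve.\<close>

lemma mixed_deriv_on_inner:
  assumes r: "\<And>s t. s \<in> {a..b} \<Longrightarrow> t \<in> {a..b} \<Longrightarrow> r s t = \<xi> s \<bullet> \<xi> t" and t: "t \<in> {a..b}"
  shows "mixed_deriv_on {a..b} r t t = (norm (D t))\<^sup>2"
proof -
  have nb: "at t within {a..b} \<noteq> bot"
    using ab t by (auto simp: trivial_limit_within islimpt_Icc)
  have 1: "deriv_on {a..b} (\<lambda>t'. r s t') t = \<xi> s \<bullet> D t" if s: "s \<in> {a..b}" for s
    unfolding deriv_on_def
  proof (rule vector_derivative_within[OF nb])
    have "((\<lambda>t. \<xi> s \<bullet> \<xi> t) has_vector_derivative (\<xi> s \<bullet> D t)) (at t within {a..b})"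
      by (rule bounded_linear.has_vector_derivative[OF bounded_linear_inner_right deriv[OF t]])
    then show "((\<lambda>t'. r s t') has_vector_derivative (\<xi> s \<bullet> D t)) (at t within {a..b})"
      by (rule has_vector_derivative_transform[OF t, rotated]) (use r s in auto)
  qed
  have "deriv_on {a..b} (\<lambda>s'. deriv_on {a..b} (\<lambda>t'. r s' t') t) t = D t \<bullet> D t"
    unfolding deriv_on_def[of _ _ t]
  proof (rule vector_derivative_within[OF nb])
    have "((\<lambda>s. \<xi> s \<bullet> D t) has_vector_derivative (D t \<bullet> D t)) (at t within {a..b})"
      by (rule bounded_linear.has_vector_derivative[OF bounded_linear_inner_left deriv[OF t]])
    then show "((\<lambda>s'. vector_derivative (\<lambda>t'. r s' t') (at t within {a..b})) has_vector_derivative (D t \<bullet> D t)) (at t within {a..b})"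
      by (rule has_vector_derivative_transform[OF t, rotated]) (use 1 in \<open>auto simp: deriv_on_def\<close>)
  qed
  then show ?thesis by (simp add: mixed_deriv_on_def dot_square_norm)
qed

end

section \<open>End-points of the curve\<close>

lemma continuous_inj_not_min:
  fixes f :: "real \<Rightarrow> real"
  assumes "s < x" "x < t" "continuous_on {s..t} f" "inj_on f {s..t}"
  shows "\<exists>y\<in>{s..t}. f y < f x" "\<exists>y\<in>{s..t}. f x < f y"
proof -
  have "s \<in> {s..t}" "t \<in> {s..t}" using assms(1,2) by auto
  moreover have "f s < f x \<and> f x < f t \<or> f t < f x \<and> f x < f s"
    by (rule continuous_inj_imp_mono[OF assms])
  ultimately show "\<exists>y\<in>{s..t}. f y < f x" "\<exists>y\<in>{s..t}. f x < f y" by blast+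
qed

text \<open>Invariance of the boundary in dimension one. The transition between chart coordinate and
  parameter is continuous and injective, so near an interior point it takes values on both sides;
  but 0 is the least chart coordinate, and a and b are extreme parameters. The same argument, read
  in opposite directions, gives both implications.\<close>

lemma chart_boundary_iff:
  fixes \<xi> :: "real \<Rightarrow> 'a::real_normed_vector"
  assumes cont: "continuous_on {a..b} \<xi>" and inj: "inj_on \<xi> {a..b}"
    and chart: "half_line_chart (\<xi> ` {a..b}) J \<phi>" and t: "t \<in> J" and \<theta>: "\<theta> \<in> {a..b}" "\<phi> t = \<xi> \<theta>"
  shows "t = 0 \<longleftrightarrow> \<theta> = a \<or> \<theta> = b"
proof -
  let ?M = "\<xi> ` {a..b}"
  obtain g where J: "openin (top_of_set {0..}) J" and M: "openin (top_of_set ?M) (\<phi> ` J)"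
    and g: "homeomorphism J (\<phi> ` J) \<phi> g"
    using chart unfolding half_line_chart_def by blast
  obtain k where k: "homeomorphism {a..b} ?M \<xi> k"
    using homeomorphism_compact[OF compact_Icc cont refl inj] by blast
  have JM: "\<phi> ` J \<subseteq> ?M" using openin_imp_subset[OF M] .
  have gg: "g (\<phi> s) = s" if "s \<in> J" for s using g that by (auto simp: homeomorphism_def)
  have kk: "k (\<xi> s) = s" if "s \<in> {a..b}" for s using k that by (auto simp: homeomorphism_def)
  have J0: "J \<subseteq> {0..}" using openin_imp_subset[OF J] .
  show ?thesis
  proof
    assume t0: "t = 0"
    define V where "V = {a..b} \<inter> \<xi> -` (\<phi> ` J)"
    have V: "openin (top_of_set {a..b}) V"
      unfolding V_def by (rule continuous_openin_preimage[OF cont _ M]) auto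
    have \<theta>V: "\<theta> \<in> V" unfolding V_def using \<theta>(1) imageI[OF t, of \<phi>] unfolding \<theta>(2) by blast
    obtain e where e: "e > 0" "cball \<theta> e \<inter> {a..b} \<subseteq> V"
      using V \<theta>V unfolding openin_contains_cball by blast
    show "\<theta> = a \<or> \<theta> = b"
    proof (rule ccontr)
      assume "\<not> (\<theta> = a \<or> \<theta> = b)"
      then have ab: "a < \<theta>" "\<theta> < b" using \<theta> by auto
      define s where "s = max a (\<theta> - e)"
      define u where "u = min b (\<theta> + e)"
      have su: "s < \<theta>" "\<theta> < u" using ab e by (auto simp: s_def u_def)
      have suV: "{s..u} \<subseteq> V" using e by (auto simp: s_def u_def dist_real_def subset_iff)
      have gc: "continuous_on (\<phi> ` J) g" using g by (simp add: homeomorphism_def)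
      have "{s..u} \<subseteq> {a..b}" "\<xi> ` {s..u} \<subseteq> \<phi> ` J" using suV unfolding V_def by blast+
      then have 1: "continuous_on {s..u} (\<lambda>x. g (\<xi> x))"
        using continuous_on_compose2[OF gc continuous_on_subset[OF cont]] by blast
      have 2: "inj_on (\<lambda>x. g (\<xi> x)) {s..u}"
      proof (rule inj_onI)
        fix x y assume xy: "x \<in> {s..u}" "y \<in> {s..u}" "g (\<xi> x) = g (\<xi> y)"
        then have "x \<in> V" "y \<in> V" using suV by blast+
        then obtain p q where "p \<in> J" "\<xi> x = \<phi> p" "q \<in> J" "\<xi> y = \<phi> q" unfolding V_def by blast
        then have "\<xi> x = \<xi> y" using xy(3) gg by metis
        then show "x = y" using inj_onD[OF inj] \<open>x \<in> V\<close> \<open>y \<in> V\<close> unfolding V_def by blast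
      qed
      obtain y where y: "y \<in> {s..u}" "g (\<xi> y) < g (\<xi> \<theta>)"
        using continuous_inj_not_min(1)[OF su 1 2] by blast
      have "g (\<xi> \<theta>) = 0" using gg[OF t] \<theta> t0 by simp
      moreover have "g (\<xi> y) \<in> J"
      proof -
        have "y \<in> V" using y suV by blast
        then obtain p where "p \<in> J" "\<xi> y = \<phi> p" unfolding V_def by blast
        then show ?thesis using gg by simp
      qed
      ultimately show False using y J0 by auto
    qed
  next
    assume ends: "\<theta> = a \<or> \<theta> = b"
    obtain e where e: "e > 0" "cball t e \<inter> {0..} \<subseteq> J"
      using J t unfolding openin_contains_cball by blast
    show "t = 0"
    proof (rule ccontr)
      assume "t \<noteq> 0"
      then have tp: "t > 0" using t J0 by auto
      define s where "s = max 0 (t - e)"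
      define u where "u = t + e"
      have su: "s < t" "t < u" using tp e by (auto simp: s_def u_def)
      have "{s..u} \<subseteq> cball t e \<inter> {0..}" by (auto simp: s_def u_def dist_real_def)
      then have suJ: "{s..u} \<subseteq> J" using e(2) by blast
      note kc = homeomorphism_cont2[OF k] and \<phi>c = homeomorphism_cont1[OF g]
      have "\<phi> ` {s..u} \<subseteq> ?M" using suJ JM by blast
      then have 1: "continuous_on {s..u} (\<lambda>x. k (\<phi> x))"
        using continuous_on_compose2[OF kc continuous_on_subset[OF \<phi>c suJ]] by blast
      have 2: "inj_on (\<lambda>x. k (\<phi> x)) {s..u}"
      proof (rule inj_onI)
        fix x y assume xy: "x \<in> {s..u}" "y \<in> {s..u}" "k (\<phi> x) = k (\<phi> y)"
        have J: "x \<in> J" "y \<in> J" by (rule subsetD[OF suJ xy(1)], rule subsetD[OF suJ xy(2)])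
        have M': "\<phi> x \<in> ?M" "\<phi> y \<in> ?M"
          by (rule subsetD[OF JM imageI[OF J(1)]], rule subsetD[OF JM imageI[OF J(2)]])
        have "\<phi> x = \<phi> y"
          using homeomorphism_apply2[OF k M'(1)] homeomorphism_apply2[OF k M'(2)] unfolding xy(3) by (rule trans[OF sym])
        then have "g (\<phi> x) = g (\<phi> y)" by (rule arg_cong)
        then show "x = y" unfolding gg[OF J(1)] gg[OF J(2)] .
      qed
      have k\<theta>: "k (\<phi> t) = \<theta>" using kk \<theta> by simp
      have kM: "k (\<phi> x) \<in> {a..b}" if "x \<in> {s..u}" for x
      proof -
        have "\<phi> x \<in> ?M" using that suJ JM by blast
        then obtain p where "p \<in> {a..b}" "\<phi> x = \<xi> p" by blast
        then show ?thesis using kk by simp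
      qed
      show False
      proof -
        obtain x y where "x \<in> {s..u}" "k (\<phi> x) < \<theta>" "y \<in> {s..u}" "\<theta> < k (\<phi> y)"
          using continuous_inj_not_min(1)[OF su 1 2] continuous_inj_not_min(2)[OF su 1 2] unfolding k\<theta> by blast
        then show False using kM[of x] kM[of y] ends by auto
      qed
    qed
  qed
qed

lemma end_points_curve:
  fixes \<xi> :: "real \<Rightarrow> 'a::real_normed_vector"
  assumes cont: "continuous_on {a..b} \<xi>" and inj: "inj_on \<xi> {a..b}" and ab: "a \<le> b"
    and mfd: "one_manifold_with_boundary (\<xi> ` {a..b})"
  shows "end_points (\<xi> ` {a..b}) = {\<xi> a, \<xi> b}"
proof (intro equalityI subsetI)
  fix p assume "p \<in> end_points (\<xi> ` {a..b})"
  then obtain J \<phi> where J: "half_line_chart (\<xi> ` {a..b}) J \<phi>" "0 \<in> J" "p = \<phi> 0"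
    unfolding end_points_def by blast
  then have "openin (top_of_set (\<xi> ` {a..b})) (\<phi> ` J)" by (simp add: half_line_chart_def)
  then have "p \<in> \<xi> ` {a..b}" using openin_imp_subset J by blast
  then obtain \<theta> where "\<theta> \<in> {a..b}" "p = \<xi> \<theta>" by blast
  then show "p \<in> {\<xi> a, \<xi> b}" using chart_boundary_iff[OF cont inj J(1,2), of \<theta>] J(3) by auto
next
  fix p assume p: "p \<in> {\<xi> a, \<xi> b}"
  then obtain \<theta> where \<theta>: "\<theta> = a \<or> \<theta> = b" "p = \<xi> \<theta>" by blast
  then have \<theta>I: "\<theta> \<in> {a..b}" using ab by auto
  obtain J \<phi> where "half_line_chart (\<xi> ` {a..b}) J \<phi>" "\<xi> \<theta> \<in> \<phi> ` J"
    using mfd \<theta>I unfolding one_manifold_with_boundary_def by blast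
  then obtain t where J: "half_line_chart (\<xi> ` {a..b}) J \<phi>" "t \<in> J" "\<phi> t = \<xi> \<theta>"
    by auto
  then have "t = 0" using chart_boundary_iff[OF cont inj J(1,2) \<theta>I J(3)] \<theta>(1) by simp
  then have "half_line_chart (\<xi> ` {a..b}) J \<phi> \<and> 0 \<in> J \<and> p = \<phi> 0" using J \<theta>(2) by simp
  then show "p \<in> end_points (\<xi> ` {a..b})" unfolding end_points_def by blast
qed

text \<open>A nonempty relatively open subset of the half-line has more than one point. This
  excludes a one-point parameter set.\<close>

lemma singleton_not_manifold: "\<not> one_manifold_with_boundary {p}"
proof
  assume "one_manifold_with_boundary {p}"
  then obtain J \<phi> where chart: "half_line_chart {p} J \<phi>" "p \<in> \<phi> ` J"
    unfolding one_manifold_with_boundary_def by blast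
  then obtain t where t: "t \<in> J" by blast
  from chart(1) obtain g where J: "openin (top_of_set {0..}) J" and M: "openin (top_of_set {p}) (\<phi> ` J)"
    and g: "homeomorphism J (\<phi> ` J) \<phi> g"
    unfolding half_line_chart_def by blast
  have J0: "t \<ge> 0" using openin_imp_subset[OF J] t by auto
  obtain e where e: "e > 0" "cball t e \<inter> {0..} \<subseteq> J"
    using J t unfolding openin_contains_cball by blast
  have te: "t + e \<in> J" using e J0 by (auto simp: dist_real_def subset_iff)
  then have "\<phi> (t + e) = \<phi> t" using openin_imp_subset[OF M] t by auto
  then have "t + e = t" using homeomorphism_apply1[OF g te] homeomorphism_apply1[OF g t] by simp
  then show False using e by simp
qed

section \<open>Exceedance probabilities along a grid\<close>

text \<open>Induction on the number of events: each new event meets the union of the old ones in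
  probability at most m \<epsilon>. Counting m^2 instead of m (m - 1)/2 pairs simplifies the bound
  and is affordable because \<epsilon> will be exponentially small.\<close>

lemma (in finite_measure) bonferroni_lower:
  fixes m :: nat
  assumes A: "\<And>i. i < m \<Longrightarrow> A i \<in> sets M"
    and pair: "\<And>i j. i < j \<Longrightarrow> j < m \<Longrightarrow> measure M (A i \<inter> A j) \<le> \<epsilon>" and "\<epsilon> \<ge> 0"
  shows "(\<Sum>i<m. measure M (A i)) - (real m)\<^sup>2 * \<epsilon> \<le> measure M (\<Union>i<m. A i)"
  using A pair
proof (induction m)
  case 0
  then show ?case by simp
next
  case (Suc m)
  have U: "(\<Union>i<m. A i) \<in> sets M" using Suc.prems(1) by auto
  have "measure M ((\<Union>i<m. A i) \<inter> A m) = measure M (\<Union>i<m. A i \<inter> A m)"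
    by (rule arg_cong[where f = "measure M"]) auto
  also have "\<dots> \<le> (\<Sum>i<m. measure M (A i \<inter> A m))"
    using Suc.prems(1) by (intro finite_measure_subadditive_finite) auto
  also have "\<dots> \<le> (\<Sum>i<m. \<epsilon>)" using Suc.prems(2) by (intro sum_mono) auto
  finally have int: "measure M ((\<Union>i<m. A i) \<inter> A m) \<le> real m * \<epsilon>" by simp
  have "(\<Union>i<Suc m. A i) = (\<Union>i<m. A i) \<union> A m" by (auto simp: less_Suc_eq)
  then have "measure M (\<Union>i<Suc m. A i) = measure M (\<Union>i<m. A i) + measure M (A m) - measure M ((\<Union>i<m. A i) \<inter> A m)"
    using U Suc.prems(1)[of m] by (simp add: measure_Un3 fmeasurable_eq_sets)
  moreover have "(\<Sum>i<m. measure M (A i)) - (real m)\<^sup>2 * \<epsilon> \<le> measure M (\<Union>i<m. A i)"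
    using Suc.prems by (intro Suc.IH) auto
  moreover have "(real m)\<^sup>2 * \<epsilon> + real m * \<epsilon> \<le> (real (Suc m))\<^sup>2 * \<epsilon>"
    using \<open>\<epsilon> \<ge> 0\<close> by (simp add: distrib_right[symmetric] power2_eq_square algebra_simps mult_right_mono)
  ultimately show ?case using int by simp
qed

locale gaussian_curve = lipschitz_C1_curve \<xi> D a b \<delta> B + prob_space P
  for \<xi> D :: "real \<Rightarrow> 'a::real_inner" and a b \<delta> B :: real and P :: "'w measure" +
  fixes Z :: "real \<Rightarrow> 'w \<Rightarrow> real" and w :: real
  assumes unit: "\<And>t. t \<in> {a..b} \<Longrightarrow> norm (\<xi> t) = 1"
    and inj: "inj_on \<xi> {a..b}"
    and w: "0 < w" "w < 1"
    and triple: "\<And>s t u. a \<le> s \<Longrightarrow> s < t \<Longrightarrow> t < u \<Longrightarrow> u \<le> b \<Longrightarrow> contracting_triple w (\<xi> s) (\<xi> t) (\<xi> u)"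
    and gauss: "gaussian_process P {a..b} Z"
    and mean: "\<And>t. t \<in> {a..b} \<Longrightarrow> expectation (Z t) = 0"
    and cov: "\<And>s t. s \<in> {a..b} \<Longrightarrow> t \<in> {a..b} \<Longrightarrow> expectation (\<lambda>\<omega>. Z s \<omega> * Z t \<omega>) = \<xi> s \<bullet> \<xi> t"
    and Z_cont: "\<And>\<omega>. \<omega> \<in> space P \<Longrightarrow> continuous_on {a..b} (\<lambda>t. Z t \<omega>)"
begin

lemma gaussian_sum: "finite I \<Longrightarrow> I \<subseteq> {a..b} \<Longrightarrow> gaussian_var P (\<lambda>\<omega>. \<Sum>t\<in>I. k t * Z t \<omega>)"
  using gauss unfolding gaussian_process_def by blast

lemma gaussian_Z: "t \<in> {a..b} \<Longrightarrow> gaussian_var P (Z t)"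
  using gaussian_sum[of "{t}" "\<lambda>_. 1"] by simp

lemma Z_measurable [measurable]: "t \<in> {a..b} \<Longrightarrow> Z t \<in> borel_measurable P"
  using gaussian_Z[of t] by (auto simp: gaussian_var_def distributed_def)

lemma cov_self: "t \<in> {a..b} \<Longrightarrow> expectation (\<lambda>\<omega>. (Z t \<omega>)\<^sup>2) = 1"
  using cov[of t t] unit[of t] by (simp add: power2_eq_square dot_square_norm)

text \<open>The integral of a non-integrable function is 0 by convention, so the value 1 forces
  integrability.\<close>

lemma integrable_Z_sq: "t \<in> {a..b} \<Longrightarrow> integrable P (\<lambda>\<omega>. (Z t \<omega>)\<^sup>2)"
  using cov_self[of t] not_integrable_integral_eq by force

lemma integrable_Z_mult:
  assumes "s \<in> {a..b}" "t \<in> {a..b}"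
  shows "integrable P (\<lambda>\<omega>. Z s \<omega> * Z t \<omega>)"
proof (rule Bochner_Integration.integrable_bound)
  show "integrable P (\<lambda>\<omega>. (Z s \<omega>)\<^sup>2 + (Z t \<omega>)\<^sup>2)" using integrable_Z_sq assms by simp
  have "\<bar>x * y\<bar> \<le> x\<^sup>2 + y\<^sup>2" for x y :: real
  proof -
    have "0 \<le> \<bar>x\<bar> * \<bar>y\<bar>" by simp
    then show ?thesis
      using sum_squares_bound[of "\<bar>x\<bar>" "\<bar>y\<bar>"] unfolding abs_mult power2_abs by linarith
  qed
  then show "AE \<omega> in P. norm (Z s \<omega> * Z t \<omega>) \<le> norm ((Z s \<omega>)\<^sup>2 + (Z t \<omega>)\<^sup>2)" by simp
qed (use assms in measurable)

lemma integrable_Z: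
  assumes t: "t \<in> {a..b}"
  shows "integrable P (Z t)"
proof (rule Bochner_Integration.integrable_bound)
  show "integrable P (\<lambda>\<omega>. (Z t \<omega>)\<^sup>2 + 1)" using integrable_Z_sq t by simp
  have "\<bar>x\<bar> \<le> x\<^sup>2 + 1" for x :: real
    using sum_squares_bound[of "\<bar>x\<bar>" 1] by simp
  then show "AE \<omega> in P. norm (Z t \<omega>) \<le> norm ((Z t \<omega>)\<^sup>2 + 1)" by simp
qed (use t in measurable)

lemma expectation_sum:
  assumes "finite I" "I \<subseteq> {a..b}"
  shows "expectation (\<lambda>\<omega>. \<Sum>t\<in>I. k t * Z t \<omega>) = 0"
proof -
  have "expectation (\<lambda>\<omega>. \<Sum>t\<in>I. k t * Z t \<omega>) = (\<Sum>t\<in>I. k t * expectation (Z t))"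
    using assms integrable_Z by (subst Bochner_Integration.integral_sum) (auto simp: subset_iff)
  also have "\<dots> = 0" using assms mean by (intro sum.neutral) auto
  finally show ?thesis .
qed

text \<open>Since covariances are inner products, sending \<open>\<xi> t\<close> to
  \<open>Z t\<close> is isometric on linear combinations. This is the bridge from contracting
  triples to small variances.\<close>

lemma expectation_sum_sq:
  assumes "finite I" "I \<subseteq> {a..b}"
  shows "expectation (\<lambda>\<omega>. (\<Sum>t\<in>I. k t * Z t \<omega>)\<^sup>2) = (norm (\<Sum>t\<in>I. k t *\<^sub>R \<xi> t))\<^sup>2"
proof -
  have "expectation (\<lambda>\<omega>. (\<Sum>t\<in>I. k t * Z t \<omega>)\<^sup>2) = expectation (\<lambda>\<omega>. \<Sum>s\<in>I. \<Sum>t\<in>I. (k s * k t) * (Z s \<omega> * Z t \<omega>))"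
    by (simp add: power2_eq_square sum_product mult_ac)
  also have "\<dots> = (\<Sum>s\<in>I. \<Sum>t\<in>I. (k s * k t) * expectation (\<lambda>\<omega>. Z s \<omega> * Z t \<omega>))"
    using assms(2) integrable_Z_mult by (simp add: subset_iff Bochner_Integration.integral_sum)
  also have "\<dots> = (\<Sum>s\<in>I. \<Sum>t\<in>I. (k s * k t) * (\<xi> s \<bullet> \<xi> t))"
    using assms(2) cov by (intro sum.cong refl) (auto simp: subset_iff)
  also have "\<dots> = (norm (\<Sum>t\<in>I. k t *\<^sub>R \<xi> t))\<^sup>2"
    by (simp add: power2_norm_eq_inner inner_sum_left inner_sum_right sum_distrib_left mult_ac inner_commute)
  finally show ?thesis .
qed

text \<open>The weights of a contracting triple combine the three inequalities into one: the
  combination is at least (x + y - z) c = c. It is a centred Gaussian variable of variance at most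
  \<open>w\<close>.\<close>

lemma triple_prob_le:
  assumes stu: "a \<le> s" "s < t" "t < u" "u \<le> b" and c: "c \<ge> 1"
  shows "prob {\<omega> \<in> space P. c \<le> Z s \<omega> \<and> Z t \<omega> < c \<and> c \<le> Z u \<omega>} \<le> exp (- c\<^sup>2 / (2 * w))"
proof -
  obtain x y z where xyz: "0 \<le> x" "0 \<le> y" "0 \<le> z" "x + y - z = 1"
    "(norm (x *\<^sub>R \<xi> s + y *\<^sub>R \<xi> u - z *\<^sub>R \<xi> t))\<^sup>2 \<le> w"
    using triple[OF stu] unfolding contracting_triple_def by blast
  let ?I = "{s, t, u}"
  define k where "k = (\<lambda>v. if v = s then x else if v = u then y else - z)"
  have I: "finite ?I" "?I \<subseteq> {a..b}" using stu by auto
  have sumZ: "(\<Sum>v\<in>?I. k v * Z v \<omega>) = x * Z s \<omega> + y * Z u \<omega> - z * Z t \<omega>" for \<omega>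
    using stu by (simp add: k_def)
  have sum\<xi>: "(\<Sum>v\<in>?I. k v *\<^sub>R \<xi> v) = x *\<^sub>R \<xi> s + y *\<^sub>R \<xi> u - z *\<^sub>R \<xi> t"
    using stu by (simp add: k_def)
  have [measurable]: "Z s \<in> borel_measurable P" "Z t \<in> borel_measurable P" "Z u \<in> borel_measurable P"
    using stu by (auto intro: Z_measurable)
  have "prob {\<omega> \<in> space P. c \<le> Z s \<omega> \<and> Z t \<omega> < c \<and> c \<le> Z u \<omega>} \<le> prob {\<omega> \<in> space P. c \<le> (\<Sum>v\<in>?I. k v * Z v \<omega>)}"
    unfolding sumZ
  proof (rule finite_measure_mono)
    show "{\<omega> \<in> space P. c \<le> Z s \<omega> \<and> Z t \<omega> < c \<and> c \<le> Z u \<omega>} \<subseteq> {\<omega> \<in> space P. c \<le> x * Z s \<omega> + y * Z u \<omega> - z * Z t \<omega>}"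
    proof (intro subsetI CollectI conjI; elim CollectE conjE)
      fix \<omega> assume "c \<le> Z s \<omega>" "Z t \<omega> < c" "c \<le> Z u \<omega>"
      then have "x * c \<le> x * Z s \<omega>" "y * c \<le> y * Z u \<omega>" "z * Z t \<omega> \<le> z * c"
        using xyz by (auto intro: mult_left_mono)
      moreover have "c = x * c + y * c - z * c" using xyz(4) by (metis distrib_right left_diff_distrib mult_1)
      ultimately show "c \<le> x * Z s \<omega> + y * Z u \<omega> - z * Z t \<omega>" by linarith
    qed
  qed measurable
  also have "\<dots> \<le> exp (- c\<^sup>2 / (2 * w))"
  proof (rule centred_gaussian_tail[OF prob_space_axioms gaussian_sum[OF I] expectation_sum[OF I] expectation_sum_sq[OF I]])
    show "(norm (\<Sum>v\<in>?I. k v *\<^sub>R \<xi> v))\<^sup>2 \<le> w" unfolding sum\<xi> by (rule xyz(5))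
  qed (use w c in auto)
  finally show ?thesis .
qed

lemma inner_eq_dist:
  assumes "s \<in> {a..b}" "t \<in> {a..b}"
  shows "\<xi> s \<bullet> \<xi> t = 1 - (dist (\<xi> s) (\<xi> t))\<^sup>2 / 2"
proof -
  have "\<xi> s \<bullet> \<xi> s = 1" "\<xi> t \<bullet> \<xi> t = 1" using unit assms by (auto simp: dot_square_norm)
  then show ?thesis by (simp add: dist_norm power2_norm_eq_inner inner_diff_left inner_diff_right inner_commute diff_divide_distrib)
qed

text \<open>A chord of length d on the unit sphere subtends an angle of sine d/2 at its half, so the
  tangent of the half-angle is d / sqrt (4 - d^2). The loss in the lower bound collects
  exp(-\<tau>^2 c^2/2) >= 1 - \<tau>^2 c^2/2 and 1/(1 + \<tau>^2) >= 1 - \<tau>^2, with \<tau> <=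
  d.\<close>

lemma upcrossing_bounds:
  assumes st: "s \<in> {a..b}" "t \<in> {a..b}" "s < t" and d: "d = dist (\<xi> s) (\<xi> t)" "d \<le> 1" and c: "c \<ge> 0"
  shows "prob {\<omega> \<in> space P. Z s \<omega> < c \<and> c \<le> Z t \<omega>} \<le> d / (pi * sqrt (4 - d\<^sup>2)) * exp (- c\<^sup>2 / 2)"
    and "d / (2 * pi) * exp (- c\<^sup>2 / 2) * (1 - (c\<^sup>2 / 2 + 1) * d\<^sup>2) \<le> prob {\<omega> \<in> space P. Z s \<omega> < c \<and> c \<le> Z t \<omega>}"
proof -
  define r where "r = \<xi> s \<bullet> \<xi> t"
  have r: "r = 1 - d\<^sup>2 / 2" unfolding r_def d(1) by (rule inner_eq_dist) (use st in auto)
  have "\<xi> s \<noteq> \<xi> t" using inj_onD[OF inj _ st(1,2)] st(3) by auto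
  then have d0: "d > 0" using d(1) by simp
  then have d2: "0 < d\<^sup>2" "d\<^sup>2 \<le> 1" using d(2) by (auto simp: power_le_one)
  have rr: "-1 < r" "r < 1" using d2 r by linarith+
  define \<tau> where "\<tau> = sqrt ((1 - r) / (1 + r))"
  have sq4: "sqrt (4 - d\<^sup>2) > 0" using d2 by simp
  have \<tau>2: "\<tau>\<^sup>2 = d\<^sup>2 / (4 - d\<^sup>2)"
  proof -
    have "\<tau>\<^sup>2 = (1 - r) / (1 + r)" using rr by (simp add: \<tau>_def)
    also have "\<dots> = d\<^sup>2 / (4 - d\<^sup>2)" unfolding r using d2 by (simp add: field_simps)
    finally show ?thesis .
  qed
  have \<tau>0: "\<tau> \<ge> 0" using rr by (simp add: \<tau>_def)
  have \<tau>: "\<tau> = d / sqrt (4 - d\<^sup>2)"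
  proof -
    have "\<tau> = sqrt (d\<^sup>2 / (4 - d\<^sup>2))" using \<tau>2 \<tau>0 by (metis real_sqrt_unique)
    then show ?thesis using d0 by (simp add: real_sqrt_divide)
  qed
  have \<tau>_ge: "d / 2 \<le> \<tau>"
  proof -
    have "sqrt (4 - d\<^sup>2) \<le> sqrt (2\<^sup>2)" using d2 by (intro real_sqrt_le_mono) auto
    then have "sqrt (4 - d\<^sup>2) \<le> 2" by simp
    then show ?thesis unfolding \<tau> using d0 sq4 by (intro divide_left_mono) auto
  qed
  have \<tau>_sq_le: "\<tau>\<^sup>2 \<le> d\<^sup>2"
  proof -
    have "\<tau>\<^sup>2 \<le> d\<^sup>2 / 1" unfolding \<tau>2 using d2 by (intro divide_left_mono) auto
    then show ?thesis by simp
  qed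
  have P: "prob {\<omega> \<in> space P. Z s \<omega> < c \<and> c \<le> Z t \<omega>} =
    measure (std_normal_distribution \<Otimes>\<^sub>M std_normal_distribution) (wedge \<tau> c)"
    unfolding \<tau>_def
  proof (rule upcrossing_prob[OF prob_space_axioms _ _ rr c])
    fix x y :: real
    let ?I = "{s, t}"
    define k where "k = (\<lambda>v. if v = s then x else y)"
    have I: "finite ?I" "?I \<subseteq> {a..b}" using st by auto
    have sumZ: "(\<Sum>v\<in>?I. k v * Z v \<omega>) = x * Z s \<omega> + y * Z t \<omega>" for \<omega> using st by (simp add: k_def)
    have sum\<xi>: "(\<Sum>v\<in>?I. k v *\<^sub>R \<xi> v) = x *\<^sub>R \<xi> s + y *\<^sub>R \<xi> t" using st by (simp add: k_def)
    have "\<xi> s \<bullet> \<xi> s = 1" "\<xi> t \<bullet> \<xi> t = 1" using unit st by (auto simp: dot_square_norm)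
    then have n: "(norm (\<Sum>v\<in>?I. k v *\<^sub>R \<xi> v))\<^sup>2 = x\<^sup>2 + y\<^sup>2 + 2 * x * y * r"
      unfolding sum\<xi> r_def power2_norm_eq_inner
      by (simp add: inner_add_left inner_add_right inner_commute power2_eq_square algebra_simps)
    show "(CLINT \<omega>|P. iexp (x * Z s \<omega> + y * Z t \<omega>)) = complex_of_real (exp (- (x\<^sup>2 + y\<^sup>2 + 2 * x * y * r) / 2))"
      using centred_gaussian_iexp[OF prob_space_axioms gaussian_sum[OF I, of k] expectation_sum[OF I] expectation_sum_sq[OF I], unfolded n sumZ]
      by simp
  qed (use st in auto)
  show "prob {\<omega> \<in> space P. Z s \<omega> < c \<and> c \<le> Z t \<omega>} \<le> d / (pi * sqrt (4 - d\<^sup>2)) * exp (- c\<^sup>2 / 2)"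
    using std_normal_wedge(1)[OF \<tau>0 c] unfolding P \<tau> by (simp add: mult.commute)
  have "d / (2 * pi) * exp (- c\<^sup>2 / 2) * (1 - (c\<^sup>2 / 2 + 1) * d\<^sup>2) \<le> d / (2 * pi) * exp (- c\<^sup>2 / 2) * (1 - (c\<^sup>2 / 2 + 1) * \<tau>\<^sup>2)"
    using \<tau>_sq_le d0 by (intro mult_left_mono diff_left_mono) auto
  also have "\<dots> \<le> d / (2 * pi) * exp (- c\<^sup>2 / 2) * (exp (- (\<tau>\<^sup>2 * c\<^sup>2) / 2) / (1 + \<tau>\<^sup>2))"
  proof (rule mult_left_mono)
    have p: "1 + \<tau>\<^sup>2 > 0" by (simp add: add_pos_nonneg)
    define e where "e = exp (- (\<tau>\<^sup>2 * c\<^sup>2) / 2)"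
    have e: "1 - \<tau>\<^sup>2 * c\<^sup>2 / 2 \<le> e" "e \<le> 1" using exp_ge_add_one_self[of "- (\<tau>\<^sup>2 * c\<^sup>2) / 2"] by (auto simp: e_def)
    have "1 - \<tau>\<^sup>2 \<le> 1 / (1 + \<tau>\<^sup>2)"
      unfolding pos_le_divide_eq[OF p] by (simp add: algebra_simps)
    then have "e * (1 - \<tau>\<^sup>2) \<le> e * (1 / (1 + \<tau>\<^sup>2))" by (rule mult_left_mono) (simp add: e_def)
    moreover have "e * \<tau>\<^sup>2 \<le> 1 * \<tau>\<^sup>2" using e by (intro mult_right_mono) auto
    ultimately show "1 - (c\<^sup>2 / 2 + 1) * \<tau>\<^sup>2 \<le> e / (1 + \<tau>\<^sup>2)" using e by (simp add: algebra_simps)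
  qed (use d0 in auto)
  also have "\<dots> \<le> \<tau> / pi * exp (- c\<^sup>2 / 2) * (exp (- (\<tau>\<^sup>2 * c\<^sup>2) / 2) / (1 + \<tau>\<^sup>2))"
  proof (intro mult_right_mono)
    show "d / (2 * pi) \<le> \<tau> / pi" using \<tau>_ge by (simp add: field_simps)
  qed auto
  also have "\<dots> = \<tau> / pi * exp (- ((1 + \<tau>\<^sup>2) * c\<^sup>2) / 2) / (1 + \<tau>\<^sup>2)"
  proof -
    have "exp (- ((1 + \<tau>\<^sup>2) * c\<^sup>2) / 2) = exp (- c\<^sup>2 / 2) * exp (- (\<tau>\<^sup>2 * c\<^sup>2) / 2)"
      by (simp add: exp_add[symmetric] algebra_simps add_divide_distrib diff_divide_distrib)
    then show ?thesis by simp
  qed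
  also have "\<dots> \<le> prob {\<omega> \<in> space P. Z s \<omega> < c \<and> c \<le> Z t \<omega>}"
    unfolding P by (rule std_normal_wedge(2)[OF \<tau>0 c])
  finally show "d / (2 * pi) * exp (- c\<^sup>2 / 2) * (1 - (c\<^sup>2 / 2 + 1) * d\<^sup>2) \<le> prob {\<omega> \<in> space P. Z s \<omega> < c \<and> c \<le> Z t \<omega>}" .
qed

end

context lipschitz_C1_curve
begin

lemma chord_le:
  obtains K where "K > 0" "\<And>n i. n > 0 \<Longrightarrow> i < n \<Longrightarrow> chord n i \<le> K / n"
proof -
  obtain L where L: "L > 0" "\<And>s t. s \<in> {a..b} \<Longrightarrow> t \<in> {a..b} \<Longrightarrow> norm (\<xi> s - \<xi> t) \<le> L * \<bar>s - t\<bar>"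
    by (rule C1_lipschitz_on_compact[OF compact_Icc _ deriv continuous_D]) auto
  have "chord n i \<le> L * (b - a) / n" if n: "n > 0" "i < n" for n i
  proof -
    have "chord n i \<le> L * \<bar>node n i - node n (Suc i)\<bar>"
      unfolding chord_def dist_norm using node_in[OF n(1)] n by (intro L(2)) auto
    also have "\<bar>node n i - node n (Suc i)\<bar> = (b - a) / n"
      unfolding abs_minus_commute[of "node n i"] node_Suc using ab by simp
    finally show ?thesis by simp
  qed
  then show thesis using L ab by (intro that[of "L * (b - a)"]) auto
qed

lemma node_approx:
  assumes n: "n > 0" and t: "t \<in> {a..b}"
  shows "\<exists>i\<le>n. \<bar>node n i - t\<bar> \<le> (b - a) / n"
proof -
  define x where "x = (t - a) * n / (b - a)"
  have x: "0 \<le> x" "x \<le> n" using t ab n by (auto simp: x_def field_simps)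
  define i where "i = nat \<lfloor>x\<rfloor>"
  have i: "real i \<le> x" "x < real i + 1" using x unfolding i_def by (auto simp: of_nat_nat)
  have "i \<le> n" using i x by linarith
  have "t = a + (b - a) * x / n" using ab n by (simp add: x_def)
  then have "node n i - t = (b - a) / n * (i - x)"
    by (simp add: node_def algebra_simps add_divide_distrib diff_divide_distrib)
  then have "\<bar>node n i - t\<bar> = (b - a) / n * \<bar>i - x\<bar>" using ab by (simp add: abs_mult)
  also have "\<dots> \<le> (b - a) / n * 1" using i ab by (intro mult_left_mono) auto
  finally show ?thesis using \<open>i \<le> n\<close> by auto
qed

end

context gaussian_curve
begin

section \<open>Exceedance and upcrossing events on a grid\<close>

definition grid_event :: "real \<Rightarrow> nat \<Rightarrow> 'w set" where
  "grid_event c n = {\<omega> \<in> space P. \<exists>i\<le>n. c \<le> Z (node n i) \<omega>}"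

text \<open>Beyond index 0 this is any upcrossing at node i, not only the first one, so the events
  may overlap. In return each involves two nodes only and has an explicit two-dimensional
  probability; the overlaps are left to Bonferroni's inequality.\<close>

definition first_event :: "real \<Rightarrow> nat \<Rightarrow> nat \<Rightarrow> 'w set" where
  "first_event c n i = (case i of 0 \<Rightarrow> {\<omega> \<in> space P. c \<le> Z a \<omega>}
     | Suc k \<Rightarrow> {\<omega> \<in> space P. Z (node n k) \<omega> < c \<and> c \<le> Z (node n (Suc k)) \<omega>})"

lemma Z_node_measurable: "n > 0 \<Longrightarrow> i \<le> n \<Longrightarrow> Z (node n i) \<in> borel_measurable P"
  by (intro Z_measurable node_in)

lemma grid_event_sets [measurable]: "n > 0 \<Longrightarrow> grid_event c n \<in> sets P"
proof -
  assume n: "n > 0"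
  have "{\<omega> \<in> space P. c \<le> Z (node n i) \<omega>} \<in> sets P" if "i \<le> n" for i
    using Z_node_measurable[OF n that] by measurable
  then have "(\<Union>i\<le>n. {\<omega> \<in> space P. c \<le> Z (node n i) \<omega>}) \<in> sets P" by auto
  also have "(\<Union>i\<le>n. {\<omega> \<in> space P. c \<le> Z (node n i) \<omega>}) = grid_event c n" by (auto simp: grid_event_def)
  finally show ?thesis .
qed

lemma first_event_sets:
  assumes n: "n > 0" "i \<le> n"
  shows "first_event c n i \<in> sets P"
proof (cases i)
  case 0
  have [measurable]: "Z a \<in> borel_measurable P" using ab by (intro Z_measurable) auto
  show ?thesis unfolding 0 first_event_def by simp
next
  case (Suc k)
  have [measurable]: "Z (node n k) \<in> borel_measurable P" "Z (node n (Suc k)) \<in> borel_measurable P"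
    using n Suc by (auto intro!: Z_node_measurable)
  show ?thesis unfolding Suc first_event_def by simp
qed

lemma first_event_subset: "n > 0 \<Longrightarrow> first_event c n i \<subseteq> {\<omega> \<in> space P. c \<le> Z (node n i) \<omega>}"
  by (auto simp: first_event_def split: nat.splits)

lemma grid_event_eq:
  assumes n: "n > 0"
  shows "grid_event c n = (\<Union>i<Suc n. first_event c n i)"
proof (intro equalityI subsetI)
  fix \<omega> assume "\<omega> \<in> grid_event c n"
  then have \<omega>: "\<omega> \<in> space P" and "\<exists>i. i \<le> n \<and> c \<le> Z (node n i) \<omega>" by (auto simp: grid_event_def)
  then obtain i where i: "i \<le> n" "c \<le> Z (node n i) \<omega>" and least: "\<And>j. j < i \<Longrightarrow> \<not> (j \<le> n \<and> c \<le> Z (node n j) \<omega>)"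
    using exists_least_iff[of "\<lambda>i. i \<le> n \<and> c \<le> Z (node n i) \<omega>"] by blast
  have "\<omega> \<in> first_event c n i"
    using i \<omega> least[of "i - 1"] by (cases i) (auto simp: first_event_def not_le)
  then show "\<omega> \<in> (\<Union>i<Suc n. first_event c n i)" using i by auto
next
  fix \<omega> assume "\<omega> \<in> (\<Union>i<Suc n. first_event c n i)"
  then obtain i where "i \<le> n" "\<omega> \<in> first_event c n i" by (auto simp: less_Suc_eq_le)
  then show "\<omega> \<in> grid_event c n"
    using subsetD[OF first_event_subset[OF n, of c i]] by (auto simp: grid_event_def)
qed

lemma prob_first_event_0: "prob (first_event c n 0) = normal_tail c"
proof -
  have "a \<in> {a..b}" using ab by simp
  from std_normal_atLeast[OF prob_space_axioms gaussian_Z[OF this] mean[OF this] cov_self[OF this]]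
  show ?thesis by (simp add: first_event_def)
qed

text \<open>A union bound. The chord bound \<open>k\<close> is kept explicit because the grid will
  be refined at a fixed level, where k tends to 0 and the square root to 2.\<close>

lemma prob_grid_event_le:
  assumes n: "n > 0" and K: "\<And>i. i < n \<Longrightarrow> chord n i \<le> k" "k \<le> 1" and c: "c \<ge> 0"
  shows "prob (grid_event c n) \<le> normal_tail c + arc_length b / (pi * sqrt (4 - k\<^sup>2)) * exp (- c\<^sup>2 / 2)"
proof -
  have "prob (grid_event c n) \<le> (\<Sum>i<Suc n. prob (first_event c n i))"
    unfolding grid_event_eq[OF n] using first_event_sets[OF n]
    by (intro finite_measure_subadditive_finite) auto
  also have "\<dots> = normal_tail c + (\<Sum>i<n. prob (first_event c n (Suc i)))"
    unfolding sum.lessThan_Suc_shift prob_first_event_0 ..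
  also have "(\<Sum>i<n. prob (first_event c n (Suc i))) \<le> (\<Sum>i<n. chord n i * (1 / (pi * sqrt (4 - k\<^sup>2)) * exp (- c\<^sup>2 / 2)))"
  proof (rule sum_mono)
    fix i assume i: "i \<in> {..<n}"
    define d where "d = chord n i"
    have d: "0 \<le> d" "d \<le> k" using K i by (auto simp: d_def chord_def)
    then have d2: "d\<^sup>2 \<le> k\<^sup>2" "k\<^sup>2 \<le> 1" using K(2) by (auto intro: power_mono simp: power_le_one)
    have "prob (first_event c n (Suc i)) \<le> d / (pi * sqrt (4 - d\<^sup>2)) * exp (- c\<^sup>2 / 2)"
      unfolding first_event_def nat.case
      by (rule upcrossing_bounds(1)) (use i n d K(2) c node_in[OF n] node_strict_mono[OF n] in \<open>auto simp: d_def chord_def\<close>)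
    also have "\<dots> \<le> d / (pi * sqrt (4 - k\<^sup>2)) * exp (- c\<^sup>2 / 2)"
    proof -
      have "0 < sqrt (4 - k\<^sup>2)" "sqrt (4 - k\<^sup>2) \<le> sqrt (4 - d\<^sup>2)" using d2 by simp_all
      then show ?thesis using d(1)
        by (intro mult_right_mono divide_left_mono mult_left_mono mult_pos_pos) auto
    qed
    finally show "prob (first_event c n (Suc i)) \<le> chord n i * (1 / (pi * sqrt (4 - k\<^sup>2)) * exp (- c\<^sup>2 / 2))"
      by (simp add: d_def)
  qed
  also have "\<dots> = (\<Sum>i<n. chord n i) * (1 / (pi * sqrt (4 - k\<^sup>2)) * exp (- c\<^sup>2 / 2))"
    by (rule sum_distrib_right[symmetric])
  also have "\<dots> \<le> arc_length b * (1 / (pi * sqrt (4 - k\<^sup>2)) * exp (- c\<^sup>2 / 2))"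
  proof (rule mult_right_mono[OF sum_chord_le[OF n]])
    have "0 \<le> k" using order_trans[OF _ K(1)[OF n]] by (simp add: chord_def)
    then have "k\<^sup>2 \<le> 1" using K(2) by (simp add: power_le_one)
    then show "0 \<le> 1 / (pi * sqrt (4 - k\<^sup>2)) * exp (- c\<^sup>2 / 2)" by simp
  qed
  finally show ?thesis by simp
qed

text \<open>For adjacent indices the common node would have to be both above and below the level, so
  the events are disjoint. Otherwise the node just before j is a low point strictly between two high
  ones.\<close>

lemma prob_first_event_pair:
  assumes n: "n > 0" and ij: "i < j" "j \<le> n" and c: "c \<ge> 1"
  shows "prob (first_event c n i \<inter> first_event c n j) \<le> exp (- c\<^sup>2 / (2 * w))"
proof -
  obtain k where k: "j = Suc k" using ij by (cases j) auto
  show ?thesis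
  proof (cases "i = k")
    case True
    then have "first_event c n i \<inter> first_event c n j = {}"
      using first_event_subset[OF n, of c i] by (fastforce simp: k first_event_def)
    then show ?thesis by simp
  next
    case False
    then have ik: "i < k" using ij k by simp
    let ?E = "{\<omega> \<in> space P. c \<le> Z (node n i) \<omega> \<and> Z (node n k) \<omega> < c \<and> c \<le> Z (node n j) \<omega>}"
    have "prob (first_event c n i \<inter> first_event c n j) \<le> prob ?E"
    proof (rule finite_measure_mono)
      show "first_event c n i \<inter> first_event c n j \<subseteq> ?E"
        using first_event_subset[OF n, of c i] by (fastforce simp: k first_event_def)
      have [measurable]: "Z (node n i) \<in> borel_measurable P" "Z (node n k) \<in> borel_measurable P" "Z (node n j) \<in> borel_measurable P"
        using ij ik k by (auto intro!: Z_node_measurable n)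
      show "?E \<in> sets P" by measurable
    qed
    also have "\<dots> \<le> exp (- c\<^sup>2 / (2 * w))"
      using node_in[OF n, of i] node_in[OF n, of j] ij ik k
      by (intro triple_prob_le node_strict_mono n c) auto
    finally show ?thesis .
  qed
qed

text \<open>The largest chord bounds the relative loss in all upcrossing estimates at once, so the
  sum of the chords can be factored out. There are n + 1 events, one for the start and one for each
  cell.\<close>

lemma prob_grid_event_ge:
  assumes n: "n > 0" and K: "\<And>i. i < n \<Longrightarrow> chord n i \<le> k" "k \<le> 1" and c: "c \<ge> 1"
  shows "normal_tail c
     + (\<Sum>i<n. chord n i) * (1 - (c\<^sup>2 / 2 + 1) * k\<^sup>2) / (2 * pi) * exp (- c\<^sup>2 / 2)
     - (real (Suc n))\<^sup>2 * exp (- c\<^sup>2 / (2 * w)) \<le> prob (grid_event c n)"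
proof -
  have "(\<Sum>i<n. chord n i) * (1 - (c\<^sup>2 / 2 + 1) * k\<^sup>2) / (2 * pi) * exp (- c\<^sup>2 / 2)
    = (\<Sum>i<n. chord n i * ((1 - (c\<^sup>2 / 2 + 1) * k\<^sup>2) / (2 * pi) * exp (- c\<^sup>2 / 2)))"
    by (simp add: sum_distrib_right sum_divide_distrib mult.assoc)
  also have "\<dots> \<le> (\<Sum>i<n. prob (first_event c n (Suc i)))"
  proof (rule sum_mono)
    fix i assume i: "i \<in> {..<n}"
    define d where "d = chord n i"
    have d: "0 \<le> d" "d \<le> k" using K i by (auto simp: d_def chord_def)
    then have d2: "d\<^sup>2 \<le> k\<^sup>2" by (auto intro: power_mono)
    have "d * ((1 - (c\<^sup>2 / 2 + 1) * k\<^sup>2) / (2 * pi) * exp (- c\<^sup>2 / 2)) = d / (2 * pi) * exp (- c\<^sup>2 / 2) * (1 - (c\<^sup>2 / 2 + 1) * k\<^sup>2)"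
      by simp
    also have "\<dots> \<le> d / (2 * pi) * exp (- c\<^sup>2 / 2) * (1 - (c\<^sup>2 / 2 + 1) * d\<^sup>2)"
      using d d2 by (intro mult_left_mono diff_left_mono) auto
    also have "\<dots> \<le> prob (first_event c n (Suc i))"
      unfolding first_event_def nat.case
      by (rule upcrossing_bounds(2)) (use i n d K(2) c node_in[OF n] node_strict_mono[OF n] in \<open>auto simp: d_def chord_def\<close>)
    finally show "chord n i * ((1 - (c\<^sup>2 / 2 + 1) * k\<^sup>2) / (2 * pi) * exp (- c\<^sup>2 / 2)) \<le> prob (first_event c n (Suc i))"
      by (simp add: d_def)
  qed
  finally have "normal_tail c + (\<Sum>i<n. chord n i) * (1 - (c\<^sup>2 / 2 + 1) * k\<^sup>2) / (2 * pi) * exp (- c\<^sup>2 / 2)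
    \<le> (\<Sum>i<Suc n. prob (first_event c n i))"
    unfolding sum.lessThan_Suc_shift prob_first_event_0 by simp
  moreover have "(\<Sum>i<Suc n. prob (first_event c n i)) - (real (Suc n))\<^sup>2 * exp (- c\<^sup>2 / (2 * w)) \<le> prob (grid_event c n)"
    unfolding grid_event_eq[OF n]
    by (rule bonferroni_lower) (use first_event_sets[OF n] prob_first_event_pair[OF n _ _ c] in auto)
  ultimately show ?thesis by linarith
qed

section \<open>From grids to the supremum\<close>

definition sup_event :: "real \<Rightarrow> 'w set" where
  "sup_event c = {\<omega> \<in> space P. c \<le> (SUP t\<in>{a..b}. Z t \<omega>)}"

lemma Z_le_SUP:
  assumes "\<omega> \<in> space P" "t \<in> {a..b}"
  shows "Z t \<omega> \<le> (SUP t\<in>{a..b}. Z t \<omega>)"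
proof (rule cSUP_upper[OF assms(2)])
  have "compact ((\<lambda>t. Z t \<omega>) ` {a..b})" using Z_cont assms by (intro compact_continuous_image) auto
  then show "bdd_above ((\<lambda>t. Z t \<omega>) ` {a..b})" by (intro bounded_imp_bdd_above compact_imp_bounded)
qed

lemma grid_event_subset_sup_event: "n > 0 \<Longrightarrow> grid_event c n \<subseteq> sup_event c"
proof
  fix \<omega> assume n: "n > 0" and "\<omega> \<in> grid_event c n"
  then obtain i where i: "i \<le> n" "c \<le> Z (node n i) \<omega>" and \<omega>: "\<omega> \<in> space P" by (auto simp: grid_event_def)
  then show "\<omega> \<in> sup_event c"
    using order_trans[OF i(2) Z_le_SUP[OF \<omega> node_in[OF n i(1)]]] by (simp add: sup_event_def)
qed

text \<open>The maximum is attained, but perhaps at no node. By continuity every sufficiently fine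
  grid has a node where the path exceeds a strictly lower level.\<close>

lemma sup_event_eventually_grid:
  assumes \<omega>: "\<omega> \<in> sup_event c" and c': "c' < c"
  shows "eventually (\<lambda>n. \<omega> \<in> grid_event c' n) sequentially"
proof -
  have \<omega>P: "\<omega> \<in> space P" using \<omega> by (simp add: sup_event_def)
  obtain t where t: "t \<in> {a..b}" "\<And>s. s \<in> {a..b} \<Longrightarrow> Z s \<omega> \<le> Z t \<omega>"
    using continuous_attains_sup[OF compact_Icc _ Z_cont[OF \<omega>P]] ab by force
  have "(SUP t\<in>{a..b}. Z t \<omega>) \<le> Z t \<omega>" using ab t by (intro cSUP_least) auto
  then have "c' < Z t \<omega>" using \<omega> c' by (simp add: sup_event_def)
  then obtain e where e: "e > 0" "\<And>s. s \<in> {a..b} \<Longrightarrow> dist s t < e \<Longrightarrow> dist (Z s \<omega>) (Z t \<omega>) < Z t \<omega> - c'"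
    using Z_cont[OF \<omega>P, unfolded continuous_on_iff, rule_format, OF t(1), of "Z t \<omega> - c'"] by auto
  have "eventually (\<lambda>n. (b - a) / real n < e) sequentially"
    using order_tendstoD(2)[OF lim_const_over_n[of "b - a"] e(1)] .
  then show ?thesis using eventually_gt_at_top[of 0]
  proof eventually_elim
    case (elim n)
    obtain i where i: "i \<le> n" "\<bar>node n i - t\<bar> \<le> (b - a) / n" using node_approx[OF elim(2) t(1)] by blast
    then have "dist (Z (node n i) \<omega>) (Z t \<omega>) < Z t \<omega> - c'"
      using elim node_in[OF elim(2) i(1)] by (intro e(2)) (auto simp: dist_real_def)
    then have "c' \<le> Z (node n i) \<omega>" by (simp add: dist_real_def)
    then show ?case using i \<omega>P by (auto simp: grid_event_def)
  qed
qed

text \<open>The supremum runs over uncountably many variables; path continuity reduces it to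
  countably many grid events at levels increasing to c. The successor keeps the number of cells
  positive.\<close>

lemma sup_event_sets: "sup_event c \<in> sets P"
proof -
  have "sup_event c = (\<Inter>k. \<Union>n. grid_event (c - 1 / real (Suc k)) (Suc n))"
  proof (intro equalityI subsetI)
    fix \<omega> assume \<omega>: "\<omega> \<in> sup_event c"
    show "\<omega> \<in> (\<Inter>k. \<Union>n. grid_event (c - 1 / real (Suc k)) (Suc n))"
    proof
      fix k
      have "eventually (\<lambda>n. \<omega> \<in> grid_event (c - 1 / real (Suc k)) n) sequentially"
        by (rule sup_event_eventually_grid[OF \<omega>]) simp
      then obtain N where "\<And>n. n \<ge> N \<Longrightarrow> \<omega> \<in> grid_event (c - 1 / real (Suc k)) n"
        unfolding eventually_sequentially by blast
      then have "\<omega> \<in> grid_event (c - 1 / real (Suc k)) (Suc N)" by simp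
      then show "\<omega> \<in> (\<Union>n. grid_event (c - 1 / real (Suc k)) (Suc n))" by blast
    qed
  next
    fix \<omega> assume "\<omega> \<in> (\<Inter>k. \<Union>n. grid_event (c - 1 / real (Suc k)) (Suc n))"
    then have "\<omega> \<in> sup_event (c - 1 / real (Suc k))" for k
      using grid_event_subset_sup_event by blast
    then have \<omega>: "\<omega> \<in> space P" and le: "c - 1 / real (Suc k) \<le> (SUP t\<in>{a..b}. Z t \<omega>)" for k
      by (auto simp: sup_event_def)
    have "(\<lambda>k. c - 1 / real (Suc k)) \<longlonglongrightarrow> c - 0"
      by (intro tendsto_diff tendsto_const LIMSEQ_Suc[OF lim_1_over_n])
    then have "c - 0 \<le> (SUP t\<in>{a..b}. Z t \<omega>)" by (rule LIMSEQ_le_const2) (use le in blast)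
    then show "\<omega> \<in> sup_event c" using \<omega> by (simp add: sup_event_def)
  qed
  then show ?thesis by simp
qed

text \<open>Uniform grids with consecutive numbers of cells are not nested, so the grid events need
  not increase. Their lower limit does the job: it is an increasing union of the sets
  \<open>G N\<close>, each contained in a single grid event.\<close>

lemma prob_sup_event_le_aux:
  assumes c: "0 \<le> c'" "c' < c"
  shows "prob (sup_event c) \<le> normal_tail c' + arc_length b / (2 * pi) * exp (- c'\<^sup>2 / 2)"
proof -
  obtain K where K: "K > 0" "\<And>n i. n > 0 \<Longrightarrow> i < n \<Longrightarrow> chord n i \<le> K / n"
    by (rule chord_le) (assumption | rule that)+
  define G where "G N = (\<Inter>n\<in>{N..}. grid_event c' (Suc n))" for N
  have [measurable]: "G N \<in> sets P" for N unfolding G_def by measurable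
  have "incseq G" unfolding G_def by (intro monoI INF_superset_mono) auto
  have "prob (sup_event c) \<le> prob (\<Union>N. G N)"
  proof (rule finite_measure_mono)
    show "sup_event c \<subseteq> (\<Union>N. G N)"
    proof
      fix \<omega> assume "\<omega> \<in> sup_event c"
      from sup_event_eventually_grid[OF this c(2)] obtain N where "\<And>n. n \<ge> N \<Longrightarrow> \<omega> \<in> grid_event c' n"
        unfolding eventually_sequentially by blast
      then have "\<omega> \<in> G N" by (auto simp: G_def)
      then show "\<omega> \<in> (\<Union>N. G N)" by blast
    qed
  qed measurable
  also have "prob (\<Union>N. G N) \<le> normal_tail c' + arc_length b / (pi * sqrt (4 - 0\<^sup>2)) * exp (- c'\<^sup>2 / 2)"
  proof (rule LIMSEQ_le)
    show "(\<lambda>N. prob (G N)) \<longlonglongrightarrow> prob (\<Union>N. G N)"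
      using \<open>incseq G\<close> by (intro finite_Lim_measure_incseq) auto
    show "(\<lambda>N. normal_tail c' + arc_length b / (pi * sqrt (4 - (K / real (Suc N))\<^sup>2)) * exp (- c'\<^sup>2 / 2))
      \<longlonglongrightarrow> normal_tail c' + arc_length b / (pi * sqrt (4 - 0\<^sup>2)) * exp (- c'\<^sup>2 / 2)"
      by (intro tendsto_intros LIMSEQ_Suc[OF lim_const_over_n]) auto
    have "eventually (\<lambda>N. K / real (Suc N) < 1) sequentially"
      using order_tendstoD(2)[OF LIMSEQ_Suc[OF lim_const_over_n[of K]], of 1] by simp
    then obtain N0 where N0: "\<And>N. N \<ge> N0 \<Longrightarrow> K / real (Suc N) < 1" unfolding eventually_sequentially by blast
    have "prob (G N) \<le> normal_tail c' + arc_length b / (pi * sqrt (4 - (K / real (Suc N))\<^sup>2)) * exp (- c'\<^sup>2 / 2)"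
      if "N \<ge> N0" for N
    proof -
      have "prob (G N) \<le> prob (grid_event c' (Suc N))"
        by (rule finite_measure_mono) (auto simp: G_def)
      also have "\<dots> \<le> normal_tail c' + arc_length b / (pi * sqrt (4 - (K / real (Suc N))\<^sup>2)) * exp (- c'\<^sup>2 / 2)"
        by (rule prob_grid_event_le) (use K(2)[of "Suc N"] N0[OF that] c in auto)
      finally show ?thesis .
    qed
    then show "\<exists>N. \<forall>n\<ge>N. prob (G n) \<le> normal_tail c' + arc_length b / (pi * sqrt (4 - (K / real (Suc n))\<^sup>2)) * exp (- c'\<^sup>2 / 2)"
      by blast
  qed
  finally show ?thesis by (simp add: mult.commute)
qed

text \<open>Lets the auxiliary level rise to c. The normal tail is continuous there because the
  normal density is at most 1.\<close>

lemma prob_sup_event_le: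
  assumes c: "c > 0"
  shows "prob (sup_event c) \<le> normal_tail c + arc_length b / (2 * pi) * exp (- c\<^sup>2 / 2)"
proof -
  interpret N: real_distribution std_normal_distribution by (rule real_dist_normal_dist)
  have Q: "normal_tail c' \<le> normal_tail c + (c - c')" if "c' < c" for c'
  proof -
    have "normal_tail c' = measure std_normal_distribution ({c'..<c} \<union> {c..})"
      using that by (intro arg_cong[where f = "measure _"]) auto
    also have "\<dots> = measure std_normal_distribution {c'..<c} + normal_tail c"
      by (rule N.finite_measure_Union) auto
    also have "measure std_normal_distribution {c'..<c} \<le> c - c'"
    proof -
      have "emeasure std_normal_distribution {c'..<c} = (\<integral>\<^sup>+x. ennreal (std_normal_density x) * indicator {c'..<c} x \<partial>lborel)"
        by (rule emeasure_density) auto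
      also have "\<dots> \<le> (\<integral>\<^sup>+x. indicator {c'..<c} x \<partial>lborel)"
      proof (intro nn_integral_mono)
        fix x :: real
        have "1 \<le> sqrt (2 * pi)" using pi_gt3 by (simp add: real_le_rsqrt)
        then have "1 / sqrt (2 * pi) \<le> 1" by simp
        then have "std_normal_density x \<le> 1 * 1" unfolding std_normal_density_def by (intro mult_mono) auto
        then show "ennreal (std_normal_density x) * indicator {c'..<c} x \<le> indicator {c'..<c} x"
          by (auto split: split_indicator)
      qed
      also have "\<dots> = ennreal (c - c')" using that by simp
      finally show ?thesis using that by (simp add: N.emeasure_eq_measure)
    qed
    finally show ?thesis by simp
  qed
  have "eventually (\<lambda>c'. prob (sup_event c) \<le> normal_tail c + (c - c') + arc_length b / (2 * pi) * exp (- c'\<^sup>2 / 2)) (at_left c)"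
    using eventually_at_left_real[OF c]
  proof eventually_elim
    case (elim c')
    then show ?case using prob_sup_event_le_aux[of c' c] Q[of c'] by simp
  qed
  moreover have "((\<lambda>c'. normal_tail c + (c - c') + arc_length b / (2 * pi) * exp (- c'\<^sup>2 / 2)) \<longlongrightarrow>
     normal_tail c + (c - c) + arc_length b / (2 * pi) * exp (- c\<^sup>2 / 2)) (at_left c)"
    by (intro tendsto_intros) auto
  ultimately have "prob (sup_event c) \<le> normal_tail c + (c - c) + arc_length b / (2 * pi) * exp (- c\<^sup>2 / 2)"
    by (intro tendsto_lowerbound) auto
  then show ?thesis by simp
qed

end

section \<open>Lower bound for the supremum and size of the error\<close>

context gaussian_curve
begin

lemma prob_sup_event_ge:
  obtains C c0 where "\<And>c. c \<ge> c0 \<Longrightarrow>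
    normal_tail c + arc_length b / (2 * pi) * exp (- c\<^sup>2 / 2)
      - C * (exp (- c\<^sup>2 / 2) / c\<^sup>2) - (c\<^sup>2 + 2)\<^sup>2 * exp (- c\<^sup>2 / (2 * w)) \<le> prob (sup_event c)"
proof -
  obtain K where K: "K > 0" "\<And>n i. n > 0 \<Longrightarrow> i < n \<Longrightarrow> chord n i \<le> K / n"
    by (rule chord_le) (assumption | rule that)+
  define L where "L = 2 * B * (b - a)\<^sup>2"
  have L: "L \<ge> 0" using B by (simp add: L_def)
  define \<kappa> where "\<kappa> = arc_length b"
  have \<kappa>: "\<kappa> \<ge> 0" using arc_length_mono[of a b] ab by (simp add: \<kappa>_def)
  \<comment> \<open>\<open>L\<close> accounts for the chord sum falling short of the length, the
    other summand for the loss in the upcrossing estimates.\<close>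
  define C where "C = (L + \<kappa> * (2 * K\<^sup>2)) / (2 * pi)"
  \<comment> \<open>The three summands give c >= 1, the bound 2 K <= c that keeps chords and
    relative loss at most 1, and a mesh below \<delta>.\<close>
  define c0 where "c0 = 1 + 2 * K + (b - a) / \<delta>"
  have "normal_tail c + \<kappa> / (2 * pi) * exp (- c\<^sup>2 / 2)
      - C * (exp (- c\<^sup>2 / 2) / c\<^sup>2) - (c\<^sup>2 + 2)\<^sup>2 * exp (- c\<^sup>2 / (2 * w)) \<le> prob (sup_event c)"
    if c0: "c \<ge> c0" for c
  proof -
    have c: "c \<ge> 1" "c \<ge> 2 * K" "c > (b - a) / \<delta>"
      using c0 K(1) ab \<delta> divide_nonneg_pos[of "b - a" \<delta>] unfolding c0_def by linarith+
    have csq: "c \<le> c\<^sup>2" using c(1) mult_left_mono[of 1 c c] by (simp add: power2_eq_square)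
    \<comment> \<open>This many cells make both 1/n and c^2/n^2 of order 1/c^2.\<close>
    define n where "n = nat \<lceil>c\<^sup>2\<rceil>"
    have n: "c\<^sup>2 \<le> n" "real n \<le> c\<^sup>2 + 1" unfolding n_def by (auto simp: of_nat_ceiling)
    have n0: "n > 0" using n csq c by (cases n) auto
    have Kn: "K / n \<le> 1" using n csq c K n0 by (simp add: divide_le_eq)
    have "(b - a) / n < \<delta>"
    proof -
      have "(b - a) / \<delta> < n" using c csq n by linarith
      then show ?thesis using \<delta> n0 by (simp add: field_simps)
    qed
    then have S: "\<kappa> - L / n \<le> (\<Sum>i<n. chord n i)"
      using sum_chord_ge[OF n0] by (simp add: \<kappa>_def L_def)
    define \<rho> where "\<rho> = (c\<^sup>2 / 2 + 1) * (K / n)\<^sup>2"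
    have c2: "c\<^sup>2 > 0" using c by simp
    have \<rho>: "0 \<le> \<rho>" "\<rho> \<le> 2 * K\<^sup>2 / c\<^sup>2"
    proof -
      show "0 \<le> \<rho>" by (simp add: \<rho>_def)
      have "\<rho> \<le> (2 * c\<^sup>2) * (K / c\<^sup>2)\<^sup>2" unfolding \<rho>_def
        using n c2 K csq c n0 by (intro mult_mono power_mono divide_left_mono) auto
      also have "\<dots> = 2 * K\<^sup>2 / c\<^sup>2" using c2 by (simp add: power2_eq_square field_simps)
      finally show "\<rho> \<le> 2 * K\<^sup>2 / c\<^sup>2" .
    qed
    have "2 * K\<^sup>2 / c\<^sup>2 \<le> 1"
    proof -
      have "(2 * K)\<^sup>2 \<le> c\<^sup>2" using c K by (intro power_mono) auto
      then have "4 * K\<^sup>2 \<le> c\<^sup>2" by (simp add: power_mult_distrib)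
      then have "2 * K\<^sup>2 \<le> c\<^sup>2" using zero_le_power2[of K] by linarith
      then show ?thesis using c2 by simp
    qed
    then have \<rho>1: "\<rho> \<le> 1" using \<rho> by linarith
    have "\<kappa> - (L + \<kappa> * (2 * K\<^sup>2)) / c\<^sup>2 \<le> (\<Sum>i<n. chord n i) * (1 - \<rho>)"
    proof -
      have Ln: "L / n \<le> L / c\<^sup>2" using n c2 L n0 by (intro divide_left_mono) auto
      have "(\<kappa> - L / n) * (1 - \<rho>) \<le> (\<Sum>i<n. chord n i) * (1 - \<rho>)"
        using S \<rho>1 by (intro mult_right_mono) auto
      moreover have "(\<kappa> - L / n) * (1 - \<rho>) = \<kappa> - L / n - \<kappa> * \<rho> + (L / n) * \<rho>" by (simp add: algebra_simps diff_divide_distrib)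
      moreover have "(L / n) * \<rho> \<ge> 0" using L \<rho> by simp
      moreover have "\<kappa> * \<rho> \<le> \<kappa> * (2 * K\<^sup>2 / c\<^sup>2)" using \<rho> \<kappa> by (intro mult_left_mono) auto
      moreover have "(L + \<kappa> * (2 * K\<^sup>2)) / c\<^sup>2 = L / c\<^sup>2 + \<kappa> * (2 * K\<^sup>2 / c\<^sup>2)" by (simp add: add_divide_distrib)
      ultimately show ?thesis using Ln by linarith
    qed
    then have "(\<kappa> - (L + \<kappa> * (2 * K\<^sup>2)) / c\<^sup>2) / (2 * pi) * exp (- c\<^sup>2 / 2) \<le> (\<Sum>i<n. chord n i) * (1 - \<rho>) / (2 * pi) * exp (- c\<^sup>2 / 2)"
      by (intro mult_right_mono divide_right_mono) auto
    moreover have "(\<kappa> - (L + \<kappa> * (2 * K\<^sup>2)) / c\<^sup>2) / (2 * pi) * exp (- c\<^sup>2 / 2)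
      = \<kappa> / (2 * pi) * exp (- c\<^sup>2 / 2) - C * (exp (- c\<^sup>2 / 2) / c\<^sup>2)"
      by (simp add: C_def diff_divide_distrib left_diff_distrib right_diff_distrib mult.commute)
    moreover have "(real (Suc n))\<^sup>2 * exp (- c\<^sup>2 / (2 * w)) \<le> (c\<^sup>2 + 2)\<^sup>2 * exp (- c\<^sup>2 / (2 * w))"
      using n by (intro mult_right_mono power_mono) auto
    moreover have "normal_tail c + (\<Sum>i<n. chord n i) * (1 - \<rho>) / (2 * pi) * exp (- c\<^sup>2 / 2)
       - (real (Suc n))\<^sup>2 * exp (- c\<^sup>2 / (2 * w)) \<le> prob (grid_event c n)"
      unfolding \<rho>_def by (rule prob_grid_event_ge[OF n0 K(2)[OF n0] Kn c(1)])
    moreover have "prob (grid_event c n) \<le> prob (sup_event c)"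
      by (rule finite_measure_mono[OF grid_event_subset_sup_event[OF n0] sup_event_sets])
    ultimately show ?thesis by linarith
  qed
  then show thesis unfolding \<kappa>_def by (rule that)
qed

lemma small_error:
  "(\<lambda>c. C * (exp (- c\<^sup>2 / 2) / c\<^sup>2) + (c\<^sup>2 + 2)\<^sup>2 * exp (- c\<^sup>2 / (2 * w))) \<in> o[at_top](\<lambda>c. exp (- c\<^sup>2 / 2) / c)"
proof (rule sum_in_smallo)
  have "(\<lambda>c::real. exp (- c\<^sup>2 / 2) / c\<^sup>2) \<in> o[at_top](\<lambda>c. exp (- c\<^sup>2 / 2) / c)" by real_asymp
  then show "(\<lambda>c. C * (exp (- c\<^sup>2 / 2) / c\<^sup>2)) \<in> o[at_top](\<lambda>c. exp (- c\<^sup>2 / 2) / c)"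
    by (cases "C = 0") (simp_all del: times_divide_eq_right)
  \<comment> \<open>The surplus rate in exp(-c^2/(2w)) over exp(-c^2/2). It is positive because w <
    1, so it absorbs the polynomial factor.\<close>
  define k where "k = (1 / w - 1) / 2"
  have k: "k > 0" using w by (simp add: k_def)
  have "(\<lambda>c::real. (c\<^sup>2 + 2)\<^sup>2 * (exp (- c\<^sup>2 / 2) * exp (- k * c\<^sup>2))) \<in> o[at_top](\<lambda>c. exp (- c\<^sup>2 / 2) / c)"
    using k by real_asymp
  also have "(\<lambda>c. (c\<^sup>2 + 2)\<^sup>2 * (exp (- c\<^sup>2 / 2) * exp (- k * c\<^sup>2))) = (\<lambda>c. (c\<^sup>2 + 2)\<^sup>2 * exp (- c\<^sup>2 / (2 * w)))"
  proof
    fix c :: real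
    have "- c\<^sup>2 / 2 + - k * c\<^sup>2 = - c\<^sup>2 / (2 * w)" using w by (simp add: k_def field_simps)
    then show "(c\<^sup>2 + 2)\<^sup>2 * (exp (- c\<^sup>2 / 2) * exp (- k * c\<^sup>2)) = (c\<^sup>2 + 2)\<^sup>2 * exp (- c\<^sup>2 / (2 * w))"
      by (simp only: exp_add[symmetric])
  qed
  finally show "(\<lambda>c. (c\<^sup>2 + 2)\<^sup>2 * exp (- c\<^sup>2 / (2 * w))) \<in> o[at_top](\<lambda>c. exp (- c\<^sup>2 / 2) / c)" .
qed

lemma sup_tail_expansion:
  "(\<lambda>c. prob (sup_event c) - (normal_tail c + arc_length b / (2 * pi) * exp (- c\<^sup>2 / 2)))
    \<in> o[at_top](\<lambda>c. exp (- c\<^sup>2 / 2) / c)"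
proof -
  obtain C c0 where lower: "\<And>c. c \<ge> c0 \<Longrightarrow>
    normal_tail c + arc_length b / (2 * pi) * exp (- c\<^sup>2 / 2)
      - C * (exp (- c\<^sup>2 / 2) / c\<^sup>2) - (c\<^sup>2 + 2)\<^sup>2 * exp (- c\<^sup>2 / (2 * w)) \<le> prob (sup_event c)"
    by (rule prob_sup_event_ge) (assumption | rule that)+
  have "(\<lambda>c. prob (sup_event c) - (normal_tail c + arc_length b / (2 * pi) * exp (- c\<^sup>2 / 2)))
    \<in> O[at_top](\<lambda>c. C * (exp (- c\<^sup>2 / 2) / c\<^sup>2) + (c\<^sup>2 + 2)\<^sup>2 * exp (- c\<^sup>2 / (2 * w)))"
  proof (rule bigoI[of _ 1])
    show "\<forall>\<^sub>F c in at_top. norm (prob (sup_event c) - (normal_tail c + arc_length b / (2 * pi) * exp (- c\<^sup>2 / 2)))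
      \<le> 1 * norm (C * (exp (- c\<^sup>2 / 2) / c\<^sup>2) + (c\<^sup>2 + 2)\<^sup>2 * exp (- c\<^sup>2 / (2 * w)))"
      using eventually_ge_at_top[of c0] eventually_gt_at_top[of 0]
    proof eventually_elim
      case (elim c)
      show ?case using lower[OF elim(1)] prob_sup_event_le[OF elim(2)] by simp
    qed
  qed
  then show ?thesis by (rule landau_o.big_small_trans[OF _ small_error])
qed

end

section \<open>The tail of the supremum\<close>

definition l2_unit :: "nat \<Rightarrow> l2" where
  "l2_unit k = Abs_l2 (\<lambda>j. if j = k then 1 else 0)"

lemma inner_l2_unit: "x \<bullet> l2_unit k = coord x k"
proof -
  have "summable (\<lambda>j. (if j = k then 1 else 0 :: real)\<^sup>2)"
    by (rule summable_finite[of "{k}"]) auto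
  then have "coord (l2_unit k) = (\<lambda>j. if j = k then 1 else 0)"
    unfolding l2_unit_def by (subst Abs_l2_inverse) auto
  then have "x \<bullet> l2_unit k = (\<Sum>j. coord x j * (if j = k then 1 else 0))"
    by (simp add: inner_l2_def)
  also have "\<dots> = (\<Sum>j\<in>{k}. coord x j * (if j = k then 1 else 0))"
    by (rule suminf_finite) auto
  finally show ?thesis by simp
qed

text \<open>Provides the family \<open>W\<close> for the manifold lemmas: pairing with these vectors
  gives the coordinates, whose smoothness is what the expansion asserts.\<close>

lemma l2_unit_separating: "v \<noteq> 0 \<Longrightarrow> \<exists>w\<in>range l2_unit. v \<bullet> w \<noteq> 0"
proof -
  assume "v \<noteq> 0"
  then have "coord v \<noteq> coord 0" by (simp add: coord_inject)
  then obtain k where "coord v k \<noteq> 0" by (auto simp: zero_l2.rep_eq fun_eq_iff)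
  then show ?thesis by (auto simp: inner_l2_unit)
qed

text \<open>Coordinatewise continuity does not imply continuity in norm. The squared distance,
  however, is a combination of values of the kernel, so continuity of the kernel does.\<close>

lemma continuous_on_of_inner:
  fixes \<xi> :: "'t::topological_space \<Rightarrow> 'a::real_inner"
  assumes "continuous_on (S \<times> S) (\<lambda>(s, t). \<xi> s \<bullet> \<xi> t)"
  shows "continuous_on S \<xi>"
  unfolding continuous_on_def
proof
  fix x assume x: "x \<in> S"
  have c1: "continuous_on S (\<lambda>t. \<xi> t \<bullet> \<xi> t)"
    using continuous_on_compose2[OF assms, of S "\<lambda>t. (t, t)"]
    by (simp add: continuous_on_Pair continuous_on_fst continuous_on_snd continuous_on_id continuous_on_const image_subset_iff split_beta)
  have c2: "continuous_on S (\<lambda>t. \<xi> t \<bullet> \<xi> x)"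
    using continuous_on_compose2[OF assms, of S "\<lambda>t. (t, x)"] x
    by (simp add: continuous_on_Pair continuous_on_fst continuous_on_snd continuous_on_id continuous_on_const image_subset_iff split_beta)
  have "continuous_on S (\<lambda>t. sqrt (\<xi> t \<bullet> \<xi> t - 2 * (\<xi> t \<bullet> \<xi> x) + \<xi> x \<bullet> \<xi> x))"
    by (intro continuous_intros c1 c2)
  then have "((\<lambda>t. sqrt (\<xi> t \<bullet> \<xi> t - 2 * (\<xi> t \<bullet> \<xi> x) + \<xi> x \<bullet> \<xi> x)) \<longlongrightarrow> sqrt (\<xi> x \<bullet> \<xi> x - 2 * (\<xi> x \<bullet> \<xi> x) + \<xi> x \<bullet> \<xi> x)) (at x within S)"
    using x unfolding continuous_on_def by blast
  moreover have "sqrt (\<xi> t \<bullet> \<xi> t - 2 * (\<xi> t \<bullet> \<xi> x) + \<xi> x \<bullet> \<xi> x) = dist (\<xi> t) (\<xi> x)" for t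
    by (simp add: dist_norm norm_eq_sqrt_inner inner_diff_left inner_diff_right inner_commute algebra_simps)
  ultimately show "(\<xi> \<longlongrightarrow> \<xi> x) (at x within S)"
    unfolding tendsto_dist_iff[of \<xi>] by simp
qed

theorem theorem8:
  fixes X :: "(real^'s) set"
    and \<Lambda> :: "(real^'p) set" and lam0 :: "real^'p"
    and \<Theta> :: "real set"
    and f :: "real^'p \<Rightarrow> real^'s \<Rightarrow> real"
    and \<psi> :: "real \<Rightarrow> real^'s \<Rightarrow> real"
    and P :: "'w measure" and Z :: "real \<Rightarrow> 'w \<Rightarrow> real"
    and K :: "nat set" and z :: "nat \<Rightarrow> 'w \<Rightarrow> real" and \<xi> :: "real \<Rightarrow> l2"
  assumes X: "X \<in> sets borel"
    and f_density: "\<And>l. l \<in> \<Lambda> \<Longrightarrow> density_on X (f l)"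
    and \<psi>_density: "\<And>\<theta>. \<theta> \<in> \<Theta> \<Longrightarrow> density_on X (\<psi> \<theta>)"
    and lam0: "lam0 \<in> interior \<Lambda>"
    and gradient_exists: "\<And>x. x \<in> X \<Longrightarrow> f lam0 x > 0 \<Longrightarrow> (\<lambda>l. f l x) differentiable (at lam0)"
    and fisher_exists: "\<And>i j. set_integrable lborel X
          (\<lambda>x. score f lam0 x $ i * score f lam0 x $ j * f lam0 x)"
    and fisher_invertible: "invertible (fisher_info X f lam0)"
    and A1: "compact \<Theta>" "convex \<Theta>" "\<Theta> \<noteq> {}"
    and A2: "\<And>\<theta>. \<theta> \<in> \<Theta> \<Longrightarrow> set_integrable lborel X (\<lambda>x. \<psi> \<theta> x * \<psi> \<theta> x / f lam0 x)"
    and A3: "\<And>\<theta>. \<theta> \<in> \<Theta> \<Longrightarrow> supp_on X (\<psi> \<theta>) \<subseteq> supp_on X (f lam0)"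
    and A4_diff: "\<And>x \<theta>. x \<in> X \<Longrightarrow> \<theta> \<in> \<Theta> \<Longrightarrow>
          (\<lambda>t. \<psi> t x) differentiable (at \<theta> within \<Theta>) \<and>
          deriv_on \<Theta> (\<lambda>t. \<psi> t x) differentiable (at \<theta> within \<Theta>)"
    and A4_int1: "\<And>\<theta>. \<theta> \<in> \<Theta> \<Longrightarrow> set_integrable lborel X
          (\<lambda>x. (deriv_on \<Theta> (\<lambda>t. \<psi> t x) \<theta>)\<^sup>2 / f lam0 x)"
    and A4_int2: "\<And>\<theta>. \<theta> \<in> \<Theta> \<Longrightarrow> set_integrable lborel X
          (\<lambda>x. (deriv_on \<Theta> (deriv_on \<Theta> (\<lambda>t. \<psi> t x)) \<theta>)\<^sup>2 / f lam0 x)"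
    and A5: "\<And>\<theta>. \<theta> \<in> \<Theta> \<Longrightarrow> covC X f lam0 \<psi> \<theta> \<theta> > 0"
    and A6_cont: "continuous_on (\<Theta> \<times> \<Theta>) (\<lambda>(s, t). covC_star X f lam0 \<psi> s t)"
    and A6_pos: "\<And>\<theta>. \<theta> \<in> \<Theta> \<Longrightarrow> covC_star X f lam0 \<psi> \<theta> \<theta> > 0"
    and P: "prob_space P"
    and Z_gaussian: "gaussian_process P \<Theta> Z"
    and Z_mean: "\<And>\<theta>. \<theta> \<in> \<Theta> \<Longrightarrow> prob_space.expectation P (Z \<theta>) = 0"
    and Z_cov: "\<And>s t. s \<in> \<Theta> \<Longrightarrow> t \<in> \<Theta> \<Longrightarrow>
          prob_space.expectation P (\<lambda>\<omega>. Z s \<omega> * Z t \<omega>) = rho_star X f lam0 \<psi> s t"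
    and Z_cont: "\<And>\<omega>. \<omega> \<in> space P \<Longrightarrow> continuous_on \<Theta> (\<lambda>\<theta>. Z \<theta> \<omega>)"
    and KL: "karhunen_loeve P \<Theta> Z K z \<xi>"
    and \<xi>_inner: "\<And>s t. s \<in> \<Theta> \<Longrightarrow> t \<in> \<Theta> \<Longrightarrow> rho_star X f lam0 \<psi> s t = \<xi> s \<bullet> \<xi> t"
    and \<xi>_manifold: "inj_on \<xi> \<Theta>" "one_manifold_with_boundary (\<xi> ` \<Theta>)"
  shows "(let kappa0 = curve_length \<Theta> \<xi>; ell0 = card (end_points (\<xi> ` \<Theta>)) in
      (\<lambda>c. measure P {\<omega> \<in> space P. (SUP \<theta>\<in>\<Theta>. Z \<theta> \<omega>) \<ge> c}
            - (enn2real kappa0 / (2 * pi) * measure (chi_squared 2) {c\<^sup>2..}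
               + real ell0 / 4 * measure (chi_squared 1) {c\<^sup>2..}))
        \<in> o[at_top](\<lambda>c. exp (- c\<^sup>2 / 2) / c)
      \<and> kappa0 = ennreal (LINT \<theta>:\<Theta>|lborel. sqrt (mixed_deriv_on \<Theta> (rho_star X f lam0 \<psi>) \<theta> \<theta>))
      \<and> ell0 = 2)"
proof -
  interpret P: prob_space P by fact
  let ?r = "rho_star X f lam0 \<psi>"
  let ?C = "covC_star X f lam0 \<psi>"
  have r_cont: "continuous_on (\<Theta> \<times> \<Theta>) (\<lambda>(s, t). ?r s t)"
  proof -
    have C: "continuous_on (\<Theta> \<times> \<Theta>) (\<lambda>p. ?C (fst p) (snd p))"
      using A6_cont by (simp add: case_prod_beta')
    have C1: "continuous_on (\<Theta> \<times> \<Theta>) (\<lambda>p. ?C (fst p) (fst p))"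
      using continuous_on_compose2[OF C, of "\<Theta> \<times> \<Theta>" "\<lambda>p. (fst p, fst p)"]
      by (simp add: continuous_on_Pair continuous_on_fst continuous_on_snd continuous_on_id continuous_on_const image_subset_iff split_beta)
    have C2: "continuous_on (\<Theta> \<times> \<Theta>) (\<lambda>p. ?C (snd p) (snd p))"
      using continuous_on_compose2[OF C, of "\<Theta> \<times> \<Theta>" "\<lambda>p. (snd p, snd p)"]
      by (simp add: continuous_on_Pair continuous_on_fst continuous_on_snd continuous_on_id continuous_on_const image_subset_iff split_beta)
    have "?C s s * ?C t t \<noteq> 0" if "s \<in> \<Theta>" "t \<in> \<Theta>" for s t
      using A6_pos[OF that(1)] A6_pos[OF that(2)] by simp
    then have "continuous_on (\<Theta> \<times> \<Theta>) (\<lambda>p. ?C (fst p) (snd p) / sqrt (?C (fst p) (fst p) * ?C (snd p) (snd p)))"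
      by (intro continuous_on_divide continuous_on_real_sqrt continuous_on_mult C C1 C2) auto
    then show ?thesis by (simp add: rho_star_def case_prod_beta')
  qed
  have \<xi>_unit: "norm (\<xi> t) = 1" if "t \<in> \<Theta>" for t
  proof -
    have "?r t t = 1" using A6_pos[OF that] by (simp add: rho_star_def)
    then show ?thesis using \<xi>_inner[OF that that] by (simp add: norm_eq_sqrt_inner)
  qed
  have \<xi>_cont: "continuous_on \<Theta> \<xi>"
  proof (rule continuous_on_of_inner)
    show "continuous_on (\<Theta> \<times> \<Theta>) (\<lambda>(s, t). \<xi> s \<bullet> \<xi> t)"
      using r_cont by (rule continuous_on_cong[THEN iffD1, rotated 2]) (auto simp: \<xi>_inner)
  qed
  have "\<exists>a b. \<Theta> = cbox a b"
    using A1(1,2) is_interval_compact[of \<Theta>] by (simp add: is_interval_convex_1)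
  then obtain a b where \<Theta>: "\<Theta> = {a..b}" by auto
  \<comment> \<open>A degenerate interval would make the curve a single point, which is not a
    manifold of dimension one.\<close>
  have ab: "a < b"
  proof (rule ccontr)
    assume "\<not> a < b"
    then have "\<Theta> = {a}" using A1(3) \<Theta> by auto
    then show False using \<xi>_manifold(2) by (simp add: singleton_not_manifold)
  qed
  have C2: "C2_on {a..b} (\<lambda>t. \<xi> t \<bullet> w)" if w: "w \<in> range l2_unit" for w
  proof -
    obtain k where "w = l2_unit k" using w by blast
    then show ?thesis using KL unfolding karhunen_loeve_def \<Theta> by (simp add: inner_l2_unit)
  qed
  obtain D \<delta> B \<eta> where D: "\<And>t. t \<in> {a..b} \<Longrightarrow> (\<xi> has_vector_derivative D t) (at t within {a..b})"
    and \<delta>B: "\<delta> > 0" "B > 0"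
    and lip: "\<And>s t. s \<in> {a..b} \<Longrightarrow> t \<in> {a..b} \<Longrightarrow> \<bar>s - t\<bar> < \<delta> \<Longrightarrow> norm (D s - D t) \<le> B * \<bar>s - t\<bar>"
    and \<eta>: "\<eta> > 0" "\<And>s t u. a \<le> s \<Longrightarrow> s < t \<Longrightarrow> t < u \<Longrightarrow> u \<le> b \<Longrightarrow> contracting_triple (1 - \<eta>) (\<xi> s) (\<xi> t) (\<xi> u)"
    by (rule manifold_regular[OF ab \<xi>_cont[unfolded \<Theta>] \<xi>_manifold[unfolded \<Theta>] l2_unit_separating C2 \<xi>_unit[unfolded \<Theta>]])
      (assumption | rule that)+
  \<comment> \<open>The maximum with 1/2 keeps the variance bound positive, since 1 - \<eta> may be
    zero or negative.\<close>
  interpret gaussian_curve \<xi> D a b \<delta> B P Z "max (1 - \<eta>) (1 / 2)"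
  proof unfold_locales
    show "contracting_triple (max (1 - \<eta>) (1 / 2)) (\<xi> s) (\<xi> t) (\<xi> u)" if "a \<le> s" "s < t" "t < u" "u \<le> b" for s t u
      using \<eta>(2)[OF that] by (rule contracting_triple_mono) simp
  qed (use ab \<delta>B D lip \<eta> \<xi>_unit \<xi>_manifold Z_gaussian Z_mean Z_cov Z_cont \<xi>_inner \<Theta> in auto)
  have arc_length_nonneg: "arc_length b \<ge> 0" using arc_length_mono[of a b] ab by simp
  have ends: "card (end_points (\<xi> ` \<Theta>)) = 2"
  proof -
    have "\<xi> a \<noteq> \<xi> b" using inj_onD[OF \<xi>_manifold(1), of a b] ab \<Theta> by auto
    then show ?thesis
      using end_points_curve[OF \<xi>_cont[unfolded \<Theta>] inj _ \<xi>_manifold(2)[unfolded \<Theta>]] ab \<Theta> by simp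
  qed
  have mixed: "mixed_deriv_on {a..b} ?r t t = (norm (D t))\<^sup>2" if "t \<in> {a..b}" for t
    by (rule mixed_deriv_on_inner[OF _ that]) (use \<xi>_inner \<Theta> in auto)
  have "(LINT \<theta>:\<Theta>|lborel. sqrt (mixed_deriv_on \<Theta> ?r \<theta> \<theta>)) = (LINT \<theta>:\<Theta>|lborel. norm (D \<theta>))"
    unfolding \<Theta> by (rule set_lebesgue_integral_cong) (auto simp: mixed)
  then have kappa: "curve_length \<Theta> \<xi> = ennreal (LINT \<theta>:\<Theta>|lborel. sqrt (mixed_deriv_on \<Theta> ?r \<theta> \<theta>))"
    using curve_length_eq arc_length_eq_lborel \<Theta> by simp
  have "(\<lambda>c. measure P {\<omega> \<in> space P. (SUP \<theta>\<in>\<Theta>. Z \<theta> \<omega>) \<ge> c}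
            - (enn2real (curve_length \<Theta> \<xi>) / (2 * pi) * measure (chi_squared 2) {c\<^sup>2..}
               + real (card (end_points (\<xi> ` \<Theta>))) / 4 * measure (chi_squared 1) {c\<^sup>2..}))
        \<in> o[at_top](\<lambda>c. exp (- c\<^sup>2 / 2) / c)"
  proof (rule landau_o.small.in_cong[THEN iffD1, OF _ sup_tail_expansion])
    show "\<forall>\<^sub>F c in at_top. measure P (sup_event c) - (normal_tail c + arc_length b / (2 * pi) * exp (- c\<^sup>2 / 2)) =
       measure P {\<omega> \<in> space P. (SUP \<theta>\<in>\<Theta>. Z \<theta> \<omega>) \<ge> c}
            - (enn2real (curve_length \<Theta> \<xi>) / (2 * pi) * measure (chi_squared 2) {c\<^sup>2..}
               + real (card (end_points (\<xi> ` \<Theta>))) / 4 * measure (chi_squared 1) {c\<^sup>2..})"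
      using eventually_gt_at_top[of 0]
    proof eventually_elim
      case (elim c)
      have "enn2real (curve_length \<Theta> \<xi>) = arc_length b" using curve_length_eq arc_length_nonneg \<Theta> by simp
      \<comment> \<open>With two end-points the factor 2/4 times twice the normal tail is the normal
        tail itself.\<close>
      then show ?case
        using chi_squared_1_atLeast[OF elim] chi_squared_2_atLeast[of c] elim ends
        by (simp add: sup_event_def \<Theta>)
    qed
  qed
  then show ?thesis using kappa ends by (simp add: Let_def)
qed

end
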